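(* Let $l\ge 1$ be an arbitrary fixed integer, and consider the linear time-periodic problem described in the context. Assume that, for all $1\le j,k\le n$, the coefficients $a_j$, $b_{jk}$, $r_{jk}$ and $h_j$ belong to $C^{l}_{per}$; $f_j$ belong to $C^{l-1}_{per}\cap C_t^l$; $m_{jk}$ belong to $C^{l-1}_{per}\cap C_x^l$; and $p_{jk}$ belong to $C_{per}\cap C_t^l$ with $\partial_xp_{jk}\in C_t^{l-1}$, each on its respective domain. Assume also that $$a_j(x,t)\ne 0\quad\text{and}\quad a_j(x,t)\ne a_k(x,t)\qquad\text{for all }(x,t)\in\Pi\text{ and } j\ne k.$$ Moreover, let $W=(w_{jk})$ be a constant zero-one $n\times n$-matrix and let $r_{jk}(t)=\tilde r_{jk}(t)w_{jk}$, where $\tilde r_{jk}\in C^l_{per}$ for all $j,k\le n$. Assume that the matrix $W$ fulfills one of the following equivalent conditions: (i) the products $w_{i_1i_2}w_{i_2i_3}\cdots w_{i_ni_{n+1}}$ equal zero for all tuples $(i_1,\dots,i_{n+1})\in\{1,\dots,n\}^{n+1}$; (ii) all principal minors of the matrix $W$ equal zero; (iii) the matrix $W$ is nilpotent, with $W^n=0$; (iv) $W$ is the adjacency matrix of a directed acyclic graph. Then any continuous solution to the problem belongs to $C^l_{per}(\Pi;\mathbb R^n)$.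
   Context: Fix integers $n\ge 2$ and $0\le m\le n$. Let $\Pi=\{(x,t)\in\mathbb R^2: 0\le x\le 1\}$. Function spaces. For a domain $\Omega$ (such as $\Pi$, $\mathbb R$, or $\{(\xi,x,t):0\le\xi\le x\le1,\ t\in\mathbb R\}$), $C_{per}$ denotes the continuous functions on $\Omega$ that are $2\pi$-periodic in $t$, and $C^k_{per}=C^k\cap C_{per}$ (with $C^0_{per}=C_{per}$). $C_t^k$ (respectively $C_x^k$) is the space of continuous functions whose classical derivatives $\partial_t u,\dots,\partial_t^k u$ (respectively $\partial_x u,\dots,\partial_x^ku$) exist and are continuous on $\Omega$. The problem. The unknown is $u=(u_1,\dots,u_n):\Pi\to\mathbb R^n$, and the system is $$\partial_tu_j+a_j(x,t)\partial_xu_j+\sum_{k=1}^{n}b_{jk}(x,t)u_k+[Mu]_j(x,t)=f_j(x,t),\quad x\in(0,1),\ j\le n,$$ with boundary conditions $u_j(0,t)=[Ru]_j(t)+[Pu]_j(t)+h_j(t)$ for $1\le j\le m$, $u_j(1,t)=[Ru]_j(t)+[Pu]_j(t)+h_j(t)$ for $m<j\le n$, and the periodicity condition $u_j(x,t)=u_j(x,t+2\pi)$. Here $$[Mu]_j(x,t)=\sum_{k=1}^n\int_0^x m_{jk}(\xi,x,t)u_k(\xi,t)\,d\xi,\qquad [Pu]_j(t)=\sum_{k=1}^n\int_0^1p_{jk}(x,t)u_k(x,t)\,dx,$$ $$[Ru]_j(t)=\sum_{k=m+1}^n r_{jk}(t)u_k(0,t)+\sum_{k=1}^m r_{jk}(t)u_k(1,t).$$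 All coefficients are real-valued, continuous and $2\pi$-periodic in $t$; $a_j,b_{jk},f_j,p_{jk}$ are defined on $\Pi$, $m_{jk}$ on $\{0\le\xi\le x\le 1\}\times\mathbb R$, and $r_{jk},h_j$ on $\mathbb R$. The functions $a_j$ are continuously differentiable and nowhere zero, with $a_j>0$ for $j\le m$ and $a_j<0$ for $m<j\le n$. Set $x_j=0$ if $a_j>0$ and $x_j=1$ if $a_j<0$. Characteristics. For $(x,t)\in\Pi$, $\xi\in[0,1]\mapsto\omega_j(\xi)=\omega_j(\xi,x,t)$ is the solution of $\partial_\xi\omega_j(\xi,x,t)=1/a_j(\xi,\omega_j(\xi,x,t))$, $\omega_j(x,x,t)=t$. Continuous solution. Put $c_j(\xi,x,t)=\exp\int_x^\xi \frac{b_{jj}}{a_j}(\eta,\omega_j(\eta,x,t))\,d\eta$ and $d_j(\xi,x,t)=c_j(\xi,x,t)/a_j(\xi,\omega_j(\xi,x,t))$. A continuous solution is a function $u\in C_{per}(\Pi;\mathbb R^n)$ satisfying, for all $j\le n$ and $(x,t)\in\Pi$, $$u_j(x,t)=c_j(x_j,x,t)\big([Ru]_j+[Pu]_j+h_j\big)(\omega_j(x_j,x,t))+\int_{x_j}^x d_j(\xi,x,t)\Big(f_j-[Mu]_j-\sum_{k\ne j}b_{jk}u_k\Big)(\xi,\omega_j(\xi,x,t))\,d\xi.$$ *)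

theory Defs
  imports
    "HOL-Analysis.Analysis"
    "Jordan_Normal_Form.Determinant"
    "Jordan_Normal_Form.DL_Submatrix"
begin

text \<open>
  Components are numbered \<open>0, \<dots>, n - 1\<close> throughout: \<open>j < m\<close> are the components with positive
  speed, \<open>m \<le> j < n\<close> those with negative speed.
\<close>

subsection \<open>Function spaces\<close>

text \<open>
  Partial derivatives are taken within the domain, hence one-sided at boundary points. At the few
  boundary points where the domain contains no segment in direction \<open>e\<close> (on \<open>wedge\<close> below, e.g.,
  \<open>\<xi> = x = 1\<close> for the \<open>x\<close>-direction) the derivative condition is void, but the value of \<open>g\<close> is
  still determined as soon as \<open>g\<close> is required to be continuous.
\<close>

definition has_partial_on :: "'a::euclidean_space \<Rightarrow> 'a set \<Rightarrow> ('a \<Rightarrow> real) \<Rightarrow> ('a \<Rightarrow> real) \<Rightarrow> bool" where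
  "has_partial_on e S f g \<longleftrightarrow>
     (\<forall>p\<in>S. ((\<lambda>s. f (p + s *\<^sub>R e)) has_real_derivative g p) (at 0 within {s. p + s *\<^sub>R e \<in> S}))"

fun Ck_on :: "nat \<Rightarrow> 'a::euclidean_space set \<Rightarrow> ('a \<Rightarrow> real) \<Rightarrow> bool" where
  "Ck_on 0 S f \<longleftrightarrow> continuous_on S f"
| "Ck_on (Suc k) S f \<longleftrightarrow>
     continuous_on S f \<and> (\<forall>e\<in>Basis. \<exists>g. has_partial_on e S f g \<and> Ck_on k S g)"

fun Ck_dir_on :: "'a::euclidean_space \<Rightarrow> nat \<Rightarrow> 'a set \<Rightarrow> ('a \<Rightarrow> real) \<Rightarrow> bool" where
  "Ck_dir_on e 0 S f \<longleftrightarrow> continuous_on S f"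
| "Ck_dir_on e (Suc k) S f \<longleftrightarrow>
     continuous_on S f \<and> (\<exists>g. has_partial_on e S f g \<and> Ck_dir_on e k S g)"

text \<open>\<open>\<tau>\<close> is the unit vector of the time direction.\<close>

definition Ck_per :: "'a::euclidean_space \<Rightarrow> nat \<Rightarrow> 'a set \<Rightarrow> ('a \<Rightarrow> real) \<Rightarrow> bool" where
  "Ck_per \<tau> k S f \<longleftrightarrow> Ck_on k S f \<and> (\<forall>p\<in>S. f (p + (2 * pi) *\<^sub>R \<tau>) = f p)"

definition strip :: "(real \<times> real) set" where
  "strip = {(x, t). 0 \<le> x \<and> x \<le> 1}"

definition wedge :: "(real \<times> real \<times> real) set" where
  "wedge = {(\<xi>, x, t). 0 \<le> \<xi> \<and> \<xi> \<le> x \<and> x \<le> 1}"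


subsection \<open>The problem\<close>

definition M_op :: "nat \<Rightarrow> (nat \<Rightarrow> nat \<Rightarrow> real \<times> real \<times> real \<Rightarrow> real) \<Rightarrow>
    (nat \<Rightarrow> real \<times> real \<Rightarrow> real) \<Rightarrow> nat \<Rightarrow> real \<times> real \<Rightarrow> real" where
  "M_op n \<mu> u j = (\<lambda>(x, t). \<Sum>k<n. LBINT \<xi>=0..x. \<mu> j k (\<xi>, x, t) * u k (\<xi>, t))"

definition P_op :: "nat \<Rightarrow> (nat \<Rightarrow> nat \<Rightarrow> real \<times> real \<Rightarrow> real) \<Rightarrow>
    (nat \<Rightarrow> real \<times> real \<Rightarrow> real) \<Rightarrow> nat \<Rightarrow> real \<Rightarrow> real" where
  "P_op n p u j t = (\<Sum>k<n. LBINT x=0..1. p j k (x, t) * u k (x, t))"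

definition R_op :: "nat \<Rightarrow> nat \<Rightarrow> (nat \<Rightarrow> nat \<Rightarrow> real \<Rightarrow> real) \<Rightarrow>
    (nat \<Rightarrow> real \<times> real \<Rightarrow> real) \<Rightarrow> nat \<Rightarrow> real \<Rightarrow> real" where
  "R_op n m r u j t = (\<Sum>k=m..<n. r j k t * u k (0, t)) + (\<Sum>k<m. r j k t * u k (1, t))"

definition x_in :: "(nat \<Rightarrow> real \<times> real \<Rightarrow> real) \<Rightarrow> nat \<Rightarrow> real" where
  "x_in a j = (if \<forall>q\<in>strip. a j q > 0 then 0 else 1)"

text \<open>
  \<open>\<omega> j \<xi> x t\<close> is \<open>\<omega>\<^sub>j(\<xi>, x, t)\<close>. For speeds that are \<open>C\<^sup>1\<close>, periodic and nowhere zero, the family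
  \<open>\<omega>\<close> exists and is unique for \<open>j < n\<close>, \<open>\<xi> \<in> [0, 1]\<close>, \<open>(x, t) \<in> strip\<close>; other values are never used.
\<close>

definition characteristics :: "nat \<Rightarrow> (nat \<Rightarrow> real \<times> real \<Rightarrow> real) \<Rightarrow>
    (nat \<Rightarrow> real \<Rightarrow> real \<Rightarrow> real \<Rightarrow> real) \<Rightarrow> bool" where
  "characteristics n a \<omega> \<longleftrightarrow>
     (\<forall>j<n. \<forall>(x, t)\<in>strip.
        \<omega> j x x t = t \<and>
        (\<forall>\<xi>\<in>{0..1}. ((\<lambda>\<eta>. \<omega> j \<eta> x t) has_real_derivative 1 / a j (\<xi>, \<omega> j \<xi> x t))
                       (at \<xi> within {0..1})))"

definition c_fun :: "(nat \<Rightarrow> real \<times> real \<Rightarrow> real) \<Rightarrow> (nat \<Rightarrow> nat \<Rightarrow> real \<times> real \<Rightarrow> real) \<Rightarrow>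
    (nat \<Rightarrow> real \<Rightarrow> real \<Rightarrow> real \<Rightarrow> real) \<Rightarrow> nat \<Rightarrow> real \<Rightarrow> real \<Rightarrow> real \<Rightarrow> real" where
  "c_fun a b \<omega> j \<xi> x t =
     exp (LBINT \<eta>=x..\<xi>. b j j (\<eta>, \<omega> j \<eta> x t) / a j (\<eta>, \<omega> j \<eta> x t))"

definition d_fun :: "(nat \<Rightarrow> real \<times> real \<Rightarrow> real) \<Rightarrow> (nat \<Rightarrow> nat \<Rightarrow> real \<times> real \<Rightarrow> real) \<Rightarrow>
    (nat \<Rightarrow> real \<Rightarrow> real \<Rightarrow> real \<Rightarrow> real) \<Rightarrow> nat \<Rightarrow> real \<Rightarrow> real \<Rightarrow> real \<Rightarrow> real" where
  "d_fun a b \<omega> j \<xi> x t = c_fun a b \<omega> j \<xi> x t / a j (\<xi>, \<omega> j \<xi> x t)"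

definition continuous_solution ::
  "nat \<Rightarrow> nat \<Rightarrow> (nat \<Rightarrow> real \<times> real \<Rightarrow> real) \<Rightarrow> (nat \<Rightarrow> nat \<Rightarrow> real \<times> real \<Rightarrow> real) \<Rightarrow>
   (nat \<Rightarrow> nat \<Rightarrow> real \<times> real \<times> real \<Rightarrow> real) \<Rightarrow> (nat \<Rightarrow> nat \<Rightarrow> real \<times> real \<Rightarrow> real) \<Rightarrow>
   (nat \<Rightarrow> nat \<Rightarrow> real \<Rightarrow> real) \<Rightarrow> (nat \<Rightarrow> real \<times> real \<Rightarrow> real) \<Rightarrow> (nat \<Rightarrow> real \<Rightarrow> real) \<Rightarrow>
   (nat \<Rightarrow> real \<Rightarrow> real \<Rightarrow> real \<Rightarrow> real) \<Rightarrow> (nat \<Rightarrow> real \<times> real \<Rightarrow> real) \<Rightarrow> bool" where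
  "continuous_solution n m a b \<mu> p r f h \<omega> u \<longleftrightarrow>
     (\<forall>j<n. Ck_per (0, 1) 0 strip (u j)) \<and>
     (\<forall>j<n. \<forall>(x, t)\<in>strip.
        u j (x, t) =
          c_fun a b \<omega> j (x_in a j) x t *
            (let s = \<omega> j (x_in a j) x t in R_op n m r u j s + P_op n p u j s + h j s) +
          (LBINT \<xi>=x_in a j..x. d_fun a b \<omega> j \<xi> x t *
            (let q = (\<xi>, \<omega> j \<xi> x t)
             in f j q - M_op n \<mu> u j q - (\<Sum>k\<in>{..<n} - {j}. b j k q * u k q))))"


subsection \<open>Conditions on the zero-one matrix\<close>

definition zero_one_mat :: "nat \<Rightarrow> real mat \<Rightarrow> bool" where
  "zero_one_mat n W \<longleftrightarrow> W \<in> carrier_mat n n \<and> (\<forall>j<n. \<forall>k<n. W $$ (j, k) \<in> {0, 1})"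

text \<open>A tuple \<open>(i\<^sub>1, \<dots>, i\<^sub>n\<^sub>+\<^sub>1)\<close> is a function on \<open>{1..n + 1}\<close>.\<close>

definition path_products_zero :: "nat \<Rightarrow> real mat \<Rightarrow> bool" where
  "path_products_zero n W \<longleftrightarrow>
     (\<forall>i::nat \<Rightarrow> nat. (\<forall>s\<in>{1..n + 1}. i s < n) \<longrightarrow> (\<Prod>s=1..n. W $$ (i s, i (s + 1))) = 0)"

definition principal_minors_zero :: "nat \<Rightarrow> real mat \<Rightarrow> bool" where
  "principal_minors_zero n W \<longleftrightarrow>
     (\<forall>I. I \<subseteq> {..<n} \<and> I \<noteq> {} \<longrightarrow> Determinant.det (submatrix W I I) = 0)"

definition nth_power_zero :: "nat \<Rightarrow> real mat \<Rightarrow> bool" where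
  "nth_power_zero n W \<longleftrightarrow> W ^\<^sub>m n = 0\<^sub>m n n"

definition dag_adjacency :: "nat \<Rightarrow> real mat \<Rightarrow> bool" where
  "dag_adjacency n W \<longleftrightarrow>
     (\<exists>E. E \<subseteq> {..<n} \<times> {..<n} \<and> acyclic E \<and>
          W = Matrix.mat n n (\<lambda>(j, k). if (j, k) \<in> E then 1 else 0))"

end

theory Submission
  imports Defs
begin

text \<open>
  Along the characteristics the system reads \<open>(\<partial>\<^sub>x + s\<^sub>j \<partial>\<^sub>t) u\<^sub>j = \<dots>\<close> with \<open>s\<^sub>j = 1 / a\<^sub>j\<close>. If \<open>g\<close> is merely
  continuous but differentiable along the flow of a slope \<open>\<sigma>\<close>, then an integral of \<open>K g\<close> over a
  curve \<open>\<gamma>(\<cdot>, \<tau>)\<close> transversal to that flow is \<open>C\<^sup>1\<close> in \<open>\<tau>\<close>: formally \<open>g\<^sub>t = (d/d\<xi> g(\<xi>, \<gamma>) - g') / (\<gamma>\<^sub>\<xi> - \<sigma>)\<close>,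
  and the derivative in \<open>\<xi>\<close> is integrated by parts. This handles the terms \<open>b\<^sub>j\<^sub>k u\<^sub>k\<close> with \<open>k \<noteq> j\<close> (since
  \<open>a\<^sub>j \<noteq> a\<^sub>k\<close>), the term \<open>Mu\<close> (which is differentiable in \<open>x\<close>, i.e. along the flow of \<open>\<sigma> = 0\<close>) and \<open>Pu\<close>
  (curves \<open>t = const\<close>). Since the reflection graph is acyclic, the boundary values then become \<open>C\<^sup>1\<close>
  one component after the other.

  For higher order, treat \<open>Mu\<close> and \<open>Pu\<close> as data and note that \<open>v = \<partial>\<^sub>t u + Mu\<close> solves a system of the
  same type whose right-hand side involves \<open>\<partial>\<^sub>x Mu\<close> but not \<open>\<partial>\<^sub>t Mu\<close>. Hence only first-order
  differentiability of the flows is ever used.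
\<close>

section \<open>Calculus of partial derivatives\<close>

text \<open>The kernels of \<open>M\<close> have their last derivative in \<open>x\<close> only, so
  the time derivative of \<open>Mu\<close> is never available at the top order. Put
  \<open>f2 = - Mu\<close>. The source \<open>s * f2\<close> differentiated in time contains
  \<open>s * \<partial>\<^sub>t f2\<close>, and so does the derivative of \<open>f2\<close> along
  the characteristic; in \<open>\<partial>\<^sub>t u - f2\<close> the two cancel and only
  \<open>\<partial>\<^sub>x f2\<close> is left. This works because \<open>Mu\<close>, like every
  source, is divided by the speed. Sources are therefore kept in the form
  \<open>f1 + s * f2\<close>, where \<open>f1\<close> has its last derivative in \<open>t\<close>
  and \<open>f2\<close> has it in \<open>x\<close>, a form that the passage to the new unknown
  preserves. Two inductions are nested. The inner one raises the order for fixed sources. The outer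
  one feeds the solution back into them: when \<open>u\<close> is of class \<open>C^e\<close>,
  \<open>Mu\<close> gains one order in \<open>x\<close> and \<open>Pu\<close> one order in
  \<open>t\<close>, which is just enough for the inner result to give \<open>C^(e+1)\<close>. At the
  lowest order \<open>u\<close> is only continuous, so its partial derivatives may not occur even in
  intermediate formulas; this is why differentiability along a flow is a notion of its own.\<close>

fun Ck_dirs :: "'a::euclidean_space set \<Rightarrow> nat \<Rightarrow> 'a set \<Rightarrow> ('a \<Rightarrow> real) \<Rightarrow> bool" where
  "Ck_dirs B 0 S f \<longleftrightarrow> continuous_on S f"
| "Ck_dirs B (Suc k) S f \<longleftrightarrow>
     continuous_on S f \<and> (\<forall>e\<in>B. \<exists>g. has_partial_on e S f g \<and> Ck_dirs B k S g)"

lemma Ck_dirs_SucE: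
  assumes "Ck_dirs B (Suc k) S f" "e \<in> B"
  obtains g where "has_partial_on e S f g" "Ck_dirs B k S g"
  using assms unfolding Ck_dirs.simps by blast

text \<open>A single recursion over a set \<open>B\<close> of directions subsumes both notions of
  smoothness, so sums, products and quotients are treated once. \<open>B = Basis\<close> gives all
  mixed partials, a singleton only the pure ones.\<close>

lemma Ck_on_eq_Ck_dirs: "Ck_on k S f = Ck_dirs Basis k S f"
  by (induction k arbitrary: f) auto

lemma Ck_dir_on_eq_Ck_dirs: "Ck_dir_on e k S f = Ck_dirs {e} k S f"
  by (induction k arbitrary: f) auto

lemma Ck_dirs_imp_continuous_on: "Ck_dirs B k S f \<Longrightarrow> continuous_on S f"
  by (cases k) auto

lemma Ck_dirs_Suc_D: "Ck_dirs B (Suc k) S f \<Longrightarrow> Ck_dirs B k S f"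
  by (induction k arbitrary: f) (simp, fastforce)

lemma Ck_dirs_le: "Ck_dirs B k S f \<Longrightarrow> i \<le> k \<Longrightarrow> Ck_dirs B i S f"
  by (induction k) (auto dest: Ck_dirs_Suc_D simp: le_Suc_eq simp del: Ck_dirs.simps)

lemma Ck_dirs_subset: "Ck_dirs B k S f \<Longrightarrow> B' \<subseteq> B \<Longrightarrow> Ck_dirs B' k S f"
  by (induction k arbitrary: f) (simp, fastforce)

lemma has_partial_on_cong:
  assumes "\<And>p. p \<in> S \<Longrightarrow> f p = f' p" "\<And>p. p \<in> S \<Longrightarrow> g p = g' p"
  shows "has_partial_on e S f g \<longleftrightarrow> has_partial_on e S f' g'"
proof -
  have "((\<lambda>s. f (p + s *\<^sub>R e)) has_real_derivative g p) (at 0 within {s. p + s *\<^sub>R e \<in> S}) \<longleftrightarrow>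
        ((\<lambda>s. f' (p + s *\<^sub>R e)) has_real_derivative g' p) (at 0 within {s. p + s *\<^sub>R e \<in> S})"
    if "p \<in> S" for p
  proof -
    have "f (p + s *\<^sub>R e) = f' (p + s *\<^sub>R e)" if "p + s *\<^sub>R e \<in> S" for s
      using that assms(1) by blast
    hence *: "\<And>s. s \<in> {s. p + s *\<^sub>R e \<in> S} \<Longrightarrow> f (p + s *\<^sub>R e) = f' (p + s *\<^sub>R e)"
      "0 \<in> {s. p + s *\<^sub>R e \<in> S}" "g p = g' p" using \<open>p \<in> S\<close> assms by auto
    show ?thesis
      unfolding has_field_derivative_def \<open>g p = g' p\<close>
      using has_derivative_transform[OF *(2), of "\<lambda>s. f (p + s *\<^sub>R e)" "\<lambda>s. f' (p + s *\<^sub>R e)"]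
        has_derivative_transform[OF *(2), of "\<lambda>s. f' (p + s *\<^sub>R e)" "\<lambda>s. f (p + s *\<^sub>R e)"] *(1)
      by metis
  qed
  thus ?thesis by (auto simp: has_partial_on_def)
qed

lemma Ck_dirs_cong: "(\<And>p. p \<in> S \<Longrightarrow> f p = f' p) \<Longrightarrow> Ck_dirs B k S f \<longleftrightarrow> Ck_dirs B k S f'"
proof (induction k arbitrary: f f')
  case 0 thus ?case by (simp cong: continuous_on_cong)
next
  case (Suc k)
  have "has_partial_on e S f g \<longleftrightarrow> has_partial_on e S f' g" for e g
    by (rule has_partial_on_cong) (use Suc.prems in auto)
  moreover have "continuous_on S f = continuous_on S f'"
    by (rule continuous_on_cong) (use Suc.prems in auto)
  ultimately show ?case by simp
qed

lemma has_partial_on_const: "has_partial_on e S (\<lambda>p. c) (\<lambda>p. 0)"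
  by (simp add: has_partial_on_def)

lemma has_partial_on_add:
  "has_partial_on e S f f' \<Longrightarrow> has_partial_on e S g g' \<Longrightarrow>
   has_partial_on e S (\<lambda>p. f p + g p) (\<lambda>p. f' p + g' p)"
  by (auto simp: has_partial_on_def intro!: derivative_intros)

lemma has_partial_on_minus:
  "has_partial_on e S f f' \<Longrightarrow> has_partial_on e S (\<lambda>p. - f p) (\<lambda>p. - f' p)"
  by (auto simp: has_partial_on_def intro!: derivative_intros)

lemma has_partial_on_diff:
  "has_partial_on e S f f' \<Longrightarrow> has_partial_on e S g g' \<Longrightarrow>
   has_partial_on e S (\<lambda>p. f p - g p) (\<lambda>p. f' p - g' p)"
  by (auto simp: has_partial_on_def intro!: derivative_intros)

lemma has_partial_on_mult:
  assumes "has_partial_on e S f f'" "has_partial_on e S g g'"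
  shows "has_partial_on e S (\<lambda>p. f p * g p) (\<lambda>p. f' p * g p + f p * g' p)"
  unfolding has_partial_on_def
proof
  fix p assume "p \<in> S"
  with assms have "((\<lambda>s. f (p + s *\<^sub>R e) * g (p + s *\<^sub>R e)) has_real_derivative
     f' p * g (p + 0 *\<^sub>R e) + g' p * f (p + 0 *\<^sub>R e)) (at 0 within {s. p + s *\<^sub>R e \<in> S})"
    unfolding has_partial_on_def by (intro DERIV_mult) auto
  thus "((\<lambda>s. f (p + s *\<^sub>R e) * g (p + s *\<^sub>R e)) has_real_derivative
     f' p * g p + f p * g' p) (at 0 within {s. p + s *\<^sub>R e \<in> S})" by (simp add: mult.commute)
qed

lemma has_partial_on_inverse:
  assumes "has_partial_on e S f f'" "\<And>p. p \<in> S \<Longrightarrow> f p \<noteq> 0"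
  shows "has_partial_on e S (\<lambda>p. inverse (f p)) (\<lambda>p. - (inverse (f p) * f' p * inverse (f p)))"
  unfolding has_partial_on_def
proof
  fix p assume "p \<in> S"
  with assms have "((\<lambda>s. inverse (f (p + s *\<^sub>R e))) has_real_derivative
     - (inverse (f (p + 0 *\<^sub>R e)) * f' p * inverse (f (p + 0 *\<^sub>R e)))) (at 0 within {s. p + s *\<^sub>R e \<in> S})"
    unfolding has_partial_on_def by (intro DERIV_inverse') auto
  thus "((\<lambda>s. inverse (f (p + s *\<^sub>R e))) has_real_derivative
     - (inverse (f p) * f' p * inverse (f p))) (at 0 within {s. p + s *\<^sub>R e \<in> S})" by simp
qed

lemma has_partial_on_sum:
  "(\<And>i. i \<in> I \<Longrightarrow> has_partial_on e S (f i) (f' i)) \<Longrightarrow>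
   has_partial_on e S (\<lambda>p. \<Sum>i\<in>I. f i p) (\<lambda>p. \<Sum>i\<in>I. f' i p)"
  by (auto simp: has_partial_on_def intro!: derivative_intros)

lemma Ck_dirs_const: "Ck_dirs B k S (\<lambda>p. c)"
  by (induction k arbitrary: c) (auto intro: has_partial_on_const)

lemma Ck_dirs_add: "Ck_dirs B k S f \<Longrightarrow> Ck_dirs B k S g \<Longrightarrow> Ck_dirs B k S (\<lambda>p. f p + g p)"
proof (induction k arbitrary: f g)
  case (Suc k)
  show ?case
    unfolding Ck_dirs.simps
  proof (intro conjI ballI)
    fix e assume "e \<in> B"
    obtain f' where "has_partial_on e S f f'" "Ck_dirs B k S f'"
      by (rule Ck_dirs_SucE[OF Suc.prems(1) \<open>e \<in> B\<close>])
    moreover obtain g' where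
      "has_partial_on e S g g'" "Ck_dirs B k S g'" by (rule Ck_dirs_SucE[OF Suc.prems(2) \<open>e \<in> B\<close>])
    ultimately show "\<exists>h. has_partial_on e S (\<lambda>p. f p + g p) h \<and> Ck_dirs B k S h"
      using Suc.IH has_partial_on_add by blast
  qed (rule continuous_on_add[OF Suc.prems[THEN Ck_dirs_imp_continuous_on]])
qed (auto intro!: continuous_intros)

lemma Ck_dirs_mult: "Ck_dirs B k S f \<Longrightarrow> Ck_dirs B k S g \<Longrightarrow> Ck_dirs B k S (\<lambda>p. f p * g p)"
proof (induction k arbitrary: f g)
  case (Suc k)
  show ?case
    unfolding Ck_dirs.simps
  proof (intro conjI ballI)
    fix e assume "e \<in> B"
    obtain f' where f': "has_partial_on e S f f'" "Ck_dirs B k S f'"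
      by (rule Ck_dirs_SucE[OF Suc.prems(1) \<open>e \<in> B\<close>])
    obtain g' where
      g': "has_partial_on e S g g'" "Ck_dirs B k S g'" by (rule Ck_dirs_SucE[OF Suc.prems(2) \<open>e \<in> B\<close>])
    have "Ck_dirs B k S (\<lambda>p. f' p * g p + f p * g' p)"
      using Suc.prems[THEN Ck_dirs_Suc_D] f'(2) g'(2) by (intro Ck_dirs_add Suc.IH)
    thus "\<exists>h. has_partial_on e S (\<lambda>p. f p * g p) h \<and> Ck_dirs B k S h"
      using has_partial_on_mult[OF f'(1) g'(1)] by blast
  qed (rule continuous_on_mult[OF Suc.prems[THEN Ck_dirs_imp_continuous_on]])
qed (auto intro!: continuous_intros)

lemma Ck_dirs_minus: "Ck_dirs B k S f \<Longrightarrow> Ck_dirs B k S (\<lambda>p. - f p)"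
  using Ck_dirs_mult[OF Ck_dirs_const[of B k S "-1"]] by simp

lemma Ck_dirs_diff: "Ck_dirs B k S f \<Longrightarrow> Ck_dirs B k S g \<Longrightarrow> Ck_dirs B k S (\<lambda>p. f p - g p)"
  using Ck_dirs_add[OF _ Ck_dirs_minus, of B k S f g] by simp

lemma Ck_dirs_sum: "(\<And>i. i \<in> I \<Longrightarrow> Ck_dirs B k S (f i)) \<Longrightarrow> Ck_dirs B k S (\<lambda>p. \<Sum>i\<in>I. f i p)"
  by (induction I rule: infinite_finite_induct) (auto intro: Ck_dirs_add Ck_dirs_const)

lemma Ck_dirs_inverse:
  "Ck_dirs B k S f \<Longrightarrow> (\<And>p. p \<in> S \<Longrightarrow> f p \<noteq> 0) \<Longrightarrow> Ck_dirs B k S (\<lambda>p. inverse (f p))"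
proof (induction k arbitrary: f)
  case (Suc k)
  show ?case
    unfolding Ck_dirs.simps
  proof (intro conjI ballI)
    fix e assume "e \<in> B"
    obtain f' where *: "has_partial_on e S f f'" "Ck_dirs B k S f'"
      by (rule Ck_dirs_SucE[OF Suc.prems(1) \<open>e \<in> B\<close>])
    have "Ck_dirs B k S (\<lambda>p. - (inverse (f p) * f' p * inverse (f p)))"
      using Suc.prems(2) Ck_dirs_Suc_D[OF Suc.prems(1)] *(2) by (intro Ck_dirs_minus Ck_dirs_mult Suc.IH)
    thus "\<exists>h. has_partial_on e S (\<lambda>p. inverse (f p)) h \<and> Ck_dirs B k S h"
      using has_partial_on_inverse[OF *(1)] Suc.prems(2) by blast
  qed (rule continuous_on_inverse[OF Ck_dirs_imp_continuous_on[OF Suc.prems(1)]], use Suc.prems(2) in blast)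
qed (auto intro!: continuous_intros)

lemma Ck_dirs_divide:
  "Ck_dirs B k S f \<Longrightarrow> Ck_dirs B k S g \<Longrightarrow> (\<And>p. p \<in> S \<Longrightarrow> g p \<noteq> 0) \<Longrightarrow> Ck_dirs B k S (\<lambda>p. f p / g p)"
  unfolding divide_inverse by (intro Ck_dirs_mult Ck_dirs_inverse)

text \<open>Where the domain has no segment in direction \<open>e\<close> the derivative condition
  is void, so equality there cannot come from the derivative. Continuity carries it over from the
  nondegenerate points, which the closure hypothesis makes dense.\<close>

lemma has_partial_on_unique:
  assumes "has_partial_on e S f g" "has_partial_on e S f g'" "continuous_on S g" "continuous_on S g'"
    and "S \<subseteq> closure {p\<in>S. 0 islimpt {s. p + s *\<^sub>R e \<in> S}}" "p \<in> S"
  shows "g p = g' p"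
proof -
  let ?D = "{p\<in>S. 0 islimpt {s. p + s *\<^sub>R e \<in> S}}"
  have eq: "g q = g' q" if "q \<in> ?D" for q
  proof -
    have "at 0 within {s. q + s *\<^sub>R e \<in> S} \<noteq> bot" using that by (simp add: trivial_limit_within)
    thus ?thesis
      using assms(1,2) that unfolding has_partial_on_def by (intro has_field_derivative_unique) auto
  qed
  have "p \<in> closure ?D" using assms by auto
  then obtain X where X: "\<And>n. X n \<in> ?D" "X \<longlonglongrightarrow> p" unfolding closure_sequential by blast
  have "(\<lambda>n. g (X n)) \<longlonglongrightarrow> g p" "(\<lambda>n. g' (X n)) \<longlonglongrightarrow> g' p"
    using X assms(3,4,6) by (auto intro: continuous_on_tendsto_compose)
  moreover have "(\<lambda>n. g (X n)) = (\<lambda>n. g' (X n))" using X eq by auto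
  ultimately show ?thesis using LIMSEQ_unique by metis
qed

text \<open>Smoothness asserts only that some partial of the required order exists. This transfers
  the order to a partial given beforehand, so that two smoothness statements about \<open>f\<close>
  can speak about the same derivative.\<close>

lemma Ck_dirs_partial:
  assumes f: "Ck_dirs B (Suc k) S f" and e: "e \<in> B" and g: "has_partial_on e S f g" "continuous_on S g"
    and S: "S \<subseteq> closure {p\<in>S. 0 islimpt {s. p + s *\<^sub>R e \<in> S}}"
  shows "Ck_dirs B k S g"
proof -
  obtain g' where g': "has_partial_on e S f g'" "Ck_dirs B k S g'" using f e by auto
  have "g p = g' p" if "p \<in> S" for p
    using has_partial_on_unique[OF g(1) g'(1) g(2) Ck_dirs_imp_continuous_on[OF g'(2)] S that] .
  thus ?thesis using g'(2) Ck_dirs_cong by blast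
qed

subsection \<open>Functions on the strip\<close>

abbreviation x_partial :: "(real \<times> real \<Rightarrow> real) \<Rightarrow> (real \<times> real \<Rightarrow> real) \<Rightarrow> bool" where
  "x_partial \<equiv> has_partial_on (1, 0) strip"

abbreviation t_partial :: "(real \<times> real \<Rightarrow> real) \<Rightarrow> (real \<times> real \<Rightarrow> real) \<Rightarrow> bool" where
  "t_partial \<equiv> has_partial_on (0, 1) strip"

lemma has_partial_on_strip_x:
  "x_partial f g \<longleftrightarrow>
   (\<forall>x\<in>{0..1}. \<forall>t. ((\<lambda>x. f (x, t)) has_real_derivative g (x, t)) (at x within {0..1}))"
proof -
  have "((\<lambda>s. f ((x, t) + s *\<^sub>R (1, 0))) has_real_derivative D) (at 0 within {s. (x, t) + s *\<^sub>R (1, 0) \<in> strip})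
    \<longleftrightarrow> ((\<lambda>x. f (x, t)) has_real_derivative D) (at x within {0..1})" for x t D
  proof -
    have *: "{s. (x, t) + s *\<^sub>R (1, 0) \<in> strip} = (\<lambda>y. y - x) ` {0..1}"
      by (force simp: strip_def image_iff algebra_simps intro: exI[of _ "_ + x"])
    show ?thesis
      unfolding * using DERIV_at_within_shift[of "\<lambda>x. f (x, t)" D x 0 "(\<lambda>y. y - x) ` {0..1}"]
      by (simp add: image_image add.commute)
  qed
  thus ?thesis by (auto simp: has_partial_on_def strip_def)
qed

lemma has_partial_on_strip_t:
  "t_partial f g \<longleftrightarrow>
   (\<forall>x\<in>{0..1}. \<forall>t. ((\<lambda>t. f (x, t)) has_real_derivative g (x, t)) (at t))"
proof -
  have "((\<lambda>s. f ((x, t) + s *\<^sub>R (0, 1))) has_real_derivative D) (at 0 within {s. (x, t) + s *\<^sub>R (0, 1) \<in> strip})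
    \<longleftrightarrow> ((\<lambda>t. f (x, t)) has_real_derivative D) (at t)" if "x \<in> {0..1}" for x t D
  proof -
    have *: "{s. (x, t) + s *\<^sub>R (0, 1) \<in> strip} = UNIV" using that by (auto simp: strip_def)
    show ?thesis
      unfolding * using DERIV_at_within_shift[of "\<lambda>t. f (x, t)" D t 0 UNIV]
      by (simp add: surj_plus)
  qed
  thus ?thesis by (auto simp: has_partial_on_def strip_def)
qed

lemma has_partial_on_real:
  "has_partial_on (1::real) UNIV f g \<longleftrightarrow> (\<forall>t. (f has_real_derivative g t) (at t))"
  using DERIV_at_within_shift[of f _ _ 0 UNIV]
  by (simp add: has_partial_on_def surj_plus)

lemma mem_strip [simp]: "(x, t) \<in> strip \<longleftrightarrow> 0 \<le> x \<and> x \<le> 1"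
  by (auto simp: strip_def)

lemma strip_eq_Times: "strip = {0..1} \<times> UNIV"
  by (auto simp: strip_def)

lemma strip_nondegenerate_x: "strip \<subseteq> closure {p\<in>strip. 0 islimpt {s. p + s *\<^sub>R (1, 0) \<in> strip}}"
proof -
  have "0 islimpt {s. p + s *\<^sub>R (1, 0) \<in> strip}" if "p \<in> strip" for p
  proof -
    obtain x t where xt: "p = (x, t)" by (cases p)
    with that have p: "p = (x, t)" "0 \<le> x" "x \<le> 1" by simp_all
    have "{s. p + s *\<^sub>R (1, 0) \<in> strip} = {-x..1-x}" using p by auto
    thus ?thesis using p by (simp add: islimpt_Icc)
  qed
  thus ?thesis by (metis (mono_tags, lifting) closure_subset mem_Collect_eq subset_iff)
qed

lemma strip_nondegenerate_t: "strip \<subseteq> closure {p\<in>strip. 0 islimpt {s. p + s *\<^sub>R (0, 1) \<in> strip}}"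
proof -
  have "0 islimpt {s. p + s *\<^sub>R (0, 1) \<in> strip}" if "p \<in> strip" for p
  proof -
    have "{s. p + s *\<^sub>R (0, 1) \<in> strip} = UNIV" using that by (cases p) auto
    thus ?thesis by (simp add: islimpt_UNIV)
  qed
  thus ?thesis by (metis (mono_tags, lifting) closure_subset mem_Collect_eq subset_iff)
qed

lemma Basis_real_pair: "(Basis :: (real \<times> real) set) = {(1, 0), (0, 1)}"
  by (auto simp: Basis_prod_def)

lemma Ck_dirs_trace:
  assumes "Ck_dirs {(0, 1)} k strip u" "x \<in> {0..1}"
  shows "Ck_dirs {1} k UNIV (\<lambda>t. u (x, t))"
  using assms(1)
proof (induction k arbitrary: u)
  case 0
  thus ?case using assms(2)
    by (auto intro!: continuous_on_compose2[of strip u] continuous_intros)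
next
  case (Suc k)
  from Suc.prems obtain g where g: "t_partial u g" "Ck_dirs {(0, 1)} k strip g"
    by (rule Ck_dirs_SucE) simp
  have "continuous_on UNIV (\<lambda>t. u (x, t))"
    using Ck_dirs_imp_continuous_on[OF Suc.prems] assms(2)
    by (auto intro!: continuous_on_compose2[of strip u] continuous_intros)
  moreover have "has_partial_on 1 UNIV (\<lambda>t. u (x, t)) (\<lambda>t. g (x, t))"
    using g(1) assms(2) unfolding has_partial_on_strip_t has_partial_on_real by auto
  ultimately show ?case using Suc.IH[OF g(2)] by auto
qed

section \<open>Integrals depending on a parameter\<close>

text \<open>The substitution \<open>\<xi> = x * \<eta>\<close> moves the variable limit into the
  integrand, so that continuity theorems for integrals over a fixed interval apply.\<close>

lemma integral_0x_rescale:
  fixes g :: "real \<Rightarrow> real"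
  assumes "continuous_on {0..x} g" "0 \<le> x"
  shows "integral {0..x} g = x * integral {0..1} (\<lambda>\<eta>. g (x * \<eta>))"
proof -
  have "((\<lambda>\<eta>. x *\<^sub>R g (x * \<eta>)) has_integral integral {x * 0..x * 1} g) {0..1}"
    using assms
    by (intro has_integral_substitution[where c = 0 and d = x])
       (auto intro!: derivative_eq_intros mult_left_le)
  from integral_unique[OF this] show ?thesis by simp
qed

lemma continuous_on_integral_0x:
  fixes g :: "real \<Rightarrow> 'b::topological_space \<Rightarrow> real"
  assumes "continuous_on ({0..1} \<times> S) (\<lambda>p. g (fst p) (snd p))"
  shows "continuous_on ({0..1} \<times> S) (\<lambda>p. integral {0..fst p} (\<lambda>\<xi>. g \<xi> (snd p)))"
proof -
  have "continuous_on ({0..1} \<times> S) (\<lambda>p. integral (cbox 0 1) (\<lambda>\<eta>. g (fst p * \<eta>) (snd p)))"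
  proof (rule integral_continuous_on_param)
    show "continuous_on (({0..1} \<times> S) \<times> cbox 0 1) (\<lambda>(p, \<eta>). g (fst p * \<eta>) (snd p))"
      unfolding case_prod_unfold
      by (rule continuous_on_compose2[OF assms, of _ "\<lambda>q. (fst (fst q) * snd q, snd (fst q))", simplified])
         (auto intro!: continuous_intros mult_le_one)
  qed
  hence "continuous_on ({0..1} \<times> S) (\<lambda>p. fst p * integral {0..1} (\<lambda>\<eta>. g (fst p * \<eta>) (snd p)))"
    by (auto intro!: continuous_intros)
  also have "?this \<longleftrightarrow> ?thesis"
  proof (rule continuous_on_cong[OF refl])
    fix p :: "real \<times> 'b" assume p: "p \<in> {0..1} \<times> S"
    have "continuous_on {0..fst p} (\<lambda>\<xi>. g \<xi> (snd p))"
      by (rule continuous_on_compose2[OF assms, of _ "\<lambda>\<xi>. (\<xi>, snd p)", simplified])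
         (use p in \<open>auto intro!: continuous_intros\<close>)
    thus "fst p * integral {0..1} (\<lambda>\<eta>. g (fst p * \<eta>) (snd p)) =
          integral {0..fst p} (\<lambda>\<xi>. g \<xi> (snd p))"
      using p by (subst integral_0x_rescale) auto
  qed
  finally show ?thesis .
qed

lemma continuous_on_strip_x: "continuous_on strip g \<Longrightarrow> continuous_on {0..1} (\<lambda>x. g (x, t))"
  by (rule continuous_on_compose2[of strip g]) (auto intro!: continuous_intros)

lemma continuous_on_strip_compose:
  assumes "continuous_on strip g" "continuous_on S \<xi>" "continuous_on S \<theta>" "\<And>p. p \<in> S \<Longrightarrow> \<xi> p \<in> {0..1}"
  shows "continuous_on S (\<lambda>p. g (\<xi> p, \<theta> p))"
  by (rule continuous_on_compose2[OF assms(1)]) (use assms in \<open>auto intro!: continuous_intros\<close>)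

definition prim :: "(real \<times> real \<Rightarrow> real) \<Rightarrow> real \<times> real \<Rightarrow> real" where
  "prim g p = integral {0..fst p} (\<lambda>\<xi>. g (\<xi>, snd p))"

lemma cont_prim: "continuous_on strip g \<Longrightarrow> continuous_on strip (prim g)"
  using continuous_on_integral_0x[of UNIV "\<lambda>\<xi> t. g (\<xi>, t)"]
  unfolding strip_eq_Times prim_def by simp

lemma integral_0x_has_derivative:
  fixes g :: "real \<Rightarrow> real"
  assumes "continuous_on {0..1} g" "x \<in> {0..1}"
  shows "((\<lambda>x. integral {0..x} g) has_real_derivative g x) (at x within {0..1})"
  using integral_has_real_derivative[OF assms(1)] assms(2) by simp

lemma prim_x: "continuous_on strip g \<Longrightarrow> x_partial (prim g) g"
  using integral_0x_has_derivative[OF continuous_on_strip_x]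
  by (auto simp: has_partial_on_strip_x prim_def)

lemma prim_t:
  assumes "t_partial K K'" "continuous_on strip K" "continuous_on strip K'"
  shows "t_partial (prim K) (prim K')"
  unfolding has_partial_on_strip_t
proof (intro ballI allI)
  fix x t :: real assume x: "x \<in> {0..1}"
  have "((\<lambda>t. integral (cbox 0 x) (\<lambda>\<xi>. K (\<xi>, t))) has_field_derivative
      integral (cbox 0 x) (\<lambda>\<xi>. K' (\<xi>, t))) (at t within UNIV)"
  proof (rule leibniz_rule_field_derivative)
    show "(\<lambda>\<xi>. K (\<xi>, t)) integrable_on cbox 0 x" for t
      by (rule integrable_continuous) (use x in \<open>auto intro!: continuous_on_strip_compose[OF assms(2)] continuous_intros\<close>)
    show "continuous_on (UNIV \<times> cbox 0 x) (\<lambda>(t, \<xi>). K' (\<xi>, t))"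
      unfolding case_prod_unfold
      by (rule continuous_on_strip_compose[OF assms(3)]) (use x in \<open>auto intro!: continuous_intros\<close>)
  qed (use assms(1) x in \<open>auto simp: has_partial_on_strip_t\<close>)
  thus "((\<lambda>t. prim K (x, t)) has_real_derivative prim K' (x, t)) (at t)" by (simp add: prim_def)
qed

lemma FTC_0x:
  fixes H h :: "real \<Rightarrow> real"
  assumes "\<And>\<xi>. \<xi> \<in> {0..1} \<Longrightarrow> (H has_real_derivative h \<xi>) (at \<xi> within {0..1})" "x \<in> {0..1}"
  shows "(h has_integral (H x - H 0)) {0..x}"
  using assms
  by (intro fundamental_theorem_of_calculus)
     (auto simp: has_real_derivative_iff_has_vector_derivative[symmetric] intro!: DERIV_subset[OF assms(1)])

lemma prim_eq_diff:
  assumes "x_partial H h" "x \<in> {0..1}"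
  shows "prim h (x, t) = H (x, t) - H (0, t)"
proof -
  have "((\<lambda>\<xi>. h (\<xi>, t)) has_integral H (x, t) - H (0, t)) {0..x}"
    using assms by (intro FTC_0x) (auto simp: has_partial_on_strip_x)
  thus ?thesis by (simp add: prim_def integral_unique)
qed

lemma prim_integrable:
  fixes g :: "real \<times> real \<Rightarrow> real"
  assumes "continuous_on strip g" "x \<in> {0..1}"
  shows "(\<lambda>\<xi>. g (\<xi>, t)) integrable_on {0..x}"
  by (rule integrable_continuous_real, rule continuous_on_strip_compose[OF assms(1)])
     (use assms(2) in \<open>auto intro!: continuous_intros\<close>)

lemma prim_cong: "x \<in> {0..1} \<Longrightarrow> (\<And>p. p \<in> strip \<Longrightarrow> f p = g p) \<Longrightarrow> prim f (x, t) = prim g (x, t)"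
  unfolding prim_def by (rule integral_cong) auto

lemma prim_add:
  assumes "continuous_on strip f" "continuous_on strip g" "x \<in> {0..1}"
  shows "prim (\<lambda>p. f p + g p) (x, t) = prim f (x, t) + prim g (x, t)"
  using assms by (simp add: prim_def integral_add prim_integrable)

lemma prim_sum:
  assumes "finite I" "\<And>i. i \<in> I \<Longrightarrow> continuous_on strip (f i)" "x \<in> {0..1}"
  shows "prim (\<lambda>p. \<Sum>i\<in>I. f i p) (x, t) = (\<Sum>i\<in>I. prim (f i) (x, t))"
  unfolding prim_def fst_conv snd_conv
  by (rule integral_sum) (use assms prim_integrable in auto)

subsection \<open>Mean slopes and the chain rule along curves\<close>

text \<open>Hadamard's quotient of \<open>Z\<close> in its second argument when \<open>Zt\<close> is
  the \<open>t\<close>-partial of \<open>Z\<close>. For continuous \<open>Zt\<close> it is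
  continuous in all arguments, also where \<open>a = b\<close>, and so replaces limits of difference
  quotients.\<close>

definition mean_slope :: "(real \<times> real \<Rightarrow> real) \<Rightarrow> real \<Rightarrow> real \<Rightarrow> real \<Rightarrow> real" where
  "mean_slope Zt \<xi> a b = integral {0..1} (\<lambda>s. Zt (\<xi>, a + s * (b - a)))"

lemma mean_slope_self [simp]: "mean_slope Zt \<xi> a a = Zt (\<xi>, a)"
  by (simp add: mean_slope_def)

lemma mean_slope:
  assumes "t_partial Z Zt" "\<xi> \<in> {0..1}"
  shows "Z (\<xi>, b) - Z (\<xi>, a) = mean_slope Zt \<xi> a b * (b - a)"
proof -
  have "((\<lambda>s. Zt (\<xi>, a + s * (b - a)) * (b - a)) has_integral
     (Z (\<xi>, a + 1 * (b - a)) - Z (\<xi>, a + 0 * (b - a)))) {0..1}"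
  proof (rule FTC_0x)
    fix s :: real
    have "((\<lambda>s. Z (\<xi>, a + s * (b - a))) has_real_derivative Zt (\<xi>, a + s * (b - a)) * (b - a)) (at s)"
      using assms by (intro DERIV_chain2[of "\<lambda>t. Z (\<xi>, t)"])
        (auto simp: has_partial_on_strip_t intro!: derivative_eq_intros)
    thus "((\<lambda>s. Z (\<xi>, a + s * (b - a))) has_real_derivative Zt (\<xi>, a + s * (b - a)) * (b - a))
      (at s within {0..1})" by (rule DERIV_subset) auto
  qed auto
  from integral_unique[OF this] show ?thesis by (simp add: mean_slope_def)
qed

lemma continuous_on_mean_slope:
  assumes "continuous_on strip Zt" "continuous_on S \<xi>" "continuous_on S a" "continuous_on S b"
    and "\<And>p. p \<in> S \<Longrightarrow> \<xi> p \<in> {0..1}"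
  shows "continuous_on S (\<lambda>p. mean_slope Zt (\<xi> p) (a p) (b p))"
proof -
  have fst': "continuous_on (S \<times> cbox 0 (1::real)) (\<lambda>q. f (fst q))" if "continuous_on S f" for f :: "_ \<Rightarrow> real"
    by (rule continuous_on_compose2[OF that]) (auto intro!: continuous_intros)
  have "continuous_on S (\<lambda>p. integral (cbox 0 1) (\<lambda>s. Zt (\<xi> p, a p + s * (b p - a p))))"
    by (rule integral_continuous_on_param, unfold case_prod_unfold)
       (intro continuous_on_strip_compose[OF assms(1)] continuous_intros fst' assms; use assms(5) in auto)
  thus ?thesis by (simp add: mean_slope_def)
qed

lemma mean_slope_abs_le:
  assumes "continuous_on strip Zt" "\<And>p. p \<in> strip \<Longrightarrow> \<bar>Zt p\<bar> \<le> L" "\<xi> \<in> {0..1}"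
  shows "\<bar>mean_slope Zt \<xi> a b\<bar> \<le> L"
proof -
  have "norm (integral {0..1} (\<lambda>s. Zt (\<xi>, a + s * (b - a)))) \<le> L * (1 - 0)"
    by (rule integral_bound)
       (use assms in \<open>auto intro!: continuous_on_strip_compose[OF assms(1)] continuous_intros\<close>)
  thus ?thesis by (simp add: mean_slope_def)
qed

text \<open>Only the \<open>t\<close>-partial of \<open>Z\<close> enters, so that \<open>x\<close>-partials can be traded against derivatives
  along curves.\<close>

lemma increment_along_curve_has_derivative:
  assumes Z: "t_partial Z Zt" "continuous_on strip Zt"
    and \<gamma>: "(\<gamma> has_real_derivative \<gamma>') (at x within {0..1})" and x: "x \<in> {0..1}"
  shows "((\<lambda>\<xi>. Z (\<xi>, \<gamma> \<xi>) - Z (\<xi>, \<gamma> x)) has_real_derivative Zt (x, \<gamma> x) * \<gamma>') (at x within {0..1})"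
proof -
  define h where "h \<xi> b = mean_slope Zt \<xi> (\<gamma> x) b" for \<xi> b
  have cont: "continuous_on ({0..1} \<times> UNIV) (\<lambda>p. h (fst p) (snd p))"
    unfolding h_def using Z(2) by (intro continuous_on_mean_slope continuous_intros) auto
  have lim: "((\<lambda>\<xi>. (\<xi>, \<gamma> \<xi>)) \<longlongrightarrow> (x, \<gamma> x)) (at x within {0..1})"
    using DERIV_continuous[OF \<gamma>] by (intro tendsto_intros) (auto simp: continuous_within)
  have ev: "\<forall>\<^sub>F \<xi> in at x within {0..1}. (\<xi>, \<gamma> \<xi>) \<in> {0..1} \<times> UNIV"
    by (auto simp: eventually_at_filter)
  have "((\<lambda>\<xi>. h (fst (\<xi>, \<gamma> \<xi>)) (snd (\<xi>, \<gamma> \<xi>))) \<longlongrightarrow> h (fst (x, \<gamma> x)) (snd (x, \<gamma> x))) (at x within {0..1})"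
    using continuous_on_tendsto_compose[OF cont lim _ ev] x by simp
  hence "((\<lambda>\<xi>. h \<xi> (\<gamma> \<xi>) * ((\<gamma> \<xi> - \<gamma> x) / (\<xi> - x))) \<longlongrightarrow> h x (\<gamma> x) * \<gamma>') (at x within {0..1})"
    using \<gamma> by (intro tendsto_mult) (auto simp: has_field_derivative_iff)
  hence "((\<lambda>\<xi>. (Z (\<xi>, \<gamma> \<xi>) - Z (\<xi>, \<gamma> x)) / (\<xi> - x)) \<longlongrightarrow> h x (\<gamma> x) * \<gamma>') (at x within {0..1})"
    by (rule Lim_transform_eventually)
       (auto simp: eventually_at_filter h_def mean_slope[OF Z(1)])
  thus ?thesis by (simp add: has_field_derivative_iff h_def)
qed

text \<open>Splitting the increment at frozen time separates the two partials, so total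
  differentiability of \<open>Z\<close> never has to be established.\<close>

lemma along_curve_has_derivative:
  assumes "x_partial Z Zx" "t_partial Z Zt" "continuous_on strip Zt"
    and "(\<gamma> has_real_derivative \<gamma>') (at x within {0..1})" "x \<in> {0..1}"
  shows "((\<lambda>\<xi>. Z (\<xi>, \<gamma> \<xi>)) has_real_derivative Zx (x, \<gamma> x) + Zt (x, \<gamma> x) * \<gamma>') (at x within {0..1})"
proof -
  have "((\<lambda>\<xi>. Z (\<xi>, \<gamma> x) + (Z (\<xi>, \<gamma> \<xi>) - Z (\<xi>, \<gamma> x))) has_real_derivative
    Zx (x, \<gamma> x) + Zt (x, \<gamma> x) * \<gamma>') (at x within {0..1})"
    using assms(1,5) by (intro DERIV_add increment_along_curve_has_derivative assms)
      (auto simp: has_partial_on_strip_x)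
  thus ?thesis by simp
qed

text \<open>The same splitting read backwards. This is how equations along characteristics give back
  classical \<open>x\<close>-derivatives once the time derivative is known.\<close>

lemma x_partial_from_curve:
  assumes "t_partial Z Zt" "continuous_on strip Zt"
    and "(\<gamma> has_real_derivative \<gamma>') (at x within {0..1})" "x \<in> {0..1}"
    and "((\<lambda>\<xi>. Z (\<xi>, \<gamma> \<xi>)) has_real_derivative D) (at x within {0..1})"
  shows "((\<lambda>\<xi>. Z (\<xi>, \<gamma> x)) has_real_derivative D - Zt (x, \<gamma> x) * \<gamma>') (at x within {0..1})"
proof -
  have "((\<lambda>\<xi>. Z (\<xi>, \<gamma> \<xi>) - (Z (\<xi>, \<gamma> \<xi>) - Z (\<xi>, \<gamma> x))) has_real_derivative
    D - Zt (x, \<gamma> x) * \<gamma>') (at x within {0..1})"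
    by (intro DERIV_diff increment_along_curve_has_derivative assms)
  thus ?thesis by simp
qed

definition curve_comp :: "(real \<times> real \<Rightarrow> real) \<Rightarrow> (real \<times> real \<Rightarrow> real) \<Rightarrow> real \<times> real \<Rightarrow> real"
    (infixl "\<odot>" 75) where
  "Z \<odot> \<gamma> = (\<lambda>p. Z (fst p, \<gamma> p))"

lemma curve_comp_apply [simp]: "(Z \<odot> \<gamma>) (x, t) = Z (x, \<gamma> (x, t))"
  by (simp add: curve_comp_def)

lemma cont_curve_comp:
  assumes "continuous_on strip Z" "continuous_on strip \<gamma>"
  shows "continuous_on strip (Z \<odot> \<gamma>)"
  unfolding curve_comp_def
  by (rule continuous_on_strip_compose[OF assms(1) _ assms(2)])
     (simp_all add: continuous_on_fst strip_eq_Times mem_Times_iff)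

lemma curve_comp_t:
  assumes "t_partial Z Zt" "t_partial \<gamma> \<gamma>t"
  shows "t_partial (Z \<odot> \<gamma>) (\<lambda>p. (Zt \<odot> \<gamma>) p * \<gamma>t p)"
  unfolding has_partial_on_strip_t
proof (intro ballI allI)
  fix x t :: real assume "x \<in> {0..1}"
  thus "((\<lambda>t. (Z \<odot> \<gamma>) (x, t)) has_real_derivative (Zt \<odot> \<gamma>) (x, t) * \<gamma>t (x, t)) (at t)"
    using assms DERIV_chain2[of "\<lambda>t. Z (x, t)" _ "\<lambda>t. \<gamma> (x, t)" t]
    by (simp add: has_partial_on_strip_t)
qed

lemma curve_comp_x:
  assumes "x_partial Z Zx" "t_partial Z Zt" "continuous_on strip Zt"
    and "x_partial \<gamma> \<gamma>x"
  shows "x_partial (Z \<odot> \<gamma>) (\<lambda>p. (Zx \<odot> \<gamma>) p + (Zt \<odot> \<gamma>) p * \<gamma>x p)"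
  using assms(4) unfolding has_partial_on_strip_x
  by (auto intro!: along_curve_has_derivative assms)

section \<open>Characteristic flows\<close>

text \<open>A characteristic is labelled by its time \<open>y\<close> at the edge
  \<open>x = 0\<close>. At each position \<open>Psi w\<close> maps the label to the time and
  \<open>Foot w\<close> recovers the label from the time; in label coordinates the flow is
  straight.\<close>

definition Psi :: "(real \<Rightarrow> real \<Rightarrow> real \<Rightarrow> real) \<Rightarrow> real \<times> real \<Rightarrow> real" where
  "Psi w = (\<lambda>(\<xi>, y). w \<xi> 0 y)"

definition Foot :: "(real \<Rightarrow> real \<Rightarrow> real \<Rightarrow> real) \<Rightarrow> real \<times> real \<Rightarrow> real" where
  "Foot w = (\<lambda>(x, t). w 0 x t)"

text \<open>Solution of the variational equation along \<open>Psi w\<close> with value 1 at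
  \<open>x = 0\<close>; it turns out to be the \<open>y\<close>-derivative of
  \<open>Psi w\<close>.\<close>

definition Psi_y :: "(real \<times> real \<Rightarrow> real) \<Rightarrow> (real \<Rightarrow> real \<Rightarrow> real \<Rightarrow> real) \<Rightarrow> real \<times> real \<Rightarrow> real" where
  "Psi_y \<sigma>t w = (\<lambda>p. exp (prim (\<sigma>t \<odot> Psi w) p))"

text \<open>For the slope field \<open>\<sigma>\<close> of the flow \<open>w\<close>, \<open>along w g g'\<close> says \<open>(\<partial>\<^sub>x + \<sigma> \<partial>\<^sub>t) g = g'\<close>, where \<open>g\<close>
  need not possess either partial derivative.\<close>

definition along :: "(real \<Rightarrow> real \<Rightarrow> real \<Rightarrow> real) \<Rightarrow> (real \<times> real \<Rightarrow> real) \<Rightarrow> (real \<times> real \<Rightarrow> real) \<Rightarrow> bool" where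
  "along w g g' \<longleftrightarrow> (\<forall>x\<in>{0..1}. \<forall>t. ((\<lambda>\<xi>. g (\<xi>, w \<xi> x t)) has_real_derivative g' (x, t)) (at x within {0..1}))"

lemma along_cong: "(\<And>p. p \<in> strip \<Longrightarrow> g' p = g'' p) \<Longrightarrow> along w g g' \<longleftrightarrow> along w g g''"
  by (simp add: along_def)

lemma along_diff: "along w f f' \<Longrightarrow> along w g g' \<Longrightarrow> along w (\<lambda>p. f p - g p) (\<lambda>p. f' p - g' p)"
  by (auto simp: along_def intro!: derivative_intros)

lemma DERIV_cong_on:
  assumes "(f has_real_derivative D) (at x within S)" "x \<in> S" "\<And>y. y \<in> S \<Longrightarrow> f y = g y"
  shows "(g has_real_derivative D) (at x within S)"
  by (rule has_field_derivative_transform_within[where f = f and d = 1]) (simp_all add: assms)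

lemma DERIV_exp_within:
  "(g has_real_derivative m) (at x within S) \<Longrightarrow>
   ((\<lambda>x. exp (g x)) has_real_derivative exp (g x) * m) (at x within S)"
  by (auto intro!: derivative_eq_intros)

lemma continuous_on_strip_lipschitz:
  assumes "\<And>x t t'. x \<in> {0..1} \<Longrightarrow> \<bar>f (x, t) - f (x, t')\<bar> \<le> C * \<bar>t - t'\<bar>"
    and "\<And>t. continuous_on {0..1} (\<lambda>x. f (x, t))"
  shows "continuous_on strip (f :: real \<times> real \<Rightarrow> real)"
proof -
  have "local_lipschitz {0..1} UNIV (\<lambda>x t. f (x, t))"
  proof (rule local_lipschitzI)
    fix x t :: real
    have "\<bar>C\<bar>-lipschitz_on (cball t 1 \<inter> UNIV) (\<lambda>t. f (y, t))" if "y \<in> {0..1}" for y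
    proof (rule lipschitz_onI)
      fix s s'
      have "\<bar>f (y, s) - f (y, s')\<bar> \<le> C * \<bar>s - s'\<bar>" using assms(1) that by blast
      also have "\<dots> \<le> \<bar>C\<bar> * \<bar>s - s'\<bar>" by (intro mult_right_mono) auto
      finally show "dist (f (y, s)) (f (y, s')) \<le> \<bar>C\<bar> * dist s s'" by (simp add: dist_real_def)
    qed auto
    thus "\<exists>u>0. \<exists>L. \<forall>y\<in>cball x u \<inter> {0..1}. L-lipschitz_on (cball t u \<inter> UNIV) (\<lambda>t. f (y, t))"
      by (intro exI[of _ 1] conjI exI[of _ "\<bar>C\<bar>"]) auto
  qed
  from continuous_on_TimesI[OF this] assms(2) show ?thesis by (simp add: strip_eq_Times)
qed

text \<open>The flow is given, not constructed: uniqueness, group law and smoothness are all drawn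
  from \<open>ode\<close>. The constant \<open>L\<close> is what remains of periodicity, a bound on
  \<open>\<sigma>t\<close> over the unbounded strip.\<close>

locale char_flow =
  fixes \<sigma> \<sigma>t :: "real \<times> real \<Rightarrow> real" and w :: "real \<Rightarrow> real \<Rightarrow> real \<Rightarrow> real" and L :: real
  assumes slope_partial: "t_partial \<sigma> \<sigma>t"
    and slope_cont: "continuous_on strip \<sigma>" "continuous_on strip \<sigma>t"
    and slope_bound: "\<And>p. p \<in> strip \<Longrightarrow> \<bar>\<sigma>t p\<bar> \<le> L"
    and init: "\<And>x t. x \<in> {0..1} \<Longrightarrow> w x x t = t"
    and ode: "\<And>x t \<xi>. x \<in> {0..1} \<Longrightarrow> \<xi> \<in> {0..1} \<Longrightarrow>
      ((\<lambda>\<eta>. w \<eta> x t) has_real_derivative \<sigma> (\<xi>, w \<xi> x t)) (at \<xi> within {0..1})"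
begin

section \<open>Uniqueness, group law and smoothness of the flow\<close>

lemma L_nonneg: "0 \<le> L"
  using slope_bound[of "(0, 0)"] by simp

lemma cont_flow: "x \<in> {0..1} \<Longrightarrow> continuous_on {0..1} (\<lambda>\<xi>. w \<xi> x t)"
  by (rule DERIV_continuous_on) (rule ode)

text \<open>The difference of two solutions satisfies a linear equation whose coefficient is the
  mean slope between them, and the integrating factor makes \<open>v\<close> constant. Being exact,
  the formula yields uniqueness, Lipschitz bounds and differentiability in the initial value at
  once.\<close>

lemma solutions_diff:
  assumes y1: "\<And>\<xi>. \<xi> \<in> {0..1} \<Longrightarrow> (y1 has_real_derivative \<sigma> (\<xi>, y1 \<xi>)) (at \<xi> within {0..1})"
    and y2: "\<And>\<xi>. \<xi> \<in> {0..1} \<Longrightarrow> (y2 has_real_derivative \<sigma> (\<xi>, y2 \<xi>)) (at \<xi> within {0..1})"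
    and \<xi>: "\<xi> \<in> {0..1}"
  shows "y1 \<xi> - y2 \<xi> = (y1 0 - y2 0) * exp (integral {0..\<xi>} (\<lambda>\<rho>. mean_slope \<sigma>t \<rho> (y2 \<rho>) (y1 \<rho>)))"
proof -
  define A where "A = (\<lambda>\<rho>. mean_slope \<sigma>t \<rho> (y2 \<rho>) (y1 \<rho>))"
  define v where "v \<xi> = (y1 \<xi> - y2 \<xi>) * exp (- integral {0..\<xi>} A)" for \<xi>
  have "continuous_on {0..1} y1" "continuous_on {0..1} y2"
    by (rule DERIV_continuous_on, erule y1, rule DERIV_continuous_on, erule y2)
  hence A: "continuous_on {0..1} A"
    unfolding A_def by (intro continuous_on_mean_slope slope_cont continuous_intros) auto
  have "(v has_real_derivative 0) (at \<rho> within {0..1})" if "\<rho> \<in> {0..1}" for \<rho>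
  proof -
    have "(v has_real_derivative (\<sigma> (\<rho>, y1 \<rho>) - \<sigma> (\<rho>, y2 \<rho>)) * exp (- integral {0..\<rho>} A)
      + exp (- integral {0..\<rho>} A) * (- A \<rho>) * (y1 \<rho> - y2 \<rho>)) (at \<rho> within {0..1})"
      unfolding v_def
      by (rule DERIV_mult DERIV_diff y1 y2 that DERIV_exp_within DERIV_minus integral_0x_has_derivative A)+
    moreover have "\<sigma> (\<rho>, y1 \<rho>) - \<sigma> (\<rho>, y2 \<rho>) = A \<rho> * (y1 \<rho> - y2 \<rho>)"
      unfolding A_def by (rule mean_slope[OF slope_partial that])
    ultimately show ?thesis by (simp add: algebra_simps)
  qed
  then obtain c where "\<And>\<rho>. \<rho> \<in> {0..1} \<Longrightarrow> v \<rho> = c"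
    using has_field_derivative_zero_constant[of "{0..1}" v] by auto
  hence "v \<xi> = v 0" using \<xi> by simp
  thus ?thesis unfolding A_def[symmetric] by (simp add: v_def exp_minus field_simps)
qed

lemma flow:
  assumes "\<eta> \<in> {0..1}" "\<xi> \<in> {0..1}" "x \<in> {0..1}"
  shows "w \<eta> \<xi> (w \<xi> x t) = w \<eta> x t"
proof -
  define I where "I \<zeta> = integral {0..\<zeta>} (\<lambda>\<rho>. mean_slope \<sigma>t \<rho> (w \<rho> x t) (w \<rho> \<xi> (w \<xi> x t)))" for \<zeta>
  have *: "w \<zeta> \<xi> (w \<xi> x t) - w \<zeta> x t = (w 0 \<xi> (w \<xi> x t) - w 0 x t) * exp (I \<zeta>)"
    if "\<zeta> \<in> {0..1}" for \<zeta>
    unfolding I_def by (rule solutions_diff[OF _ _ that]) (auto intro!: ode simp: assms[simplified])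
  \<comment> \<open>At \<open>\<zeta> = \<xi>\<close> both curves have the value
    \<open>w \<xi> x t\<close>, and the exponential never vanishes, so their values at 0
    agree.\<close>
  have "w 0 \<xi> (w \<xi> x t) = w 0 x t"
    using *[OF assms(2)] unfolding init[OF assms(2)] by simp
  thus ?thesis using *[OF assms(1)] by simp
qed

lemma flow_eq_Psi_Foot: "\<xi> \<in> {0..1} \<Longrightarrow> x \<in> {0..1} \<Longrightarrow> w \<xi> x t = Psi w (\<xi>, Foot w (x, t))"
  by (simp add: Psi_def Foot_def flow)

lemma Psi_Foot [simp]: "x \<in> {0..1} \<Longrightarrow> Psi w (x, Foot w (x, t)) = t"
  using flow_eq_Psi_Foot[of x x t] init by simp

lemma Foot_Psi [simp]: "x \<in> {0..1} \<Longrightarrow> Foot w (x, Psi w (x, y)) = y"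
  using flow[of 0 x 0 y] init[of 0 y] by (simp add: Psi_def Foot_def)

lemma flow_Psi: "\<eta> \<in> {0..1} \<Longrightarrow> \<xi> \<in> {0..1} \<Longrightarrow> w \<eta> \<xi> (Psi w (\<xi>, y)) = Psi w (\<eta>, y)"
  by (simp add: Psi_def flow)

lemma Psi_diff:
  assumes "\<xi> \<in> {0..1}"
  shows "Psi w (\<xi>, y) - Psi w (\<xi>, y') =
    (y - y') * exp (integral {0..\<xi>} (\<lambda>\<rho>. mean_slope \<sigma>t \<rho> (Psi w (\<rho>, y')) (Psi w (\<rho>, y))))"
  using solutions_diff[of "\<lambda>\<xi>. w \<xi> 0 y" "\<lambda>\<xi>. w \<xi> 0 y'", OF ode ode assms] init[of 0]
  by (simp add: Psi_def)

lemma cont_Psi_x: "continuous_on {0..1} (\<lambda>\<xi>. Psi w (\<xi>, y))"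
  using cont_flow[of 0 y] by (simp add: Psi_def)

lemma mean_slope_exponent_bound:
  assumes "\<xi> \<in> {0..1}"
  shows "\<bar>integral {0..\<xi>} (\<lambda>\<rho>. mean_slope \<sigma>t \<rho> (Psi w (\<rho>, y')) (Psi w (\<rho>, y)))\<bar> \<le> L"
proof -
  have "norm (integral {0..\<xi>} (\<lambda>\<rho>. mean_slope \<sigma>t \<rho> (Psi w (\<rho>, y')) (Psi w (\<rho>, y)))) \<le> L * (\<xi> - 0)"
  proof (rule integral_bound)
    show "continuous_on {0..\<xi>} (\<lambda>\<rho>. mean_slope \<sigma>t \<rho> (Psi w (\<rho>, y')) (Psi w (\<rho>, y)))"
      using assms by (intro continuous_on_mean_slope slope_cont continuous_intros
          continuous_on_subset[OF cont_Psi_x]) auto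
  qed (use assms mean_slope_abs_le[OF slope_cont(2) slope_bound] in auto)
  also have "\<dots> \<le> L * 1" using assms L_nonneg by (intro mult_left_mono) auto
  finally show ?thesis by simp
qed

lemma Psi_lipschitz:
  assumes "\<xi> \<in> {0..1}"
  shows "\<bar>Psi w (\<xi>, y) - Psi w (\<xi>, y')\<bar> \<le> exp L * \<bar>y - y'\<bar>"
  unfolding Psi_diff[OF assms] abs_mult
  using mean_slope_exponent_bound[OF assms, of y' y]
  by (subst mult.commute, intro mult_right_mono) auto

text \<open>\<open>Psi_diff\<close> solved for the difference of the labels: the exponent changes
  sign, but its bound \<open>L\<close> is symmetric.\<close>

lemma Foot_lipschitz:
  assumes "x \<in> {0..1}"
  shows "\<bar>Foot w (x, t) - Foot w (x, t')\<bar> \<le> exp L * \<bar>t - t'\<bar>"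
proof -
  define I where "I = integral {0..x} (\<lambda>\<rho>. mean_slope \<sigma>t \<rho> (Psi w (\<rho>, Foot w (x, t'))) (Psi w (\<rho>, Foot w (x, t))))"
  have "t - t' = (Foot w (x, t) - Foot w (x, t')) * exp I"
    unfolding I_def using Psi_diff[OF assms, of "Foot w (x, t)" "Foot w (x, t')"] assms by simp
  hence "\<bar>Foot w (x, t) - Foot w (x, t')\<bar> = exp (- I) * \<bar>t - t'\<bar>"
    by (simp add: abs_mult exp_minus)
  also have "\<dots> \<le> exp L * \<bar>t - t'\<bar>"
    using mean_slope_exponent_bound[OF assms, of "Foot w (x, t')" "Foot w (x, t)"]
    by (intro mult_right_mono) (auto simp: I_def)
  finally show ?thesis .
qed

lemma cont_Psi: "continuous_on strip (Psi w)"
  using Psi_lipschitz cont_Psi_x by (rule continuous_on_strip_lipschitz)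

lemma cont_Foot: "continuous_on strip (Foot w)"
proof (rule continuous_on_strip_lipschitz[OF Foot_lipschitz])
  fix t
  show "continuous_on {0..1} (\<lambda>x. Foot w (x, t))"
    unfolding continuous_on_def
  proof
    fix x :: real assume x: "x \<in> {0..1}"
    have "((\<lambda>x'. Psi w (x', Foot w (x, t))) \<longlongrightarrow> t) (at x within {0..1})"
      using cont_Psi_x[of "Foot w (x, t)"] x unfolding continuous_on_def by force
    hence "((\<lambda>x'. exp L * \<bar>t - Psi w (x', Foot w (x, t))\<bar>) \<longlongrightarrow> exp L * \<bar>t - t\<bar>) (at x within {0..1})"
      by (intro tendsto_intros)
    hence "((\<lambda>x'. exp L * \<bar>t - Psi w (x', Foot w (x, t))\<bar>) \<longlongrightarrow> 0) (at x within {0..1})" by simp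
    moreover have "\<forall>\<^sub>F x' in at x within {0..1}. norm (Foot w (x', t) - Foot w (x, t)) \<le>
       exp L * \<bar>t - Psi w (x', Foot w (x, t))\<bar>"
    proof -
      \<comment> \<open>With \<open>y = Foot w (x, t)\<close>, the identity
        \<open>Foot w (x', Psi w (x', y)) = y\<close> turns a difference in position into one in
        time, where the Lipschitz bound applies.\<close>
      have "\<bar>Foot w (x', t) - Foot w (x, t)\<bar> \<le> exp L * \<bar>t - Psi w (x', Foot w (x, t))\<bar>"
        if "x' \<in> {0..1}" for x'
        using Foot_lipschitz[OF that, of t "Psi w (x', Foot w (x, t))"] that by simp
      thus ?thesis by (auto simp: eventually_at_filter)
    qed
    ultimately have "((\<lambda>x'. Foot w (x', t) - Foot w (x, t)) \<longlongrightarrow> 0) (at x within {0..1})"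
      by (rule Lim_null_comparison[rotated])
    thus "((\<lambda>x. Foot w (x, t)) \<longlongrightarrow> Foot w (x, t)) (at x within {0..1})" by (rule LIM_zero_cancel)
  qed
qed

lemma cont_slope_Psi: "continuous_on strip (\<sigma> \<odot> Psi w)" "continuous_on strip (\<sigma>t \<odot> Psi w)"
  by (intro cont_curve_comp slope_cont cont_Psi)+

lemma Psi_x: "x_partial (Psi w) (\<sigma> \<odot> Psi w)"
  using ode[of 0] by (simp add: has_partial_on_strip_x Psi_def curve_comp_def)

lemma cont_Psi_y: "continuous_on strip (Psi_y \<sigma>t w)"
  unfolding Psi_y_def by (intro continuous_on_exp cont_prim cont_slope_Psi)

lemma Psi_y_nonzero: "Psi_y \<sigma>t w p \<noteq> 0"
  by (simp add: Psi_y_def)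

text \<open>The difference formula has the shape \<open>(y - y') * q y\<close> with \<open>q\<close>
  continuous at \<open>y'\<close>, so the derivative is \<open>q y'\<close>, where the mean slopes
  collapse to \<open>\<sigma>t\<close> along the characteristic.\<close>

lemma Psi_t: "t_partial (Psi w) (Psi_y \<sigma>t w)"
  unfolding has_partial_on_strip_t
proof (intro ballI allI)
  fix \<xi> y' :: real assume \<xi>: "\<xi> \<in> {0..1}"
  define I where "I y = integral {0..\<xi>} (\<lambda>\<rho>. mean_slope \<sigma>t \<rho> (Psi w (\<rho>, y')) (Psi w (\<rho>, y)))" for y
  have "continuous_on UNIV (\<lambda>y. integral (cbox 0 \<xi>) (\<lambda>\<rho>. mean_slope \<sigma>t \<rho> (Psi w (\<rho>, y')) (Psi w (\<rho>, y))))"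
    by (rule integral_continuous_on_param, unfold case_prod_unfold)
       (use \<xi> in \<open>auto intro!: continuous_on_mean_slope slope_cont continuous_intros
          continuous_on_strip_compose[OF cont_Psi]\<close>)
  hence "isCont I y'" unfolding I_def by (simp add: continuous_on_eq_continuous_at)
  hence "isCont (\<lambda>y. exp (I y)) y'" by (intro continuous_intros)
  hence "((\<lambda>y. Psi w (\<xi>, y)) has_real_derivative exp (I y')) (at y')"
    unfolding CARAT_DERIV
    by (intro exI[of _ "\<lambda>y. exp (I y)"]) (simp add: Psi_diff[OF \<xi>] I_def mult.commute)
  thus "((\<lambda>y. Psi w (\<xi>, y)) has_real_derivative Psi_y \<sigma>t w (\<xi>, y')) (at y')"
    by (simp add: I_def Psi_y_def prim_def)
qed

text \<open>The exponent is an integral in \<open>x\<close>, so this mixed derivative of the flow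
  exists although \<open>\<sigma>t\<close> is merely continuous. The transversal weights below rely
  on it.\<close>

lemma Psi_y_x: "x_partial (Psi_y \<sigma>t w) (\<lambda>p. Psi_y \<sigma>t w p * (\<sigma>t \<odot> Psi w) p)"
  using prim_x[OF cont_slope_Psi(2)]
  unfolding has_partial_on_strip_x Psi_y_def by (intro ballI allI DERIV_exp_within) blast

lemma Foot_t: "t_partial (Foot w) (\<lambda>p. inverse ((Psi_y \<sigma>t w \<odot> Foot w) p))"
  unfolding has_partial_on_strip_t
proof (intro ballI allI)
  fix x t :: real assume x: "x \<in> {0..1}"
  have "((\<lambda>t. Foot w (x, t)) has_real_derivative inverse (Psi_y \<sigma>t w (x, Foot w (x, t)))) (at t)"
  proof (rule DERIV_inverse_function[where a = "t - 1" and b = "t + 1"])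
    show "((\<lambda>y. Psi w (x, y)) has_real_derivative Psi_y \<sigma>t w (x, Foot w (x, t))) (at (Foot w (x, t)))"
      using Psi_t x by (simp add: has_partial_on_strip_t)
    have "continuous_on UNIV (\<lambda>t. Foot w (x, t))"
      using x by (intro continuous_on_strip_compose[OF cont_Foot] continuous_intros) auto
    thus "isCont (\<lambda>t. Foot w (x, t)) t" by (simp add: continuous_on_eq_continuous_at)
  qed (use x Psi_y_nonzero in auto)
  thus "((\<lambda>t. Foot w (x, t)) has_real_derivative inverse ((Psi_y \<sigma>t w \<odot> Foot w) (x, t))) (at t)" by simp
qed

lemma cont_Foot_t: "continuous_on strip (\<lambda>p. inverse ((Psi_y \<sigma>t w \<odot> Foot w) p))"
  by (intro continuous_on_inverse cont_curve_comp cont_Psi_y cont_Foot) (simp add: curve_comp_def Psi_y_nonzero)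

text \<open>The label is constant along each characteristic, which determines its
  \<open>x\<close>-partial from its \<open>t\<close>-partial.\<close>

lemma Foot_x: "x_partial (Foot w) (\<lambda>p. - (inverse ((Psi_y \<sigma>t w \<odot> Foot w) p) * \<sigma> p))"
  unfolding has_partial_on_strip_x
proof (intro ballI allI)
  fix x t :: real assume x: "x \<in> {0..1}"
  have "((\<lambda>\<xi>. Foot w (\<xi>, w \<xi> x t)) has_real_derivative 0) (at x within {0..1})"
  proof (rule DERIV_cong_on[OF DERIV_const x])
    show "Foot w (x, t) = Foot w (\<xi>, w \<xi> x t)" if "\<xi> \<in> {0..1}" for \<xi>
      using flow[of 0 \<xi> x t] that x by (simp add: Foot_def)
  qed
  from x_partial_from_curve[OF Foot_t cont_Foot_t ode[OF x x] x this]
  show "((\<lambda>x. Foot w (x, t)) has_real_derivative - (inverse ((Psi_y \<sigma>t w \<odot> Foot w) (x, t)) * \<sigma> (x, t)))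
    (at x within {0..1})" using init[OF x] by simp
qed

text \<open>In label coordinates the characteristics are the lines \<open>y = const\<close>, so
  differentiation along the flow becomes plain differentiation in \<open>x\<close>.\<close>

lemma along_iff_Psi: "along w g g' \<longleftrightarrow> x_partial (g \<odot> Psi w) (g' \<odot> Psi w)"
proof
  assume *: "along w g g'"
  show "x_partial (g \<odot> Psi w) (g' \<odot> Psi w)"
    unfolding has_partial_on_strip_x
  proof (intro ballI allI)
    fix x y :: real assume x: "x \<in> {0..1}"
    hence "((\<lambda>\<xi>. g (\<xi>, w \<xi> x (Psi w (x, y)))) has_real_derivative (g' \<odot> Psi w) (x, y)) (at x within {0..1})"
      using * by (simp add: along_def)
    thus "((\<lambda>x. (g \<odot> Psi w) (x, y)) has_real_derivative (g' \<odot> Psi w) (x, y)) (at x within {0..1})"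
      by (rule DERIV_cong_on[OF _ x]) (use x flow_Psi in auto)
  qed
next
  assume *: "x_partial (g \<odot> Psi w) (g' \<odot> Psi w)"
  show "along w g g'"
    unfolding along_def
  proof (intro ballI allI)
    fix x t :: real assume x: "x \<in> {0..1}"
    have "((\<lambda>\<xi>. g (\<xi>, Psi w (\<xi>, Foot w (x, t)))) has_real_derivative g' (x, t)) (at x within {0..1})"
      using *[unfolded has_partial_on_strip_x, rule_format, OF x, of "Foot w (x, t)"] x by simp
    thus "((\<lambda>\<xi>. g (\<xi>, w \<xi> x t)) has_real_derivative g' (x, t)) (at x within {0..1})"
      by (rule DERIV_cong_on[OF _ x]) (use x flow_eq_Psi_Foot in auto)
  qed
qed

lemma along_classical:
  assumes "x_partial u ux" "t_partial u ut" "continuous_on strip ut"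
  shows "along w u (\<lambda>p. ux p + ut p * \<sigma> p)"
  unfolding along_def
proof (intro ballI allI)
  fix x t :: real assume x: "x \<in> {0..1}"
  show "((\<lambda>\<xi>. u (\<xi>, w \<xi> x t)) has_real_derivative ux (x, t) + ut (x, t) * \<sigma> (x, t)) (at x within {0..1})"
    using along_curve_has_derivative[OF assms ode[OF x x, of t] x] init[OF x] by simp
qed

lemma x_partial_from_along:
  assumes "t_partial u ut" "continuous_on strip ut" "along w u S"
  shows "x_partial u (\<lambda>p. S p - ut p * \<sigma> p)"
  unfolding has_partial_on_strip_x
proof (intro ballI allI)
  fix x t :: real assume x: "x \<in> {0..1}"
  hence "((\<lambda>\<xi>. u (\<xi>, w \<xi> x t)) has_real_derivative S (x, t)) (at x within {0..1})"
    using assms(3) by (simp add: along_def)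
  from x_partial_from_curve[OF assms(1,2) ode[OF x x] x this] init[OF x]
  show "((\<lambda>x. u (x, t)) has_real_derivative S (x, t) - ut (x, t) * \<sigma> (x, t)) (at x within {0..1})" by simp
qed

text \<open>Commuting \<open>\<partial>\<^sub>t\<close> with \<open>\<partial>\<^sub>x + \<sigma> \<partial>\<^sub>t\<close>, without second derivatives of \<open>u\<close>.\<close>

lemma along_t_partial:
  assumes u: "t_partial u ut" "along w u S"
    and S: "t_partial S St" "continuous_on strip S" "continuous_on strip St"
  shows "along w ut (\<lambda>p. St p - \<sigma>t p * ut p)"
proof -
  define E where "E = Psi_y \<sigma>t w"
  define SP where "SP = S \<odot> Psi w"
  define SPt where "SPt = (\<lambda>p. (St \<odot> Psi w) p * E p)"
  have SP: "continuous_on strip SP" unfolding SP_def by (rule cont_curve_comp[OF S(2) cont_Psi])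
  have SPt: "continuous_on strip SPt"
    unfolding SPt_def E_def by (intro continuous_on_mult cont_curve_comp S cont_Psi cont_Psi_y)
  have SP_t: "t_partial SP SPt"
    unfolding SP_def SPt_def E_def by (rule curve_comp_t[OF S(1) Psi_t])
  have U: "u (\<xi>, Psi w (\<xi>, y)) = u (0, y) + prim SP (\<xi>, y)" if "\<xi> \<in> {0..1}" for \<xi> y
  proof -
    have "Psi w (0, y) = y" using init[of 0 y] by (simp add: Psi_def)
    thus ?thesis using prim_eq_diff[OF iffD1[OF along_iff_Psi u(2)] that, of y] by (simp add: SP_def)
  qed
  \<comment> \<open>Differentiating the integrated identity \<open>U\<close> in the label, instead
    of the differential equation in time, is what avoids second derivatives of
    \<open>u\<close>.\<close>
  have Ut: "ut (\<xi>, Psi w (\<xi>, y)) * E (\<xi>, y) = ut (0, y) + prim SPt (\<xi>, y)"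
    if \<xi>: "\<xi> \<in> {0..1}" for \<xi> y
  proof (rule DERIV_unique)
    show "((\<lambda>y. u (\<xi>, Psi w (\<xi>, y))) has_real_derivative ut (\<xi>, Psi w (\<xi>, y)) * E (\<xi>, y)) (at y)"
      using curve_comp_t[OF u(1) Psi_t] \<xi> by (simp add: has_partial_on_strip_t E_def)
    have "((\<lambda>y. u (0, y) + prim SP (\<xi>, y)) has_real_derivative ut (0, y) + prim SPt (\<xi>, y)) (at y)"
      using u(1) prim_t[OF SP_t SP SPt] \<xi>
      by (intro DERIV_add) (auto simp: has_partial_on_strip_t)
    thus "((\<lambda>y. u (\<xi>, Psi w (\<xi>, y))) has_real_derivative ut (0, y) + prim SPt (\<xi>, y)) (at y)"
      by (simp add: U[OF \<xi>])
  qed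
  show ?thesis
    unfolding along_iff_Psi has_partial_on_strip_x
  proof (intro ballI allI)
    fix x y :: real assume x: "x \<in> {0..1}"
    have E0: "E p \<noteq> 0" for p by (simp add: E_def Psi_y_nonzero)
    \<comment> \<open>By \<open>Ut\<close>, \<open>ut\<close> along the flow is a quotient of two
      functions differentiable in \<open>x\<close>; the derivative of the denominator produces the
      term with \<open>\<sigma>t\<close>.\<close>
    have "((\<lambda>x. (ut (0, y) + prim SPt (x, y)) / E (x, y)) has_real_derivative
      ((0 + SPt (x, y)) * E (x, y) - (ut (0, y) + prim SPt (x, y)) *
        (E (x, y) * (\<sigma>t \<odot> Psi w) (x, y))) / (E (x, y) * E (x, y))) (at x within {0..1})"
      using prim_x[OF SPt] Psi_y_x x E0 unfolding has_partial_on_strip_x E_def[symmetric]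
      by (intro DERIV_divide DERIV_add DERIV_const) blast+
    also have "((0 + SPt (x, y)) * E (x, y) - (ut (0, y) + prim SPt (x, y)) *
        (E (x, y) * (\<sigma>t \<odot> Psi w) (x, y))) / (E (x, y) * E (x, y)) =
        ((\<lambda>p. St p - \<sigma>t p * ut p) \<odot> Psi w) (x, y)"
      unfolding Ut[OF x, symmetric] using E0[of "(x, y)"]
      by (simp add: SPt_def divide_simps) (simp add: algebra_simps)
    finally show "((\<lambda>x. (ut \<odot> Psi w) (x, y)) has_real_derivative
        ((\<lambda>p. St p - \<sigma>t p * ut p) \<odot> Psi w) (x, y)) (at x within {0..1})"
      by (rule DERIV_cong_on[OF _ x]) (use E0 Ut in \<open>auto simp: divide_simps\<close>)
  qed
qed

end

text \<open>With slope zero the characteristics are the lines of constant time. Through this flow,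
  differentiability in \<open>x\<close> becomes a case of differentiability along a flow, and
  sources smooth in \<open>x\<close> fall under the same transversality result as the other
  components of the solution.\<close>

lemma char_flow_vertical: "char_flow (\<lambda>p. 0) (\<lambda>p. 0) (\<lambda>\<xi> x t. t) 0"
  by unfold_locales (auto intro: has_partial_on_const)

lemma along_vertical: "along (\<lambda>\<xi> x t. t) g g' \<longleftrightarrow> x_partial g g'"
  by (simp add: along_def has_partial_on_strip_x)

section \<open>Integrals along transversal curves\<close>

text \<open>Differentiation under the integral produces \<open>K * Gt * Yt\<close>, which
  \<open>rel\<close> turns into \<open>Q * Gt * Yx\<close>. This is the total
  \<open>x\<close>-derivative of \<open>Q\<close> times \<open>G\<close> along \<open>Y\<close>, up
  to terms free of \<open>Gt\<close>. Integration thus removes \<open>Gt\<close>, and the final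
  formula makes sense without a \<open>t\<close>-partial of \<open>G\<close>.\<close>

lemma transversal_integral_smooth:
  assumes G: "continuous_on strip G" "x_partial G G1" "continuous_on strip G1"
      "t_partial G Gt" "continuous_on strip Gt"
    and Y: "continuous_on strip Y" "x_partial Y Yx" "continuous_on strip Yx"
      "t_partial Y Yt" "continuous_on strip Yt"
    and K: "continuous_on strip K" "t_partial K Kt" "continuous_on strip Kt"
    and Q: "continuous_on strip Q" "x_partial Q Qx" "continuous_on strip Qx"
    and rel: "\<And>p. p \<in> strip \<Longrightarrow> Q p * Yx p = K p * Yt p"
    and x: "x \<in> {0..1}"
  shows "((\<lambda>\<tau>. prim (\<lambda>p. K p * (G \<odot> Y) p) (x, \<tau>)) has_real_derivative
     prim (\<lambda>p. (Kt p - Qx p) * (G \<odot> Y) p - Q p * (G1 \<odot> Y) p) (x, \<tau>)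
       + Q (x, \<tau>) * G (x, Y (x, \<tau>)) - Q (0, \<tau>) * G (0, Y (0, \<tau>))) (at \<tau>)"
proof -
  note comps = cont_curve_comp[OF G(1) Y(1)] cont_curve_comp[OF G(3) Y(1)] cont_curve_comp[OF G(5) Y(1)]
  have d: "t_partial (prim (\<lambda>p. K p * (G \<odot> Y) p))
      (prim (\<lambda>p. Kt p * (G \<odot> Y) p + K p * ((Gt \<odot> Y) p * Yt p)))"
    by (intro prim_t has_partial_on_mult curve_comp_t K G Y continuous_on_mult continuous_on_add comps)
  have "prim (\<lambda>p. Kt p * (G \<odot> Y) p + K p * ((Gt \<odot> Y) p * Yt p)) (x, \<tau>) =
     prim (\<lambda>p. (Kt p - Qx p) * (G \<odot> Y) p - Q p * (G1 \<odot> Y) p) (x, \<tau>)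
       + Q (x, \<tau>) * G (x, Y (x, \<tau>)) - Q (0, \<tau>) * G (0, Y (0, \<tau>))" (is "?l = _")
  proof -
    let ?B = "\<lambda>p. Qx p * (G \<odot> Y) p + Q p * ((G1 \<odot> Y) p + (Gt \<odot> Y) p * Yx p)"
    let ?A = "\<lambda>p. (Kt p - Qx p) * (G \<odot> Y) p - Q p * (G1 \<odot> Y) p"
    have "x_partial (\<lambda>p. Q p * (G \<odot> Y) p) ?B"
      by (intro has_partial_on_mult Q curve_comp_x G Y)
    from prim_eq_diff[OF this x]
    have B: "prim ?B (x, \<tau>) = Q (x, \<tau>) * G (x, Y (x, \<tau>)) - Q (0, \<tau>) * G (0, Y (0, \<tau>))" by simp
    have "?l = prim (\<lambda>p. ?A p + ?B p) (x, \<tau>)"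
    proof (rule prim_cong[OF x])
      fix p assume "p \<in> strip"
      hence "K p * ((Gt \<odot> Y) p * Yt p) = Q p * ((Gt \<odot> Y) p * Yx p)"
        using rel[of p] by (metis mult.assoc mult.commute)
      thus "Kt p * (G \<odot> Y) p + K p * ((Gt \<odot> Y) p * Yt p) = ?A p + ?B p"
        by (simp add: algebra_simps)
    qed
    also have "\<dots> = prim ?A (x, \<tau>) + prim ?B (x, \<tau>)"
      by (intro prim_add x continuous_on_add continuous_on_diff continuous_on_mult comps K Q Y)
    finally show ?thesis using B by simp
  qed
  with d[unfolded has_partial_on_strip_t, rule_format, OF x, of \<tau>] show ?thesis by (simp only:)
qed

lemma continuous_eq_at_limit:
  fixes f g :: "real \<Rightarrow> real"
  assumes "continuous_on UNIV f" "continuous_on UNIV g" "\<And>x. x \<noteq> a \<Longrightarrow> f x = g x"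
  shows "f a = g a"
proof (rule tendsto_unique)
  show "(f \<longlongrightarrow> f a) (at a)" using assms(1) by (simp add: continuous_on_def)
  have "(g \<longlongrightarrow> g a) (at a)" using assms(2) by (simp add: continuous_on_def)
  thus "(f \<longlongrightarrow> g a) (at a)"
    by (rule Lim_transform_eventually) (use assms(3) in \<open>auto simp: eventually_at_filter\<close>)
qed simp

lemma mean_slope_increment_imp_derivative:
  assumes "continuous_on strip R" "x \<in> {0..1}" "\<And>a b. J b - J a = mean_slope R x a b * (b - a)"
  shows "(J has_real_derivative R (x, \<tau>)) (at \<tau>)"
proof -
  have "continuous_on UNIV (\<lambda>b. mean_slope R x \<tau> b)"
    by (intro continuous_on_mean_slope assms(1) continuous_intros) (use assms(2) in auto)
  hence "isCont (\<lambda>b. mean_slope R x \<tau> b) \<tau>" by (simp add: continuous_on_eq_continuous_at)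
  thus ?thesis unfolding CARAT_DERIV
    by (intro exI[of _ "\<lambda>b. mean_slope R x \<tau> b"]) (simp add: assms(3))
qed

text \<open>The average over \<open>[y, y + \<delta>]\<close> is a difference quotient of an
  antiderivative of \<open>G\<close> in \<open>y\<close>, hence differentiable in \<open>y\<close>
  for merely continuous \<open>G\<close>.\<close>

lemma mean_slope_shift_t:
  assumes "continuous_on strip G" "\<delta> \<noteq> 0"
  shows "t_partial (\<lambda>p. mean_slope G (fst p) (snd p) (snd p + \<delta>))
    (\<lambda>p. (G (fst p, snd p + \<delta>) - G p) / \<delta>)"
proof -
  have "\<exists>P. \<forall>y. (P has_real_derivative G (\<xi>, y)) (at y)" if "\<xi> \<in> {0..1}" for \<xi>
  proof -
    have "continuous_on UNIV (\<lambda>y. G (\<xi>, y))"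
      by (intro continuous_on_strip_compose[OF assms(1)] continuous_intros) (use that in auto)
    hence "isCont (\<lambda>y. G (\<xi>, y)) y" for y by (simp add: continuous_on_eq_continuous_at)
    then obtain P where "\<And>y. (P has_vector_derivative G (\<xi>, y)) (at y)"
      using einterval_antiderivative[of "-\<infinity>" "\<infinity>" "\<lambda>y. G (\<xi>, y)"] by auto
    thus ?thesis by (auto simp: has_real_derivative_iff_has_vector_derivative)
  qed
  then obtain P where P: "\<And>\<xi> y. \<xi> \<in> {0..1} \<Longrightarrow> (P \<xi> has_real_derivative G (\<xi>, y)) (at y)"
    by metis
  hence P': "t_partial (\<lambda>(\<xi>, y). P \<xi> y) G" by (simp add: has_partial_on_strip_t)
  have eq: "mean_slope G \<xi> y (y + \<delta>) = (P \<xi> (y + \<delta>) - P \<xi> y) / \<delta>" if "\<xi> \<in> {0..1}" for \<xi> y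
    using mean_slope[OF P' that, of "y + \<delta>" y] assms(2) by (simp add: field_simps)
  show ?thesis
    unfolding has_partial_on_strip_t
  proof (intro ballI allI)
    fix x t :: real assume x: "x \<in> {0..1}"
    have "((\<lambda>y. P x (y + \<delta>)) has_real_derivative G (x, t + \<delta>)) (at t)"
      using P[OF x, of "t + \<delta>"] by (simp add: DERIV_shift)
    hence "((\<lambda>y. (P x (y + \<delta>) - P x y) / \<delta>) has_real_derivative (G (x, t + \<delta>) - G (x, t)) / \<delta>) (at t)"
      using P[OF x, of t] by (intro DERIV_cdivide DERIV_diff)
    thus "((\<lambda>t. mean_slope G (fst (x, t)) (snd (x, t)) (snd (x, t) + \<delta>)) has_real_derivative
      (G (fst (x, t), snd (x, t) + \<delta>) - G (x, t)) / \<delta>) (at t)" by (simp add: eq[OF x])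
  qed
qed

lemma mean_slope_shift_x:
  assumes "continuous_on strip G" "x_partial G G1" "continuous_on strip G1"
  shows "x_partial (\<lambda>p. mean_slope G (fst p) (snd p) (snd p + \<delta>))
    (\<lambda>p. mean_slope G1 (fst p) (snd p) (snd p + \<delta>))"
  unfolding has_partial_on_strip_x
proof (intro ballI allI)
  fix x t :: real assume x: "x \<in> {0..1}"
  have "((\<lambda>x. integral (cbox 0 1) (\<lambda>s. G (x, t + s * \<delta>))) has_field_derivative
      integral (cbox 0 1) (\<lambda>s. G1 (x, t + s * \<delta>))) (at x within {0..1})"
  proof (rule leibniz_rule_field_derivative)
    show "(\<lambda>s. G (y, t + s * \<delta>)) integrable_on cbox 0 1" if "y \<in> {0..1}" for y
      by (rule integrable_continuous)
         (use that in \<open>auto intro!: continuous_on_strip_compose[OF assms(1)] continuous_intros\<close>)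
    show "continuous_on ({0..1} \<times> cbox 0 1) (\<lambda>(x, s). G1 (x, t + s * \<delta>))"
      unfolding case_prod_unfold
      by (rule continuous_on_strip_compose[OF assms(3)]) (auto intro!: continuous_intros)
  qed (use assms(2) x in \<open>auto simp: has_partial_on_strip_x\<close>)
  thus "((\<lambda>x. mean_slope G (fst (x, t)) (snd (x, t)) (snd (x, t) + \<delta>)) has_real_derivative
     mean_slope G1 (fst (x, t)) (snd (x, t)) (snd (x, t) + \<delta>)) (at x within {0..1})"
    by (simp add: mean_slope_def)
qed

text \<open>\<open>G\<close> is smoothed in its second argument by averaging over \<open>[y, y + \<delta>]\<close>; both sides of the
  integrated identity are continuous in \<open>\<delta>\<close> up to \<open>\<delta> = 0\<close>.\<close>

lemma transversal_integral:
  assumes G: "continuous_on strip G" "x_partial G G1" "continuous_on strip G1"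
    and Y: "continuous_on strip Y" "x_partial Y Yx" "continuous_on strip Yx"
      "t_partial Y Yt" "continuous_on strip Yt"
    and K: "continuous_on strip K" "t_partial K Kt" "continuous_on strip Kt"
    and Q: "continuous_on strip Q" "x_partial Q Qx" "continuous_on strip Qx"
    and rel: "\<And>p. p \<in> strip \<Longrightarrow> Q p * Yx p = K p * Yt p"
    and x: "x \<in> {0..1}"
  shows "((\<lambda>\<tau>. prim (\<lambda>p. K p * (G \<odot> Y) p) (x, \<tau>)) has_real_derivative
     prim (\<lambda>p. (Kt p - Qx p) * (G \<odot> Y) p - Q p * (G1 \<odot> Y) p) (x, \<tau>)
       + Q (x, \<tau>) * G (x, Y (x, \<tau>)) - Q (0, \<tau>) * G (0, Y (0, \<tau>))) (at \<tau>)"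
proof -
  define GD where "GD \<delta> = (\<lambda>p. mean_slope G (fst p) (snd p) (snd p + \<delta>))" for \<delta>
  define G1D where "G1D \<delta> = (\<lambda>p. mean_slope G1 (fst p) (snd p) (snd p + \<delta>))" for \<delta>
  define J where "J \<delta> = prim (\<lambda>p. K p * (GD \<delta> \<odot> Y) p)" for \<delta>
  define R where "R \<delta> = (\<lambda>p. prim (\<lambda>p. (Kt p - Qx p) * (GD \<delta> \<odot> Y) p - Q p * (G1D \<delta> \<odot> Y) p) p
     + Q p * (GD \<delta> \<odot> Y) p - Q (0, snd p) * GD \<delta> (0, Y (0, snd p)))" for \<delta>
  have GD0: "GD 0 = G" "G1D 0 = G1" by (simp_all add: GD_def G1D_def)
  \<comment> \<open>The averaging width is carried as a parameter next to time, in points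
    \<open>(x, (\<delta>, t))\<close>, so joint continuity in \<open>\<delta>\<close> comes from the
    continuity of parameter integrals.\<close>
  let ?D = "{0..1} \<times> (UNIV :: (real \<times> real) set)"
  have str: "continuous_on ?D (\<lambda>q. g (fst q, snd (snd q)))" if "continuous_on strip g" for g :: "_ \<Rightarrow> real"
    by (intro continuous_on_strip_compose[OF that] continuous_intros) auto
  have str0: "continuous_on ?D (\<lambda>q. g (0, snd (snd q)))" if "continuous_on strip g" for g :: "_ \<Rightarrow> real"
    by (intro continuous_on_strip_compose[OF that] continuous_intros) auto
  have GY: "continuous_on ?D (\<lambda>q. GD (fst (snd q)) (fst q, Y (fst q, snd (snd q))))"
    "continuous_on ?D (\<lambda>q. G1D (fst (snd q)) (fst q, Y (fst q, snd (snd q))))"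
    "continuous_on ?D (\<lambda>q. GD (fst (snd q)) (0, Y (0, snd (snd q))))"
    unfolding GD_def G1D_def fst_conv snd_conv
    by (intro continuous_on_mean_slope G continuous_intros str[OF Y(1)] str0[OF Y(1)]; auto)+
  have Jc: "continuous_on ?D (\<lambda>q. J (fst (snd q)) (fst q, snd (snd q)))"
    unfolding J_def prim_def curve_comp_def fst_conv snd_conv
    using continuous_on_integral_0x[of UNIV "\<lambda>\<xi> r. K (\<xi>, snd r) * GD (fst r) (\<xi>, Y (\<xi>, snd r))"]
    by (simp add: continuous_on_mult str[OF K(1)] GY)
  have Rc: "continuous_on ?D (\<lambda>q. R (fst (snd q)) (fst q, snd (snd q)))"
    unfolding R_def prim_def curve_comp_def fst_conv snd_conv
    by (intro continuous_on_add continuous_on_diff continuous_on_mult str str0 Q GY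
         continuous_on_integral_0x[of UNIV "\<lambda>\<xi> r. (Kt (\<xi>, snd r) - Qx (\<xi>, snd r)) * GD (fst r) (\<xi>, Y (\<xi>, snd r))
           - Q (\<xi>, snd r) * G1D (fst r) (\<xi>, Y (\<xi>, snd r))"] K)
  \<comment> \<open>Stated for increments rather than derivatives: an identity between increments of
    \<open>J \<delta>\<close> and averages of \<open>R \<delta>\<close> survives the limit in
    \<open>\<delta>\<close>, and the derivative is recovered from it afterwards.\<close>
  have incr: "J \<delta> (x, b) - J \<delta> (x, a) = mean_slope (R \<delta>) x a b * (b - a)" if "\<delta> \<noteq> 0" for \<delta> a b
  proof (rule mean_slope[OF _ x])
    show "t_partial (J \<delta>) (R \<delta>)"
      unfolding has_partial_on_strip_t
    proof (intro ballI allI)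
      fix x \<tau> :: real assume x: "x \<in> {0..1}"
      have "((\<lambda>\<tau>. prim (\<lambda>p. K p * (GD \<delta> \<odot> Y) p) (x, \<tau>)) has_real_derivative
         prim (\<lambda>p. (Kt p - Qx p) * (GD \<delta> \<odot> Y) p - Q p * (G1D \<delta> \<odot> Y) p) (x, \<tau>)
         + Q (x, \<tau>) * GD \<delta> (x, Y (x, \<tau>)) - Q (0, \<tau>) * GD \<delta> (0, Y (0, \<tau>))) (at \<tau>)"
      proof (rule transversal_integral_smooth[OF _ _ _ _ _ Y K Q rel x])
        show "x_partial (GD \<delta>) (G1D \<delta>)"
          unfolding GD_def G1D_def by (rule mean_slope_shift_x[OF G])
        show "t_partial (GD \<delta>) (\<lambda>p. (G (fst p, snd p + \<delta>) - G p) / \<delta>)"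
          unfolding GD_def by (rule mean_slope_shift_t[OF G(1) that])
        show "continuous_on strip (GD \<delta>)" "continuous_on strip (G1D \<delta>)"
          unfolding GD_def G1D_def by (intro continuous_on_mean_slope G continuous_intros; auto)+
        have "continuous_on strip (\<lambda>p. G (fst p, snd p + \<delta>))"
          by (intro continuous_on_strip_compose[OF G(1)] continuous_intros) auto
        thus "continuous_on strip (\<lambda>p. (G (fst p, snd p + \<delta>) - G p) / \<delta>)"
          using G(1) that by (intro continuous_intros) auto
      qed
      thus "((\<lambda>\<tau>. J \<delta> (x, \<tau>)) has_real_derivative R \<delta> (x, \<tau>)) (at \<tau>)"
        by (simp add: J_def R_def)
    qed
  qed
  have incr0: "J 0 (x, b) - J 0 (x, a) = mean_slope (R 0) x a b * (b - a)" for a b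
  proof (rule continuous_eq_at_limit[where a = 0])
    have Jx: "continuous_on UNIV (\<lambda>\<delta>. J \<delta> (x, c))" for c
      using continuous_on_compose2[OF Jc, of UNIV "\<lambda>\<delta>. (x, \<delta>, c)"] x by (simp add: continuous_on_Pair image_subset_iff)
    show "continuous_on UNIV (\<lambda>\<delta>. J \<delta> (x, b) - J \<delta> (x, a))"
      by (intro continuous_on_diff Jx)
    have "continuous_on (UNIV \<times> cbox 0 1) (\<lambda>(\<delta>, s). R \<delta> (x, a + s * (b - a)))"
      using continuous_on_compose2[OF Rc, of "UNIV \<times> cbox 0 1" "\<lambda>r. (x, fst r, a + snd r * (b - a))"] x
      by (simp add: case_prod_unfold image_subset_iff continuous_intros)
    from integral_continuous_on_param[OF this]
    have "continuous_on UNIV (\<lambda>\<delta>. mean_slope (R \<delta>) x a b)" by (simp add: mean_slope_def)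
    thus "continuous_on UNIV (\<lambda>\<delta>. mean_slope (R \<delta>) x a b * (b - a))" by (intro continuous_intros)
  qed (use incr in auto)
  have "continuous_on strip (R 0)"
    using continuous_on_compose2[OF Rc, of strip "\<lambda>p. (fst p, 0, snd p)"]
    by (auto simp: continuous_intros image_subset_iff strip_eq_Times)
  from mean_slope_increment_imp_derivative[OF this x incr0, of \<tau>] show ?thesis
    by (simp add: J_def R_def GD0)
qed

section \<open>Differentiability classes on the strip and operations preserving them\<close>

abbreviation Cxt :: "nat \<Rightarrow> (real \<times> real \<Rightarrow> real) \<Rightarrow> bool" where "Cxt k f \<equiv> Ck_dirs Basis k strip f"
abbreviation Ct :: "nat \<Rightarrow> (real \<times> real \<Rightarrow> real) \<Rightarrow> bool" where "Ct k f \<equiv> Ck_dirs {(0, 1)} k strip f"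
abbreviation Cx :: "nat \<Rightarrow> (real \<times> real \<Rightarrow> real) \<Rightarrow> bool" where "Cx k f \<equiv> Ck_dirs {(1, 0)} k strip f"
abbreviation C1 :: "nat \<Rightarrow> (real \<Rightarrow> real) \<Rightarrow> bool" where "C1 k f \<equiv> Ck_dirs {1} k UNIV f"

lemma Cxt_imp_Ct: "Cxt k f \<Longrightarrow> Ct k f"
  by (erule Ck_dirs_subset) (simp add: Basis_real_pair)

lemma Cxt_imp_Cx: "Cxt k f \<Longrightarrow> Cx k f"
  by (erule Ck_dirs_subset) (simp add: Basis_real_pair)

lemma Cxt_SucI:
  assumes "continuous_on strip f" "x_partial f fx" "Cxt k fx"
    "t_partial f ft" "Cxt k ft"
  shows "Cxt (Suc k) f"
  using assms by (auto simp: Basis_real_pair)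

lemma Cxt_SucE:
  assumes "Cxt (Suc k) f"
  obtains fx ft where "x_partial f fx" "Cxt k fx" "t_partial f ft" "Cxt k ft"
  using Ck_dirs_SucE[OF assms, of "(1, 0)"] Ck_dirs_SucE[OF assms, of "(0, 1)"]
  by (metis Basis_real_pair insertI1 insertI2)

lemma Ct_SucE:
  assumes "Ct (Suc k) f"
  obtains ft where "t_partial f ft" "Ct k ft"
  using Ck_dirs_SucE[OF assms, of "(0, 1)"] by blast

lemma Cx_SucE:
  assumes "Cx (Suc k) f"
  obtains fx where "x_partial f fx" "Cx k fx"
  using Ck_dirs_SucE[OF assms, of "(1, 0)"] by blast

lemma C1_SucE:
  assumes "C1 (Suc k) f"
  obtains f' where "\<And>t. (f has_real_derivative f' t) (at t)" "C1 k f'"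
  using Ck_dirs_SucE[OF assms, of 1] unfolding has_partial_on_real by blast

lemma Ct_1I: "continuous_on strip f \<Longrightarrow> t_partial f ft \<Longrightarrow> continuous_on strip ft \<Longrightarrow> Ct (Suc 0) f"
  by auto

lemma Ct_1E:
  assumes "Ct (Suc 0) f"
  obtains ft where "continuous_on strip f" "t_partial f ft" "continuous_on strip ft"
  using assms by auto

lemma Cx_1I: "continuous_on strip f \<Longrightarrow> x_partial f fx \<Longrightarrow> continuous_on strip fx \<Longrightarrow> Cx (Suc 0) f"
  by auto

lemma Cx_1E:
  assumes "Cx (Suc 0) f"
  obtains fx where "continuous_on strip f" "x_partial f fx" "continuous_on strip fx"
  using assms by auto

lemma Cxt_1_iff: "Cxt (Suc 0) f \<longleftrightarrow> Cx (Suc 0) f \<and> Ct (Suc 0) f"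
  by (auto simp: Basis_real_pair)

lemma Ct_prim: "Ct k f \<Longrightarrow> Ct k (prim f)"
proof (induction k arbitrary: f)
  case 0
  thus ?case by (simp add: cont_prim)
next
  case (Suc k)
  from Suc.prems obtain ft where ft: "t_partial f ft" "Ct k ft" by (rule Ct_SucE)
  have "t_partial (prim f) (prim ft)"
    by (rule prim_t[OF ft(1) Ck_dirs_imp_continuous_on[OF Suc.prems] Ck_dirs_imp_continuous_on[OF ft(2)]])
  thus ?case using Suc.IH[OF ft(2)] cont_prim[OF Ck_dirs_imp_continuous_on[OF Suc.prems]] by auto
qed

lemma Cx_prim: "continuous_on strip f \<Longrightarrow> Cx (Suc 0) (prim f)"
  by (rule Cx_1I[OF cont_prim prim_x])

lemma Ct_curve_comp: "Ct (Suc 0) Z \<Longrightarrow> Ct (Suc 0) \<gamma> \<Longrightarrow> Ct (Suc 0) (Z \<odot> \<gamma>)"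
  by (elim Ct_1E, rule Ct_1I[OF cont_curve_comp curve_comp_t])
     (auto intro!: continuous_on_mult cont_curve_comp)

lemma Cx_curve_comp:
  assumes "Cxt (Suc 0) Z" "Cx (Suc 0) \<gamma>"
  shows "Cx (Suc 0) (Z \<odot> \<gamma>)"
proof -
  obtain Zx Zt where Z: "x_partial Z Zx" "Cxt 0 Zx" "t_partial Z Zt" "Cxt 0 Zt"
    using assms(1) by (rule Cxt_SucE)
  obtain \<gamma>x where \<gamma>: "continuous_on strip \<gamma>" "x_partial \<gamma> \<gamma>x" "continuous_on strip \<gamma>x"
    using assms(2) by (rule Cx_1E)
  show ?thesis
  proof (rule Cx_1I)
    show "x_partial (Z \<odot> \<gamma>) (\<lambda>p. (Zx \<odot> \<gamma>) p + (Zt \<odot> \<gamma>) p * \<gamma>x p)"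
      using Z \<gamma> by (intro curve_comp_x) auto
    show "continuous_on strip (\<lambda>p. (Zx \<odot> \<gamma>) p + (Zt \<odot> \<gamma>) p * \<gamma>x p)"
      using Z \<gamma> by (intro continuous_on_add continuous_on_mult cont_curve_comp) auto
    show "continuous_on strip (Z \<odot> \<gamma>)"
      using Ck_dirs_imp_continuous_on[OF assms(1)] \<gamma>(1) by (rule cont_curve_comp)
  qed
qed

lemma Cxt_curve_comp: "Cxt (Suc 0) Z \<Longrightarrow> Cxt (Suc 0) \<gamma> \<Longrightarrow> Cxt (Suc 0) (Z \<odot> \<gamma>)"
  using Cx_curve_comp Ct_curve_comp Cxt_1_iff by blast

lemma Cxt_exp:
  assumes "Cxt (Suc 0) f"
  shows "Cxt (Suc 0) (\<lambda>p. exp (f p))"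
proof -
  obtain fx ft where f: "x_partial f fx" "Cxt 0 fx" "t_partial f ft" "Cxt 0 ft"
    using assms by (rule Cxt_SucE)
  show ?thesis
  proof (rule Cxt_SucI)
    show "continuous_on strip (\<lambda>p. exp (f p))"
      using Ck_dirs_imp_continuous_on[OF assms] by (rule continuous_on_exp)
    show "x_partial (\<lambda>p. exp (f p)) (\<lambda>p. exp (f p) * fx p)"
      using f(1) by (auto simp: has_partial_on_strip_x intro!: DERIV_exp_within)
    show "t_partial (\<lambda>p. exp (f p)) (\<lambda>p. exp (f p) * ft p)"
      using f(3) by (auto simp: has_partial_on_strip_t intro!: DERIV_exp_within)
    show "Cxt 0 (\<lambda>p. exp (f p) * fx p)" "Cxt 0 (\<lambda>p. exp (f p) * ft p)"
      using f(2,4) Ck_dirs_imp_continuous_on[OF assms] by (auto intro!: continuous_intros)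
  qed
qed

lemma Ct_of_trace:
  assumes "C1 k h"
  shows "Ct k (\<lambda>p. h (snd p))"
  using assms
proof (induction k arbitrary: h)
  case 0
  thus ?case by (auto intro!: continuous_on_compose2[of UNIV h] continuous_intros)
next
  case (Suc k)
  from Suc.prems obtain h' where h': "\<And>t. (h has_real_derivative h' t) (at t)" "C1 k h'"
    by (rule C1_SucE) blast
  have "t_partial (\<lambda>p. h (snd p)) (\<lambda>p. h' (snd p))"
    using h'(1) by (simp add: has_partial_on_strip_t)
  moreover have "continuous_on strip (\<lambda>p. h (snd p))"
    using Ck_dirs_imp_continuous_on[OF Suc.prems]
    by (rule continuous_on_compose2) (auto intro!: continuous_intros)
  ultimately show ?case using Suc.IH[OF h'(2)] by auto
qed

section \<open>Integrals over curves transversal to a characteristic flow\<close>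

context char_flow
begin

lemma Cxt_Psi: "Cxt (Suc 0) (Psi w)"
  by (rule Cxt_SucI[OF cont_Psi Psi_x _ Psi_t]) (use cont_slope_Psi(1) cont_Psi_y in auto)

lemma Ct_Foot: "Ct (Suc 0) (Foot w)"
  by (rule Ct_1I[OF cont_Foot Foot_t cont_Foot_t])

lemma Cx_Psi_y: "Cx (Suc 0) (Psi_y \<sigma>t w)"
  by (intro Cx_1I[OF cont_Psi_y Psi_y_x] continuous_on_mult cont_Psi_y cont_slope_Psi)

text \<open>In \<open>rel\<close>, \<open>\<gamma>x - \<sigma>\<close> is the rate at which the curve \<open>\<gamma>\<close> departs from the flow; where it does not
  vanish, \<open>Q = K \<gamma>t / (\<gamma>x - \<sigma>)\<close>.\<close>

lemma transversal_integral_flow: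
  assumes g: "continuous_on strip g" "along w g g1" "continuous_on strip g1"
    and \<gamma>: "continuous_on strip \<gamma>" "x_partial \<gamma> \<gamma>x" "continuous_on strip \<gamma>x"
      "t_partial \<gamma> \<gamma>t" "continuous_on strip \<gamma>t"
    and K: "continuous_on strip K" "t_partial K Kt" "continuous_on strip Kt"
    and Q: "continuous_on strip Q" "x_partial Q Qx" "continuous_on strip Qx"
    and rel: "\<And>p. p \<in> strip \<Longrightarrow> Q p * (\<gamma>x p - (\<sigma> \<odot> \<gamma>) p) = K p * \<gamma>t p"
  shows "t_partial (prim (\<lambda>p. K p * (g \<odot> \<gamma>) p))
     (\<lambda>p. prim (\<lambda>p. (Kt p - Qx p) * (g \<odot> \<gamma>) p - Q p * (g1 \<odot> \<gamma>) p) p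
       + Q p * (g \<odot> \<gamma>) p - Q (0, snd p) * g (0, \<gamma> (0, snd p)))"
  unfolding has_partial_on_strip_t
proof (intro ballI allI)
  fix x \<tau> :: real assume x: "x \<in> {0..1}"
  \<comment> \<open>Straightening the flow: \<open>G\<close> is \<open>g\<close> in label
    coordinates, where differentiability along \<open>w\<close> is differentiability in
    \<open>x\<close>, and \<open>Y\<close> is the label of the characteristic met by the
    curve.\<close>
  define G where "G = g \<odot> Psi w"
  define G1 where "G1 = g1 \<odot> Psi w"
  define Y where "Y = Foot w \<odot> \<gamma>"
  define D where "D = (\<lambda>p. inverse ((Psi_y \<sigma>t w \<odot> Foot w) p)) \<odot> \<gamma>"
  define Yx where "Yx = (\<lambda>p. D p * (\<gamma>x p - (\<sigma> \<odot> \<gamma>) p))"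
  have GY: "(G \<odot> Y) p = (g \<odot> \<gamma>) p" "(G1 \<odot> Y) p = (g1 \<odot> \<gamma>) p" if "p \<in> strip" for p
    using that by (cases p; simp add: G_def G1_def Y_def)+
  have G: "continuous_on strip G" "x_partial G G1" "continuous_on strip G1"
    unfolding G_def G1_def by (intro cont_curve_comp g cont_Psi iffD1[OF along_iff_Psi])+
  have D: "continuous_on strip D" unfolding D_def by (intro cont_curve_comp cont_Foot_t \<gamma>)
  have Yc: "continuous_on strip Y" unfolding Y_def by (intro cont_curve_comp cont_Foot \<gamma>)
  have Yt: "t_partial Y (\<lambda>p. D p * \<gamma>t p)"
    unfolding Y_def D_def by (intro curve_comp_t Foot_t \<gamma>)
  have Yx: "x_partial Y Yx"
  proof -
    have "Yx = (\<lambda>p. ((\<lambda>p. - (inverse ((Psi_y \<sigma>t w \<odot> Foot w) p) * \<sigma> p)) \<odot> \<gamma>) p + D p * \<gamma>x p)"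
      by (auto simp: Yx_def D_def algebra_simps)
    thus ?thesis
      unfolding Y_def D_def by (simp only:) (intro curve_comp_x Foot_t Foot_x cont_Foot_t \<gamma>)
  qed
  have conts: "continuous_on strip Yx" "continuous_on strip (\<lambda>p. D p * \<gamma>t p)"
    unfolding Yx_def by (intro continuous_on_mult continuous_on_diff D \<gamma> cont_curve_comp slope_cont)+
  have "((\<lambda>\<tau>. prim (\<lambda>p. K p * (G \<odot> Y) p) (x, \<tau>)) has_real_derivative
     prim (\<lambda>p. (Kt p - Qx p) * (G \<odot> Y) p - Q p * (G1 \<odot> Y) p) (x, \<tau>)
       + Q (x, \<tau>) * G (x, Y (x, \<tau>)) - Q (0, \<tau>) * G (0, Y (0, \<tau>))) (at \<tau>)"
  proof (rule transversal_integral[OF G Yc Yx conts(1) Yt conts(2) K Q _ x])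
    fix p assume "p \<in> strip"
    from rel[OF this] show "Q p * Yx p = K p * (D p * \<gamma>t p)"
      unfolding Yx_def by (metis mult.assoc mult.commute)
  qed
  moreover have "prim (\<lambda>p. K p * (G \<odot> Y) p) (x, \<tau>) = prim (\<lambda>p. K p * (g \<odot> \<gamma>) p) (x, \<tau>)" for \<tau>
    by (rule prim_cong[OF x]) (simp add: GY)
  moreover have "prim (\<lambda>p. (Kt p - Qx p) * (G \<odot> Y) p - Q p * (G1 \<odot> Y) p) (x, \<tau>) =
      prim (\<lambda>p. (Kt p - Qx p) * (g \<odot> \<gamma>) p - Q p * (g1 \<odot> \<gamma>) p) (x, \<tau>)"
    by (rule prim_cong[OF x]) (simp add: GY)
  moreover have "G (x, Y (x, \<tau>)) = g (x, \<gamma> (x, \<tau>))" "G (0, Y (0, \<tau>)) = g (0, \<gamma> (0, \<tau>))"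
    using GY(1)[of "(x, \<tau>)"] GY(1)[of "(0, \<tau>)"] x by simp_all
  ultimately show "((\<lambda>\<tau>. prim (\<lambda>p. K p * (g \<odot> \<gamma>) p) (x, \<tau>)) has_real_derivative
     prim (\<lambda>p. (Kt p - Qx p) * (g \<odot> \<gamma>) p - Q p * (g1 \<odot> \<gamma>) p) (x, \<tau>)
       + Q (x, \<tau>) * (g \<odot> \<gamma>) (x, \<tau>) - Q (0, snd (x, \<tau>)) * g (0, \<gamma> (0, snd (x, \<tau>)))) (at \<tau>)"
    by simp
qed

end

text \<open>The curves are characteristics of one family while \<open>g\<close> is differentiable
  along another. The families separate at rate \<open>\<sigma> - \<sigma>'\<close>, by which
  \<open>Q\<close> divides. Differentiability of \<open>Q\<close> in \<open>x\<close> rests on the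
  \<open>C^1\<close> slopes and on the mixed derivative of the flow.\<close>

lemma Ct_integral_across_characteristics:
  assumes "char_flow \<sigma> \<sigma>t w L" "char_flow \<sigma>' \<sigma>t' w' L'" "Cxt (Suc 0) \<sigma>" "Cxt (Suc 0) \<sigma>'"
    and neq: "\<And>p. p \<in> strip \<Longrightarrow> \<sigma> p \<noteq> \<sigma>' p"
    and K: "Cxt (Suc 0) K" and g: "continuous_on strip g" "along w' g g1" "continuous_on strip g1"
  shows "Ct (Suc 0) (prim (\<lambda>p. K p * (g \<odot> Psi w) p))"
proof -
  interpret w: char_flow \<sigma> \<sigma>t w L by fact
  interpret w': char_flow \<sigma>' \<sigma>t' w' L' by fact
  define Q where "Q = (\<lambda>p. K p * Psi_y \<sigma>t w p / ((\<sigma> \<odot> Psi w) p - (\<sigma>' \<odot> Psi w) p))"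
  have neq': "(\<sigma> \<odot> Psi w) p - (\<sigma>' \<odot> Psi w) p \<noteq> 0" if "p \<in> strip" for p
    using that neq by (cases p) auto
  have Psi: "Cx (Suc 0) (Psi w)" using w.Cxt_Psi by (rule Cxt_imp_Cx)
  have "Cx (Suc 0) Q"
    unfolding Q_def
    by (intro Ck_dirs_divide Ck_dirs_mult Ck_dirs_diff Cx_curve_comp Cxt_imp_Cx[OF K] w.Cx_Psi_y assms Psi neq')
  then obtain Qx where Q: "continuous_on strip Q" "x_partial Q Qx" "continuous_on strip Qx"
    by (rule Cx_1E)
  obtain Kt where Kt: "continuous_on strip K" "t_partial K Kt" "continuous_on strip Kt"
    using Cxt_imp_Ct[OF K] by (rule Ct_1E)
  note * = w'.transversal_integral_flow[OF g w.cont_Psi w.Psi_x w.cont_slope_Psi(1) w.Psi_t w.cont_Psi_y Kt Q]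
  have "t_partial (prim (\<lambda>p. K p * (g \<odot> Psi w) p))
     (\<lambda>p. prim (\<lambda>p. (Kt p - Qx p) * (g \<odot> Psi w) p - Q p * (g1 \<odot> Psi w) p) p
       + Q p * (g \<odot> Psi w) p - Q (0, snd p) * g (0, Psi w (0, snd p)))"
  proof (rule *)
    fix p assume p: "p \<in> strip"
    show "Q p * ((\<sigma> \<odot> Psi w) p - (\<sigma>' \<odot> Psi w) p) = K p * Psi_y \<sigma>t w p"
      using neq'[OF p] by (simp add: Q_def)
  qed
  moreover have "continuous_on strip (\<lambda>p. Q (0, snd p))" "continuous_on strip (\<lambda>p. Psi w (0, snd p))"
    by (intro continuous_on_strip_compose[OF Q(1)] continuous_on_strip_compose[OF w.cont_Psi] continuous_intros; simp)+
  hence "continuous_on strip (\<lambda>p. prim (\<lambda>p. (Kt p - Qx p) * (g \<odot> Psi w) p - Q p * (g1 \<odot> Psi w) p) p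
       + Q p * (g \<odot> Psi w) p - Q (0, snd p) * g (0, Psi w (0, snd p)))"
    by (intro continuous_on_add continuous_on_diff continuous_on_mult cont_prim cont_curve_comp
        Kt Q g w.cont_Psi continuous_on_strip_compose[OF g(1)] continuous_on_const) auto
  moreover have "continuous_on strip (prim (\<lambda>p. K p * (g \<odot> Psi w) p))"
    by (intro cont_prim continuous_on_mult Kt cont_curve_comp g w.cont_Psi)
  ultimately show ?thesis by (intro Ct_1I)
qed

section \<open>Regularity without integral operators\<close>

text \<open>\<open>s j\<close> is the reciprocal of the speed \<open>a\<^sub>j\<close>, and \<open>E\<close> collects the pairs for which the
  reflection coefficient \<open>r j k\<close> may be nonzero.\<close>

locale hyp_system =
  fixes n :: nat and s st :: "nat \<Rightarrow> real \<times> real \<Rightarrow> real"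
    and w :: "nat \<Rightarrow> real \<Rightarrow> real \<Rightarrow> real \<Rightarrow> real" and L :: "nat \<Rightarrow> real"
    and E :: "(nat \<times> nat) set" and x_inflow x_outflow :: "nat \<Rightarrow> real"
  assumes sys_flow: "j < n \<Longrightarrow> char_flow (s j) (st j) (w j) (L j)"
    and s_nonzero: "j < n \<Longrightarrow> p \<in> strip \<Longrightarrow> s j p \<noteq> 0"
    and s_distinct: "j < n \<Longrightarrow> k < n \<Longrightarrow> j \<noteq> k \<Longrightarrow> p \<in> strip \<Longrightarrow> s j p \<noteq> s k p"
    and E: "E \<subseteq> {..<n} \<times> {..<n}" "acyclic E"
    and x_inflow: "x_inflow j \<in> {0..1}" and x_outflow: "x_outflow j \<in> {0..1}"
begin

definition along_rhs ::
  "(nat \<Rightarrow> nat \<Rightarrow> real \<times> real \<Rightarrow> real) \<Rightarrow> (nat \<Rightarrow> real \<times> real \<Rightarrow> real) \<Rightarrow> (nat \<Rightarrow> real \<times> real \<Rightarrow> real) \<Rightarrow>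
   (nat \<Rightarrow> real \<times> real \<Rightarrow> real) \<Rightarrow> nat \<Rightarrow> real \<times> real \<Rightarrow> real" where
  "along_rhs \<beta> f1 f2 u j = (\<lambda>p. f1 j p + s j p * f2 j p - (\<Sum>k<n. \<beta> j k p * u k p))"

definition weak_solution ::
  "(nat \<Rightarrow> nat \<Rightarrow> real \<times> real \<Rightarrow> real) \<Rightarrow> (nat \<Rightarrow> real \<times> real \<Rightarrow> real) \<Rightarrow> (nat \<Rightarrow> real \<times> real \<Rightarrow> real) \<Rightarrow>
   (nat \<Rightarrow> nat \<Rightarrow> real \<Rightarrow> real) \<Rightarrow> (nat \<Rightarrow> real \<Rightarrow> real) \<Rightarrow> (nat \<Rightarrow> real \<times> real \<Rightarrow> real) \<Rightarrow> bool" where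
  "weak_solution \<beta> f1 f2 r h u \<longleftrightarrow>
     (\<forall>j<n. continuous_on strip (u j) \<and> along (w j) (u j) (along_rhs \<beta> f1 f2 u j) \<and>
       (\<forall>t. u j (x_inflow j, t) = (\<Sum>k\<in>E `` {j}. r j k t * u k (x_outflow k, t)) + h j t))"

lemma E_less: "(j, k) \<in> E \<Longrightarrow> j < n" "(j, k) \<in> E \<Longrightarrow> k < n"
  using E(1) by auto

text \<open>The diagonal term \<open>\<beta> j j * u j\<close> has no transversality and is removed
  by the integrating factor \<open>K j\<close>. The remaining terms are integrated over
  characteristics of family \<open>j\<close>. Differentiability in time comes first; the
  \<open>x\<close>-partial then follows from the equation.\<close>

lemma weak_solution_C1:
  assumes s: "\<And>j. j < n \<Longrightarrow> Cxt (Suc 0) (s j)"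
    and \<beta>: "\<And>j k. j < n \<Longrightarrow> k < n \<Longrightarrow> Cxt (Suc 0) (\<beta> j k)"
    and r: "\<And>j k. (j, k) \<in> E \<Longrightarrow> C1 (Suc 0) (r j k)"
    and h: "\<And>j. j < n \<Longrightarrow> C1 (Suc 0) (h j)"
    and f1: "\<And>j. j < n \<Longrightarrow> Ct (Suc 0) (f1 j)"
    and f2: "\<And>j. j < n \<Longrightarrow> Cx (Suc 0) (f2 j)"
    and sol: "weak_solution \<beta> f1 f2 r h u"
    and "i < n"
  shows "Cxt (Suc 0) (u i)"
proof -
  have u: "continuous_on strip (u j)" and al: "along (w j) (u j) (along_rhs \<beta> f1 f2 u j)"
    and bc: "u j (x_inflow j, t) = (\<Sum>k\<in>E `` {j}. r j k t * u k (x_outflow k, t)) + h j t" if "j < n" for j t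
    using sol that by (auto simp: weak_solution_def)
  note c0 = Ck_dirs_imp_continuous_on
  have rhs: "continuous_on strip (along_rhs \<beta> f1 f2 u j)" if "j < n" for j
    unfolding along_rhs_def using that
    by (intro continuous_on_diff continuous_on_add continuous_on_mult continuous_on_sum u c0[OF s] c0[OF \<beta>]
        c0[OF f1] c0[OF f2]) auto
  define B where "B j = prim (\<beta> j j \<odot> Psi (w j))" for j
  define K where "K j = (\<lambda>p. exp (B j p))" for j
  define F where "F j = (\<lambda>p. f1 j p + s j p * f2 j p - (\<Sum>k\<in>{..<n} - {j}. \<beta> j k p * u k p))" for j
  define S where "S j = prim (\<lambda>p. K j p * (F j \<odot> Psi (w j)) p)" for j
  have K: "Cxt (Suc 0) (K j)" if "j < n" for j
  proof -
    interpret char_flow "s j" "st j" "w j" "L j" using that by (rule sys_flow)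
    have \<beta>P: "Cxt (Suc 0) (\<beta> j j \<odot> Psi (w j))" using \<beta> that Cxt_Psi by (intro Cxt_curve_comp)
    have "Cx (Suc 0) (B j)" unfolding B_def using c0[OF \<beta>P] by (rule Cx_prim)
    moreover have "Ct (Suc 0) (B j)" unfolding B_def using Cxt_imp_Ct[OF \<beta>P] by (rule Ct_prim)
    ultimately show ?thesis unfolding K_def using Cxt_1_iff by (intro Cxt_exp) blast
  qed
  have S: "Ct (Suc 0) (S j)" if j: "j < n" for j
  proof -
    interpret char_flow "s j" "st j" "w j" "L j" using j by (rule sys_flow)
    have Kj: "continuous_on strip (K j)" using K[OF j] by (rule c0)
    \<comment> \<open>Three sources, three reasons for differentiability in the label:
      \<open>f1\<close> is smooth in time, \<open>f2\<close> along the zero slope field, and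
      \<open>u k\<close> along its own characteristics, which are transversal to those of family
      \<open>j\<close>.\<close>
    define A1 where "A1 = (\<lambda>p. K j p * (f1 j \<odot> Psi (w j)) p)"
    define A2 where "A2 = (\<lambda>p. (K j p * (s j \<odot> Psi (w j)) p) * (f2 j \<odot> Psi (w j)) p)"
    define A3 where "A3 k = (\<lambda>p. (- K j p * (\<beta> j k \<odot> Psi (w j)) p) * (u k \<odot> Psi (w j)) p)" for k
    have c: "continuous_on strip A1" "continuous_on strip A2" "\<And>k. k < n \<Longrightarrow> continuous_on strip (A3 k)"
      unfolding A1_def A2_def A3_def
      using c0[OF f1] c0[OF f2] c0[OF \<beta>] c0[OF s] u j
      by (intro continuous_on_mult continuous_on_minus Kj cont_curve_comp cont_Psi; simp)+
    have 1: "Ct (Suc 0) (prim A1)"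
      unfolding A1_def
      by (intro Ct_prim Ck_dirs_mult Ct_curve_comp f1[OF j] Cxt_imp_Ct[OF K[OF j]] Cxt_imp_Ct[OF Cxt_Psi])
    have 2: "Ct (Suc 0) (prim A2)"
    proof -
      obtain f2x where f2x: "continuous_on strip (f2 j)" "x_partial (f2 j) f2x" "continuous_on strip f2x"
        using f2[OF j] by (rule Cx_1E)
      show ?thesis
        unfolding A2_def
        by (rule Ct_integral_across_characteristics[OF sys_flow[OF j] char_flow_vertical s[OF j] Ck_dirs_const
             s_nonzero[OF j] _ f2x(1) _ f2x(3)])
           (use f2x(2) K[OF j] Cxt_curve_comp[OF s[OF j] Cxt_Psi] in \<open>auto simp: along_vertical intro!: Ck_dirs_mult simp del: Ck_dirs.simps\<close>)
    qed
    have 3: "Ct (Suc 0) (prim (A3 k))" if k: "k < n" "k \<noteq> j" for k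
      unfolding A3_def
      by (rule Ct_integral_across_characteristics[OF sys_flow[OF j] sys_flow[OF k(1)] s[OF j] s[OF k(1)]
           s_distinct[OF j k(1)] _ u[OF k(1)] al[OF k(1)] rhs[OF k(1)]])
         (use K[OF j] Cxt_curve_comp[OF \<beta>[OF j k(1)] Cxt_Psi] k in
           \<open>auto intro!: Ck_dirs_mult Ck_dirs_minus simp del: Ck_dirs.simps\<close>)
    have "Ct (Suc 0) (\<lambda>p. prim A1 p + (prim A2 p + (\<Sum>k\<in>{..<n} - {j}. prim (A3 k) p)))"
      using 1 2 3 by (intro Ck_dirs_add Ck_dirs_sum) auto
    also have "?this \<longleftrightarrow> ?thesis"
    proof (rule Ck_dirs_cong)
      fix p assume "p \<in> strip"
      then obtain x t where p: "p = (x, t)" "x \<in> {0..1}" by (cases p) auto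
      have "prim A1 p + (prim A2 p + (\<Sum>k\<in>{..<n} - {j}. prim (A3 k) p)) =
        prim (\<lambda>p. A1 p + (A2 p + (\<Sum>k\<in>{..<n} - {j}. A3 k p))) p"
      proof -
        have c3: "continuous_on strip (\<lambda>p. \<Sum>k\<in>{..<n} - {j}. A3 k p)"
          using c(3) by (intro continuous_on_sum) auto
        have "prim (\<lambda>p. \<Sum>k\<in>{..<n} - {j}. A3 k p) (x, t) = (\<Sum>k\<in>{..<n} - {j}. prim (A3 k) (x, t))"
          by (rule prim_sum[OF _ c(3) p(2)]) auto
        thus ?thesis
          unfolding p(1) prim_add[OF c(1) continuous_on_add[OF c(2) c3] p(2)] prim_add[OF c(2) c3 p(2)] by simp
      qed
      also have "\<dots> = S j p"
        unfolding S_def p(1)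
        by (rule prim_cong[OF p(2)])
           (simp add: A1_def A2_def A3_def F_def curve_comp_def algebra_simps sum_distrib_left sum_negf)
      finally show "prim A1 p + (prim A2 p + (\<Sum>k\<in>{..<n} - {j}. prim (A3 k) p)) = S j p" .
    qed
    finally show ?thesis .
  qed
  have Kpos: "K j p > 0" for j p by (simp add: K_def)
  have rep: "K j (x, y) * u j (x, Psi (w j) (x, y)) = u j (0, y) + S j (x, y)"
    if j: "j < n" and x: "x \<in> {0..1}" for j x y
  proof -
    interpret char_flow "s j" "st j" "w j" "L j" using j by (rule sys_flow)
    have \<beta>P: "continuous_on strip (\<beta> j j \<odot> Psi (w j))"
      using j by (intro cont_curve_comp c0[OF \<beta>] cont_Psi)
    have "x_partial (K j) (\<lambda>p. K j p * (\<beta> j j \<odot> Psi (w j)) p)"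
      using prim_x[OF \<beta>P] by (auto simp: has_partial_on_strip_x K_def B_def intro!: DERIV_exp_within)
    from has_partial_on_mult[OF this iffD1[OF along_iff_Psi al[OF j]]]
    have "x_partial (\<lambda>p. K j p * (u j \<odot> Psi (w j)) p) (\<lambda>p. K j p * (F j \<odot> Psi (w j)) p)"
    proof (rule has_partial_on_cong[THEN iffD1, rotated 2])
      fix p assume "p \<in> strip"
      have "(\<Sum>k<n. \<beta> j k q * u k q) = \<beta> j j q * u j q + (\<Sum>k\<in>{..<n} - {j}. \<beta> j k q * u k q)" for q
        using j by (subst sum.remove[of _ j]) auto
      thus "K j p * (\<beta> j j \<odot> Psi (w j)) p * (u j \<odot> Psi (w j)) p + K j p * (along_rhs \<beta> f1 f2 u j \<odot> Psi (w j)) p =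
        K j p * (F j \<odot> Psi (w j)) p"
        by (simp add: curve_comp_def along_rhs_def F_def algebra_simps)
    qed auto
    from prim_eq_diff[OF this x, of y]
    have "S j (x, y) = K j (x, y) * u j (x, Psi (w j) (x, y)) - K j (0, y) * u j (0, Psi (w j) (0, y))"
      by (simp add: S_def)
    moreover have "K j (0, y) = 1" by (simp add: K_def B_def prim_def)
    moreover have "Psi (w j) (0, y) = y" using init[of 0 y] by (simp add: Psi_def)
    ultimately show ?thesis by simp
  qed
  have Ct_slice: "Ct (Suc 0) (\<lambda>p. f (x, snd p))" if "Ct (Suc 0) f" "x \<in> {0..1}" for f x
    using Ct_of_trace[OF Ck_dirs_trace[OF that]] .
  have wfE: "wf (E\<inverse>)"
    by (rule finite_acyclic_wf_converse[OF finite_subset[OF E(1)] E(2)]) simp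
  have ut: "j < n \<longrightarrow> Ct (Suc 0) (u j)" for j
  \<comment> \<open>The induction hypothesis covers all \<open>k\<close> with
    \<open>(j, k) \<in> E\<close>, exactly the components whose outflow traces enter the boundary
    value of component \<open>j\<close>.\<close>
  proof (induction j rule: wf_induct_rule[OF wfE])
    case (1 j)
    show ?case
    proof
      assume j: "j < n"
      interpret char_flow "s j" "st j" "w j" "L j" using j by (rule sys_flow)
      define b where "b = (\<lambda>p :: real \<times> real. (\<Sum>k\<in>E `` {j}. r j k (snd p) * u k (x_outflow k, snd p)) + h j (snd p))"
      have b: "Ct (Suc 0) b"
        unfolding b_def
      proof (intro Ck_dirs_add Ck_dirs_sum Ck_dirs_mult)
        fix k assume k: "k \<in> E `` {j}"
        thus "Ct (Suc 0) (\<lambda>p. r j k (snd p))" by (intro Ct_of_trace r) auto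
        show "Ct (Suc 0) (\<lambda>p. u k (x_outflow k, snd p))"
          using k 1 E_less x_outflow by (intro Ct_slice) auto
      qed (intro Ct_of_trace h j)
      have Kj: "Ct (Suc 0) (K j)" using K[OF j] by (rule Cxt_imp_Ct)
      define \<gamma> where "\<gamma> = (\<lambda>p :: real \<times> real. Psi (w j) (x_inflow j, snd p))"
      have \<gamma>: "Ct (Suc 0) \<gamma>" unfolding \<gamma>_def using Cxt_imp_Ct[OF Cxt_Psi] x_inflow by (rule Ct_slice)
      \<comment> \<open>\<open>rep\<close> at the inflow edge, solved for the trace at
        \<open>x = 0\<close>: this edge carries the labels even when the inflow is at
        \<open>x = 1\<close>.\<close>
      define u0 where "u0 = (\<lambda>p. K j (x_inflow j, snd p) * (b \<odot> \<gamma>) p - S j (x_inflow j, snd p))"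
      have u0: "Ct (Suc 0) u0"
        unfolding u0_def
        by (intro Ck_dirs_diff Ck_dirs_mult Ct_slice[OF Kj x_inflow] Ct_slice[OF S[OF j] x_inflow] Ct_curve_comp b \<gamma>)
      have u0_eq: "u0 (x, y) = u j (0, y)" for x y
        using rep[OF j x_inflow, of j y] bc[OF j, of "Psi (w j) (x_inflow j, y)"]
        by (simp add: u0_def b_def \<gamma>_def curve_comp_def algebra_simps)
      define V where "V = (\<lambda>p. (u0 p + S j p) / K j p)"
      have "Ct (Suc 0) V"
        unfolding V_def using Kpos by (intro Ck_dirs_divide Ck_dirs_add u0 S[OF j] Kj) (metis less_irrefl)
      hence "Ct (Suc 0) (V \<odot> Foot (w j))" using Ct_Foot by (rule Ct_curve_comp)
      also have "?this \<longleftrightarrow> Ct (Suc 0) (u j)"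
      proof (rule Ck_dirs_cong)
        fix p assume "p \<in> strip"
        then obtain x t where p: "p = (x, t)" "x \<in> {0..1}" by (cases p) auto
        have "u j p * K j (x, Foot (w j) p) = u0 (x, Foot (w j) p) + S j (x, Foot (w j) p)"
          using rep[OF j p(2), of "Foot (w j) p"] p by (simp add: u0_eq mult.commute)
        hence "(u0 (x, Foot (w j) p) + S j (x, Foot (w j) p)) / K j (x, Foot (w j) p) = u j p"
          using Kpos[of j "(x, Foot (w j) p)"] by (metis less_irrefl nonzero_eq_divide_eq)
        thus "(V \<odot> Foot (w j)) p = u j p" using p by (simp add: V_def)
      qed
      finally show "Ct (Suc 0) (u j)" .
    qed
  qed
  interpret char_flow "s i" "st i" "w i" "L i" using \<open>i < n\<close> by (rule sys_flow)
  obtain ut where ut: "t_partial (u i) ut" "continuous_on strip ut"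
    using ut \<open>i < n\<close> by (blast elim: Ct_1E)
  show ?thesis
  proof (rule Cxt_SucI[OF u[OF \<open>i < n\<close>] x_partial_from_along[OF ut al[OF \<open>i < n\<close>]] _ ut(1)])
    show "Cxt 0 (\<lambda>p. along_rhs \<beta> f1 f2 u i p - ut p * s i p)"
      using rhs[OF \<open>i < n\<close>] ut(2) slope_cont(1) by (auto intro!: continuous_intros)
  qed (use ut(2) in simp)
qed

end

context hyp_system
begin

text \<open>If \<open>u\<close> is \<open>C\<^sup>1\<close>, then \<open>v j = \<partial>\<^sub>t u j - f2 j\<close> solves a system of the same form whose data have one
  derivative less. Subtracting \<open>f2\<close> trades its \<open>t\<close>-derivative for \<open>\<partial>\<^sub>x f2\<close>.\<close>

lemma weak_solution_regular:
  assumes s: "\<And>j. j < n \<Longrightarrow> Cxt (Suc d) (s j)"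
    and \<beta>: "\<And>j k. j < n \<Longrightarrow> k < n \<Longrightarrow> Cxt (Suc d) (\<beta> j k)"
    and r: "\<And>j k. (j, k) \<in> E \<Longrightarrow> C1 (Suc d) (r j k)"
    and h: "\<And>j. j < n \<Longrightarrow> C1 (Suc d) (h j)"
    and f1: "\<And>j. j < n \<Longrightarrow> Cxt d (f1 j) \<and> Ct (Suc d) (f1 j)"
    and f2: "\<And>j. j < n \<Longrightarrow> Cxt d (f2 j) \<and> Cx (Suc d) (f2 j)"
    and sol: "weak_solution \<beta> f1 f2 r h u"
    and "i < n"
  shows "Cxt (Suc d) (u i)"
  using assms
proof (induction d arbitrary: \<beta> f1 f2 h u i)
  case 0
  thus ?case by (intro weak_solution_C1[of \<beta> r h f1 f2 u i]) auto
next
  case (Suc d)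
  note s = Suc.prems(1) and \<beta> = Suc.prems(2) and r = Suc.prems(3) and h = Suc.prems(4)
    and f1 = Suc.prems(5) and f2 = Suc.prems(6) and sol = Suc.prems(7) and c0 = Ck_dirs_imp_continuous_on
  \<comment> \<open>First use of the induction hypothesis, with the data regarded as one order
    rougher; the second use, below, is for \<open>v\<close>.\<close>
  have u: "Cxt (Suc d) (u j)" if "j < n" for j
    by (rule Suc.IH[of \<beta> h f1 f2])
       (use s \<beta> r h f1 f2 sol that in \<open>auto intro: Ck_dirs_Suc_D simp del: Ck_dirs.simps\<close>)
  \<comment> \<open>The pure and the mixed smoothness of \<open>f1 j\<close> may come with different
    time derivatives; \<open>g\<close> has to serve for both.\<close>
  have "\<exists>f1t. t_partial (f1 j) f1t \<and> Ct (Suc d) f1t \<and> Cxt d f1t" if j: "j < n" for j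
  proof -
    obtain g where g: "t_partial (f1 j) g" "Ct (Suc d) g"
      using conjunct2[OF f1[OF j]] by (rule Ct_SucE)
    moreover have "Cxt d g"
      by (rule Ck_dirs_partial[OF conjunct1[OF f1[OF j]] _ g(1) c0[OF g(2)] strip_nondegenerate_t])
         (simp add: Basis_real_pair)
    ultimately show ?thesis by blast
  qed
  then obtain f1t where f1t: "\<And>j. j < n \<Longrightarrow> t_partial (f1 j) (f1t j)"
    "\<And>j. j < n \<Longrightarrow> Ct (Suc d) (f1t j)" "\<And>j. j < n \<Longrightarrow> Cxt d (f1t j)" by metis
  have "\<exists>f2x. x_partial (f2 j) f2x \<and> Cx (Suc d) f2x \<and> Cxt d f2x" if j: "j < n" for j
  proof -
    obtain g where g: "x_partial (f2 j) g" "Cx (Suc d) g"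
      using conjunct2[OF f2[OF j]] by (rule Cx_SucE)
    moreover have "Cxt d g"
      by (rule Ck_dirs_partial[OF conjunct1[OF f2[OF j]] _ g(1) c0[OF g(2)] strip_nondegenerate_x])
         (simp add: Basis_real_pair)
    ultimately show ?thesis by blast
  qed
  then obtain f2x where f2x: "\<And>j. j < n \<Longrightarrow> x_partial (f2 j) (f2x j)"
    "\<And>j. j < n \<Longrightarrow> Cx (Suc d) (f2x j)" "\<And>j. j < n \<Longrightarrow> Cxt d (f2x j)" by metis
  have "\<exists>f2t. t_partial (f2 j) f2t \<and> Cxt d f2t" if j: "j < n" for j
    using conjunct1[OF f2[OF j]] by (blast elim: Cxt_SucE)
  then obtain f2t where f2t: "\<And>j. j < n \<Longrightarrow> t_partial (f2 j) (f2t j)"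
    "\<And>j. j < n \<Longrightarrow> Cxt d (f2t j)" by metis
  have "\<exists>bt. t_partial (\<beta> j k) bt \<and> Cxt (Suc d) bt" if "j < n" "k < n" for j k
    using \<beta>[OF that] by (blast elim: Cxt_SucE)
  then obtain \<beta>t where \<beta>t: "\<And>j k. j < n \<Longrightarrow> k < n \<Longrightarrow> t_partial (\<beta> j k) (\<beta>t j k)"
    "\<And>j k. j < n \<Longrightarrow> k < n \<Longrightarrow> Cxt (Suc d) (\<beta>t j k)" by metis
  have "\<exists>ut. t_partial (u j) ut \<and> Cxt d ut" if "j < n" for j
    using u[OF that] by (blast elim: Cxt_SucE)
  then obtain ut where ut: "\<And>j. j < n \<Longrightarrow> t_partial (u j) (ut j)"
    "\<And>j. j < n \<Longrightarrow> Cxt d (ut j)" by metis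
  have "\<exists>r'. (\<forall>t. (r j k has_real_derivative r' t) (at t)) \<and> C1 (Suc d) r'" if "(j, k) \<in> E" for j k
    using r[OF that] by (rule C1_SucE) blast
  then obtain r' where r': "\<And>j k t. (j, k) \<in> E \<Longrightarrow> (r j k has_real_derivative r' j k t) (at t)"
    "\<And>j k. (j, k) \<in> E \<Longrightarrow> C1 (Suc d) (r' j k)" by metis
  have "\<exists>h'. (\<forall>t. (h j has_real_derivative h' t) (at t)) \<and> C1 (Suc d) h'" if "j < n" for j
    using h[OF that] by (rule C1_SucE) blast
  then obtain h' where h': "\<And>j t. j < n \<Longrightarrow> (h j has_real_derivative h' j t) (at t)"
    "\<And>j. j < n \<Longrightarrow> C1 (Suc d) (h' j)" by metis
  have st: "Cxt (Suc d) (st j)" if j: "j < n" for j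
  proof -
    interpret char_flow "s j" "st j" "w j" "L j" using j by (rule sys_flow)
    show ?thesis
      by (rule Ck_dirs_partial[OF s[OF j] _ slope_partial slope_cont(2) strip_nondegenerate_t])
         (simp add: Basis_real_pair)
  qed
  \<comment> \<open>Origin of the new data: \<open>st j\<close> on the diagonal is the commutator of
    the time derivative with the derivative along the flow; \<open>\<beta> j k * f2 k\<close> comes
    from \<open>ut k = v k + f2 k\<close>; and \<open>f2x j\<close> appears without the factor
    \<open>s j\<close>, hence the inverse in \<open>f2'\<close>.\<close>
  define v where "v j = (\<lambda>p. ut j p - f2 j p)" for j
  define \<beta>' where "\<beta>' j k = (\<lambda>p. \<beta> j k p + (if k = j then st j p else 0))" for j k
  define f1' where "f1' j = (\<lambda>p. f1t j p - (\<Sum>k<n. \<beta>t j k p * u k p + \<beta> j k p * f2 k p))" for j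
  define f2' where "f2' j = (\<lambda>p. - (inverse (s j p) * f2x j p))" for j
  define g where "g j = (\<lambda>t. (\<Sum>k\<in>E `` {j}. r' j k t * u k (x_outflow k, t) + r j k t * f2 k (x_outflow k, t))
    + h' j t - f2 j (x_inflow j, t))" for j
  have bc: "u j (x_inflow j, t) = (\<Sum>k\<in>E `` {j}. r j k t * u k (x_outflow k, t)) + h j t" if "j < n" for j t
    using sol that by (auto simp: weak_solution_def)
  have al: "along (w j) (u j) (along_rhs \<beta> f1 f2 u j)" if "j < n" for j
    using sol that by (auto simp: weak_solution_def)
  have rhs: "Cxt (Suc d) (along_rhs \<beta> f1 f2 u j)" if "j < n" for j
    unfolding along_rhs_def using that f1 f2 s[THEN Ck_dirs_Suc_D] \<beta>[THEN Ck_dirs_Suc_D] u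
    by (intro Ck_dirs_diff Ck_dirs_add Ck_dirs_mult Ck_dirs_sum) (auto simp del: Ck_dirs.simps)
  have "weak_solution \<beta>' f1' f2' r g v"
    unfolding weak_solution_def
  proof (intro allI impI conjI)
    fix j assume j: "j < n"
    interpret char_flow "s j" "st j" "w j" "L j" using j by (rule sys_flow)
    show "continuous_on strip (v j)"
      unfolding v_def using j f2 by (intro continuous_on_diff c0[OF ut(2)]) (auto dest: c0 simp del: Ck_dirs.simps)
    define St where "St = (\<lambda>p. f1t j p + (st j p * f2 j p + s j p * f2t j p) - (\<Sum>k<n. \<beta>t j k p * u k p + \<beta> j k p * ut k p))"
    have "t_partial (along_rhs \<beta> f1 f2 u j) St"
      unfolding along_rhs_def St_def using j f1t f2t slope_partial \<beta>t ut
      by (intro has_partial_on_diff has_partial_on_add has_partial_on_mult has_partial_on_sum) auto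
    moreover have "continuous_on strip St"
      unfolding St_def using j c0[OF f1t(3)] c0[OF conjunct1[OF f2]] c0[OF f2t(2)] slope_cont
        c0[OF \<beta>t(2)] c0[OF u] c0[OF \<beta>] c0[OF ut(2)]
      by (intro continuous_on_diff continuous_on_add continuous_on_mult continuous_on_sum) auto
    ultimately have "along (w j) (ut j) (\<lambda>p. St p - st j p * ut j p)"
      by (intro along_t_partial[OF ut(1)[OF j] al[OF j]] c0[OF rhs[OF j]])
    moreover have "along (w j) (f2 j) (\<lambda>p. f2x j p + f2t j p * s j p)"
      by (rule along_classical[OF f2x(1)[OF j] f2t(1)[OF j] c0[OF f2t(2)[OF j]]])
    ultimately have main: "along (w j) (v j) (\<lambda>p. (St p - st j p * ut j p) - (f2x j p + f2t j p * s j p))"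
      unfolding v_def by (rule along_diff)
    \<comment> \<open>The two terms \<open>s j * f2t j\<close> cancel, and
      \<open>st j * f2 j - st j * ut j\<close> combines to \<open>- st j * v j\<close>.\<close>
    have eq: "(St p - st j p * ut j p) - (f2x j p + f2t j p * s j p) = along_rhs \<beta>' f1' f2' v j p"
      if "p \<in> strip" for p
    proof -
      have "(\<Sum>k<n. \<beta>' j k p * v k p) = (\<Sum>k<n. \<beta> j k p * v k p) + (\<Sum>k<n. (if k = j then st j p else 0) * v k p)"
        by (simp add: \<beta>'_def algebra_simps sum.distrib)
      also have "(\<Sum>k<n. (if k = j then st j p else 0) * v k p) = st j p * v j p"
        using j by (simp add: if_distrib[of "\<lambda>x. x * _"] cong: if_cong)
      finally have *: "(\<Sum>k<n. \<beta>' j k p * v k p) = (\<Sum>k<n. \<beta> j k p * v k p) + st j p * v j p" .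
      have "s j p * f2' j p = - f2x j p" using s_nonzero[OF j that] by (simp add: f2'_def)
      thus ?thesis
        unfolding along_rhs_def *
        by (simp add: St_def f1'_def v_def algebra_simps sum.distrib sum_subtractf)
    qed
    show "along (w j) (v j) (along_rhs \<beta>' f1' f2' v j)" by (rule iffD1[OF along_cong[OF eq] main])
    fix t
    have "((\<lambda>t. u j (x_inflow j, t)) has_real_derivative ut j (x_inflow j, t)) (at t)"
      using ut(1)[OF j] x_inflow by (simp add: has_partial_on_strip_t)
    moreover have "((\<lambda>t. u j (x_inflow j, t)) has_real_derivative
      (\<Sum>k\<in>E `` {j}. r' j k t * u k (x_outflow k, t) + r j k t * ut k (x_outflow k, t)) + h' j t) (at t)"
      unfolding bc[OF j]
    proof (intro DERIV_add DERIV_sum h' j)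
      fix k assume "k \<in> E `` {j}"
      hence k: "(j, k) \<in> E" "k < n" using E_less by auto
      have "((\<lambda>t. u k (x_outflow k, t)) has_real_derivative ut k (x_outflow k, t)) (at t)"
        using ut(1)[OF k(2)] x_outflow by (simp add: has_partial_on_strip_t)
      from DERIV_mult[OF r'(1)[OF k(1)] this]
      show "((\<lambda>t. r j k t * u k (x_outflow k, t)) has_real_derivative
        r' j k t * u k (x_outflow k, t) + r j k t * ut k (x_outflow k, t)) (at t)" by (simp add: mult.commute)
    qed
    ultimately have "ut j (x_inflow j, t) =
      (\<Sum>k\<in>E `` {j}. r' j k t * u k (x_outflow k, t) + r j k t * ut k (x_outflow k, t)) + h' j t"
      by (rule DERIV_unique)
    thus "v j (x_inflow j, t) = (\<Sum>k\<in>E `` {j}. r j k t * v k (x_outflow k, t)) + g j t"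
      by (simp add: v_def g_def algebra_simps sum.distrib sum_subtractf)
  qed
  moreover have "Cxt (Suc d) (\<beta>' j k)" if "j < n" "k < n" for j k
    unfolding \<beta>'_def using \<beta>[OF that] st[OF that(1)]
    by (cases "k = j"; intro Ck_dirs_add) (simp_all add: Ck_dirs_Suc_D Ck_dirs_const del: Ck_dirs.simps)
  moreover have "Cxt d (f1' j) \<and> Ct (Suc d) (f1' j)" if j: "j < n" for j
  proof
    have "Cxt d (\<beta> j k)" "Cxt d (\<beta>t j k)" "Cxt d (u k)" "Cxt d (f2 k)" if "k < n" for k
      using \<beta>[OF j that] \<beta>t(2)[OF j that] u[OF that] f2[OF that]
      by (auto intro: Ck_dirs_Suc_D simp del: Ck_dirs.simps)
    thus "Cxt d (f1' j)"
      unfolding f1'_def using f1t(3)[OF j] by (intro Ck_dirs_diff Ck_dirs_add Ck_dirs_mult Ck_dirs_sum) auto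
    have "Ct (Suc d) (\<beta> j k)" "Ct (Suc d) (\<beta>t j k)" "Ct (Suc d) (u k)" "Ct (Suc d) (f2 k)" if "k < n" for k
      using \<beta>[OF j that, THEN Ck_dirs_Suc_D] \<beta>t(2)[OF j that] u[OF that] f2[OF that]
      by (auto intro: Cxt_imp_Ct simp del: Ck_dirs.simps)
    thus "Ct (Suc d) (f1' j)"
      unfolding f1'_def using f1t(2)[OF j]
      by (intro Ck_dirs_diff Ck_dirs_add Ck_dirs_mult Ck_dirs_sum) (auto simp del: Ck_dirs.simps)
  qed
  moreover have "Cxt d (f2' j) \<and> Cx (Suc d) (f2' j)" if j: "j < n" for j
  proof
    have inv: "Cxt (Suc d) (\<lambda>p. inverse (s j p))"
      using s[OF j, THEN Ck_dirs_Suc_D] s_nonzero[OF j] by (rule Ck_dirs_inverse)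
    show "Cxt d (f2' j)"
      unfolding f2'_def using Ck_dirs_Suc_D[OF inv] f2x(3)[OF j] by (intro Ck_dirs_minus Ck_dirs_mult)
    show "Cx (Suc d) (f2' j)"
      unfolding f2'_def using Cxt_imp_Cx[OF inv] f2x(2)[OF j] by (intro Ck_dirs_minus Ck_dirs_mult)
  qed
  moreover have "C1 (Suc d) (g j)" if j: "j < n" for j
    unfolding g_def
  proof (intro Ck_dirs_diff Ck_dirs_add Ck_dirs_sum Ck_dirs_mult)
    fix k assume "k \<in> E `` {j}"
    hence k: "(j, k) \<in> E" "k < n" using E_less by auto
    show "C1 (Suc d) (r' j k)" by (rule r'(2)[OF k(1)])
    show "C1 (Suc d) (r j k)" by (rule Ck_dirs_Suc_D[OF r[OF k(1)]])
    show "C1 (Suc d) (\<lambda>t. u k (x_outflow k, t))"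
      by (rule Ck_dirs_trace[OF Cxt_imp_Ct[OF u[OF k(2)]] x_outflow])
    show "C1 (Suc d) (\<lambda>t. f2 k (x_outflow k, t))"
      by (rule Ck_dirs_trace[OF Cxt_imp_Ct[OF conjunct1[OF f2[OF k(2)]]] x_outflow])
  next
    show "C1 (Suc d) (h' j)" by (rule h'(2)[OF j])
    show "C1 (Suc d) (\<lambda>t. f2 j (x_inflow j, t))"
      by (rule Ck_dirs_trace[OF Cxt_imp_Ct[OF conjunct1[OF f2[OF j]]] x_inflow])
  qed
  ultimately have v: "Cxt (Suc d) (v j)" if "j < n" for j
    using that by (intro Suc.IH[of \<beta>' g f1' f2' v j])
      (auto intro: Ck_dirs_Suc_D[OF s] Ck_dirs_Suc_D[OF r] simp del: Ck_dirs.simps)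
  have i: "i < n" by fact
  \<comment> \<open>Undoing the shift by \<open>f2\<close> gives the time derivative its full order;
    the \<open>x\<close>-partial is then expressed through the equation.\<close>
  have "Cxt (Suc d) (\<lambda>p. v i p + f2 i p)"
    using v[OF i] conjunct1[OF f2[OF i]] by (rule Ck_dirs_add)
  hence ut': "Cxt (Suc d) (ut i)" by (simp add: v_def)
  interpret char_flow "s i" "st i" "w i" "L i" using i by (rule sys_flow)
  show ?case
  proof (rule Cxt_SucI[OF c0[OF u[OF i]] x_partial_from_along[OF ut(1)[OF i] c0[OF ut'] al[OF i]] _ ut(1)[OF i] ut'])
    show "Cxt (Suc d) (\<lambda>p. along_rhs \<beta> f1 f2 u i p - ut i p * s i p)"
      using rhs[OF i] ut' Ck_dirs_Suc_D[OF s[OF i]] by (intro Ck_dirs_diff Ck_dirs_mult)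
  qed
qed

end

section \<open>Regularity of the integral operators\<close>

lemma mem_wedge [simp]: "(\<xi>, x, t) \<in> wedge \<longleftrightarrow> 0 \<le> \<xi> \<and> \<xi> \<le> x \<and> x \<le> 1"
  by (auto simp: wedge_def)

lemma Basis_real_triple: "(Basis :: (real \<times> real \<times> real) set) = {(1, 0, 0), (0, 1, 0), (0, 0, 1)}"
  by (auto simp: Basis_prod_def zero_prod_def)

lemma has_partial_on_line:
  fixes S :: "'a::euclidean_space set"
  assumes "has_partial_on e S f g" "\<And>s. s \<in> I \<Longrightarrow> c + s *\<^sub>R e \<in> S" "s \<in> I"
  shows "((\<lambda>s. f (c + s *\<^sub>R e)) has_real_derivative g (c + s *\<^sub>R e)) (at s within I)"
proof -
  let ?h = "\<lambda>r. f (c + s *\<^sub>R e + r *\<^sub>R e)"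
  have "(?h has_real_derivative g (c + s *\<^sub>R e)) (at 0 within {r. c + s *\<^sub>R e + r *\<^sub>R e \<in> S})"
    using assms(1) assms(2)[OF assms(3)] by (simp add: has_partial_on_def)
  hence "(?h has_real_derivative g (c + s *\<^sub>R e)) (at 0 within (\<lambda>r. r - s) ` I)"
    by (rule DERIV_subset) (use assms(2) in \<open>auto simp: algebra_simps\<close>)
  moreover have "(+) s ` (\<lambda>r. r - s) ` I = I" by (simp add: image_image)
  ultimately have "((\<lambda>r. f (c + r *\<^sub>R e)) has_real_derivative g (c + s *\<^sub>R e)) (at (s + 0) within I)"
    using DERIV_at_within_shift[of "\<lambda>r. f (c + r *\<^sub>R e)" "g (c + s *\<^sub>R e)" s 0 "(\<lambda>r. r - s) ` I"]
    by (simp add: scaleR_add_left add.assoc)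
  thus ?thesis by simp
qed

lemma has_partial_on_wedge_\<xi>:
  assumes "has_partial_on (1, 0, 0) wedge f g" "0 \<le> \<xi>" "\<xi> \<le> x" "x \<le> 1"
  shows "((\<lambda>\<xi>. f (\<xi>, x, t)) has_real_derivative g (\<xi>, x, t)) (at \<xi> within {0..x})"
  using has_partial_on_line[OF assms(1), of "{0..x}" "(0, x, t)" \<xi>] assms(2-) by simp

lemma has_partial_on_wedge_x:
  assumes "has_partial_on (0, 1, 0) wedge f g" "0 \<le> \<xi>" "\<xi> \<le> x" "x \<le> 1"
  shows "((\<lambda>x. f (\<xi>, x, t)) has_real_derivative g (\<xi>, x, t)) (at x within {\<xi>..1})"
  using has_partial_on_line[OF assms(1), of "{\<xi>..1}" "(\<xi>, 0, t)" x] assms(2-) by simp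

lemma has_partial_on_wedge_t:
  assumes "has_partial_on (0, 0, 1) wedge f g" "0 \<le> \<xi>" "\<xi> \<le> x" "x \<le> 1"
  shows "((\<lambda>t. f (\<xi>, x, t)) has_real_derivative g (\<xi>, x, t)) (at t)"
  using has_partial_on_line[OF assms(1), of UNIV "(\<xi>, x, 0)" t] assms(2-) by simp

text \<open>Only the edge \<open>\<xi> = x = 1\<close> has no segment in the
  \<open>x\<close>-direction, and its points are limits of points with
  \<open>\<xi> < 1\<close>.\<close>

lemma wedge_nondegenerate_x: "wedge \<subseteq> closure {p\<in>wedge. 0 islimpt {s. p + s *\<^sub>R (0, 1, 0) \<in> wedge}}"
  (is "_ \<subseteq> closure ?D")
proof
  fix p assume "p \<in> wedge"
  then obtain \<xi> x t where p: "p = (\<xi>, x, t)" "0 \<le> \<xi>" "\<xi> \<le> x" "x \<le> 1" by (cases p) auto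
  have D: "(\<zeta>, y, r) \<in> ?D" if "0 \<le> \<zeta>" "\<zeta> < 1" "\<zeta> \<le> y" "y \<le> 1" for \<zeta> y r
  proof -
    have "{s. (\<zeta>, y, r) + s *\<^sub>R (0, 1, 0) \<in> wedge} = {\<zeta> - y..1 - y}" using that by auto
    thus ?thesis using that by (simp add: islimpt_Icc)
  qed
  show "p \<in> closure ?D"
  proof (cases "\<xi> < 1")
    case True
    hence "p \<in> ?D" unfolding p(1) using p by (intro D)
    thus ?thesis by (rule subsetD[OF closure_subset])
  next
    case False
    hence p1: "p = (1, 1, t)" using p by auto
    define X where "X n = (1 - inverse (real (Suc n)), 1::real, t)" for n
    have "X \<longlonglongrightarrow> (1 - 0, 1, t)"
      unfolding X_def[abs_def] by (intro tendsto_intros LIMSEQ_inverse_real_of_nat)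
    hence lim: "X \<longlonglongrightarrow> (1, 1, t)" by simp
    have "X n \<in> ?D" for n
      unfolding X_def by (rule D) (auto simp: field_simps)
    thus ?thesis unfolding p1 closure_sequential using lim by blast
  qed
qed

lemma continuous_on_wedge_compose:
  assumes "continuous_on wedge g" "continuous_on S \<xi>" "continuous_on S x" "continuous_on S \<theta>"
    "\<And>p. p \<in> S \<Longrightarrow> 0 \<le> \<xi> p \<and> \<xi> p \<le> x p \<and> x p \<le> 1"
  shows "continuous_on S (\<lambda>p. g (\<xi> p, x p, \<theta> p))"
  by (rule continuous_on_compose2[OF assms(1)]) (use assms in \<open>auto intro!: continuous_intros\<close>)

section \<open>Restriction to the diagonal of the wedge\<close>

definition diag :: "(real \<times> real \<times> real \<Rightarrow> real) \<Rightarrow> real \<times> real \<Rightarrow> real" where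
  "diag f = (\<lambda>p. f (fst p, fst p, snd p))"

lemma cont_diag: "continuous_on wedge f \<Longrightarrow> continuous_on strip (diag f)"
  unfolding diag_def
  by (rule continuous_on_wedge_compose) (auto intro!: continuous_intros)

lemma integral_affine_derivative:
  fixes F f :: "real \<Rightarrow> real"
  assumes "a \<le> b" "\<And>x. x \<in> {a..b} \<Longrightarrow> (F has_real_derivative f x) (at x within {a..b})"
  shows "F b - F a = (b - a) * integral {0..1} (\<lambda>s. f (a + s * (b - a)))"
proof -
  have "((\<lambda>s. f (a + s * (b - a)) * (b - a)) has_integral (F (a + 1 * (b - a)) - F (a + 0 * (b - a)))) {0..1}"
  proof (rule FTC_0x)
    fix s :: real assume s: "s \<in> {0..1}"
    hence "0 \<le> s * (b - a)" "s * (b - a) \<le> b - a"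
      using assms(1) by (auto intro: mult_left_le_one_le)
    hence in_ab: "a + s * (b - a) \<in> {a..b}" by auto
    have "((\<lambda>s. a + s * (b - a)) has_real_derivative b - a) (at s within {0..1})"
      by (auto intro!: derivative_eq_intros)
    moreover have "(\<lambda>s. a + s * (b - a)) ` {0..1} \<subseteq> {a..b}"
    proof
      fix y assume "y \<in> (\<lambda>s. a + s * (b - a)) ` {0..1}"
      then obtain r where "r \<in> {0..1}" "y = a + r * (b - a)" by auto
      moreover from this have "0 \<le> r * (b - a)" "r * (b - a) \<le> b - a"
        using assms(1) by (auto intro: mult_left_le_one_le)
      ultimately show "y \<in> {a..b}" by auto
    qed
    ultimately show "((\<lambda>s. F (a + s * (b - a))) has_real_derivative f (a + s * (b - a)) * (b - a)) (at s within {0..1})"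
      using DERIV_image_chain[of F "f (a + s * (b - a))" "\<lambda>s. a + s * (b - a)" s "{0..1}" "b - a"]
        DERIV_subset[OF assms(2)[OF in_ab]]
      by (simp add: comp_def)
  qed auto
  from integral_unique[OF this] show ?thesis by (simp add: mult.commute)
qed

text \<open>One-sided partials on both sides of the diagonal suffice: two points of the diagonal are joined
  inside the wedge through the corner \<open>(min, max)\<close>.\<close>

lemma diag_x:
  assumes f\<xi>: "has_partial_on (1, 0, 0) wedge f f\<xi>" "continuous_on wedge f\<xi>"
    and fx: "has_partial_on (0, 1, 0) wedge f fx" "continuous_on wedge fx"
  shows "x_partial (diag f) (\<lambda>p. diag f\<xi> p + diag fx p)"
  unfolding has_partial_on_strip_x
proof (intro ballI allI)
  fix x t :: real assume x: "x \<in> {0..1}"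
  define lo where "lo y = min x y" for y
  define hi where "hi y = max x y" for y
  \<comment> \<open>The averages of the two partials over the legs of the path through the corner.
    Their sum is the difference quotient for either sign of \<open>y - x\<close>, so continuity of
    \<open>A\<close> at \<open>x\<close> gives the derivative.\<close>
  define A where "A y = integral {0..1} (\<lambda>s. f\<xi> (lo y + s * (hi y - lo y), hi y, t)) +
     integral {0..1} (\<lambda>s. fx (lo y, lo y + s * (hi y - lo y), t))" for y
  have aff: "lo y \<le> lo y + s * (hi y - lo y) \<and> lo y + s * (hi y - lo y) \<le> hi y"
    if "s \<in> {0..1}" for s y
  proof -
    have "lo y \<le> hi y" by (simp add: lo_def hi_def)
    hence "0 \<le> s * (hi y - lo y)" "s * (hi y - lo y) \<le> hi y - lo y"
      using that by (auto intro: mult_left_le_one_le)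
    thus ?thesis by simp
  qed
  have lohi: "0 \<le> lo y \<and> lo y \<le> hi y \<and> hi y \<le> 1" if "y \<in> {0..1}" for y
    using that x by (auto simp: lo_def hi_def)
  have quot: "diag f (y, t) - diag f (x, t) = A y * (y - x)" if y: "y \<in> {0..1}" for y
  proof -
    have "f (hi y, hi y, t) - f (lo y, hi y, t) = (hi y - lo y) * integral {0..1} (\<lambda>s. f\<xi> (lo y + s * (hi y - lo y), hi y, t))"
      using lohi[OF y]
      by (intro integral_affine_derivative[of _ _ "\<lambda>\<xi>. f (\<xi>, hi y, t)"])
         (auto intro!: DERIV_subset[OF has_partial_on_wedge_\<xi>[OF f\<xi>(1)]])
    moreover have "f (lo y, hi y, t) - f (lo y, lo y, t) = (hi y - lo y) * integral {0..1} (\<lambda>s. fx (lo y, lo y + s * (hi y - lo y), t))"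
      using lohi[OF y]
      by (intro integral_affine_derivative[of _ _ "\<lambda>x. f (lo y, x, t)"])
         (auto intro!: DERIV_subset[OF has_partial_on_wedge_x[OF fx(1)]])
    ultimately have "f (hi y, hi y, t) - f (lo y, lo y, t) = A y * (hi y - lo y)"
      by (simp add: A_def algebra_simps)
    thus ?thesis
      by (cases "x \<le> y") (auto simp: lo_def hi_def diag_def min_def max_def algebra_simps)
  qed
  have "continuous_on {0..1} A"
  proof -
    have lohi': "continuous_on ({0..1} \<times> cbox 0 (1::real)) (\<lambda>q. lo (fst q))"
      "continuous_on ({0..1} \<times> cbox 0 (1::real)) (\<lambda>q. hi (fst q))"
      unfolding lo_def hi_def by (intro continuous_intros)+
    have mem: "0 \<le> lo (fst q) \<and> lo (fst q) \<le> lo (fst q) + snd q * (hi (fst q) - lo (fst q)) \<and>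
        lo (fst q) + snd q * (hi (fst q) - lo (fst q)) \<le> hi (fst q) \<and> hi (fst q) \<le> 1"
      if "q \<in> {0..1} \<times> cbox 0 1" for q
      using that aff[of "snd q" "fst q"] lohi[of "fst q"] by auto
    have "continuous_on {0..1} (\<lambda>y. integral (cbox 0 1) (\<lambda>s. f\<xi> (lo y + s * (hi y - lo y), hi y, t)))"
      by (rule integral_continuous_on_param, unfold case_prod_unfold,
          rule continuous_on_wedge_compose[OF f\<xi>(2)])
         ((intro continuous_intros lohi')+, drule mem, linarith)
    moreover have "continuous_on {0..1} (\<lambda>y. integral (cbox 0 1) (\<lambda>s. fx (lo y, lo y + s * (hi y - lo y), t)))"
      by (rule integral_continuous_on_param, unfold case_prod_unfold,
          rule continuous_on_wedge_compose[OF fx(2)])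
         ((intro continuous_intros lohi')+, drule mem, linarith)
    ultimately show ?thesis unfolding A_def by (intro continuous_on_add) simp_all
  qed
  hence "(A \<longlongrightarrow> A x) (at x within {0..1})" using x by (simp add: continuous_on_def)
  hence "((\<lambda>y. (diag f (y, t) - diag f (x, t)) / (y - x)) \<longlongrightarrow> A x) (at x within {0..1})"
    by (rule Lim_transform_eventually) (auto simp: eventually_at_filter quot)
  moreover have "A x = diag f\<xi> (x, t) + diag fx (x, t)" by (simp add: A_def lo_def hi_def diag_def)
  ultimately show "((\<lambda>x. diag f (x, t)) has_real_derivative diag f\<xi> (x, t) + diag fx (x, t)) (at x within {0..1})"
    by (simp add: has_field_derivative_iff)
qed

lemma diag_t:
  assumes "has_partial_on (0, 0, 1) wedge f ft"
  shows "t_partial (diag f) (diag ft)"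
  unfolding has_partial_on_strip_t diag_def using has_partial_on_wedge_t[OF assms] by auto

lemma Cwedge_SucE:
  assumes "Ck_dirs Basis (Suc k) wedge f"
  obtains f\<xi> fx ft where "has_partial_on (1, 0, 0) wedge f f\<xi>" "Ck_dirs Basis k wedge f\<xi>"
    "has_partial_on (0, 1, 0) wedge f fx" "Ck_dirs Basis k wedge fx"
    "has_partial_on (0, 0, 1) wedge f ft" "Ck_dirs Basis k wedge ft"
proof -
  have "(1, 0, 0) \<in> (Basis :: (real \<times> real \<times> real) set)" "(0, 1, 0) \<in> (Basis :: (real \<times> real \<times> real) set)"
    "(0, 0, 1) \<in> (Basis :: (real \<times> real \<times> real) set)" by (simp_all add: Basis_real_triple)
  thus ?thesis using that assms unfolding Ck_dirs.simps by blast
qed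

lemma Cxt_diag: "Ck_dirs Basis k wedge f \<Longrightarrow> Cxt k (diag f)"
proof (induction k arbitrary: f)
  case 0
  thus ?case by (simp add: cont_diag)
next
  case (Suc k)
  from Suc.prems obtain f\<xi> fx ft where f: "has_partial_on (1, 0, 0) wedge f f\<xi>" "Ck_dirs Basis k wedge f\<xi>"
    "has_partial_on (0, 1, 0) wedge f fx" "Ck_dirs Basis k wedge fx"
    "has_partial_on (0, 0, 1) wedge f ft" "Ck_dirs Basis k wedge ft" by (rule Cwedge_SucE)
  show ?case
    by (rule Cxt_SucI[OF cont_diag[OF Ck_dirs_imp_continuous_on[OF Suc.prems]]
          diag_x[OF f(1) Ck_dirs_imp_continuous_on[OF f(2)] f(3) Ck_dirs_imp_continuous_on[OF f(4)]]
          _ diag_t[OF f(5)] Suc.IH[OF f(6)]])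
       (intro Ck_dirs_add Suc.IH f)
qed

text \<open>\<open>vol3\<close> decouples the upper limit of the integral from the argument \<open>x\<close> of the kernel.\<close>

definition vol3 :: "(real \<times> real \<times> real \<Rightarrow> real) \<Rightarrow> (real \<times> real \<Rightarrow> real) \<Rightarrow> real \<times> real \<times> real \<Rightarrow> real" where
  "vol3 \<mu> u = (\<lambda>(z, x, t). integral {0..z} (\<lambda>\<xi>. \<mu> (\<xi>, x, t) * u (\<xi>, t)))"

definition vol :: "(real \<times> real \<times> real \<Rightarrow> real) \<Rightarrow> (real \<times> real \<Rightarrow> real) \<Rightarrow> real \<times> real \<Rightarrow> real" where
  "vol \<mu> u = (\<lambda>(x, t). integral {0..x} (\<lambda>\<xi>. \<mu> (\<xi>, x, t) * u (\<xi>, t)))"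

lemma vol_eq_diag: "vol \<mu> u = diag (vol3 \<mu> u)"
  by (auto simp: vol_def vol3_def diag_def)

lemma vol_integrand_cont:
  fixes \<mu> :: "real \<times> real \<times> real \<Rightarrow> real" and u :: "real \<times> real \<Rightarrow> real"
  assumes "continuous_on wedge \<mu>" "continuous_on strip u" "0 \<le> z" "z \<le> x" "x \<le> 1"
  shows "continuous_on {0..z} (\<lambda>\<xi>. \<mu> (\<xi>, x, t) * u (\<xi>, t))"
  by (intro continuous_on_mult continuous_on_wedge_compose[OF assms(1)]
       continuous_on_strip_compose[OF assms(2)] continuous_intros) (use assms(3-) in auto)

lemma cont_vol3:
  assumes "continuous_on wedge \<mu>" "continuous_on strip u"
  shows "continuous_on wedge (vol3 \<mu> u)"
proof -
  have m: "0 \<le> fst p \<and> fst p \<le> fst (snd p) \<and> fst (snd p) \<le> 1" if "p \<in> wedge" for p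
    using that by (cases p) auto
  have le: "0 \<le> z * \<eta> \<and> z * \<eta> \<le> z" if "0 \<le> z" "\<eta> \<in> {0..1}" for z \<eta> :: real
    using that by (auto intro: mult_left_le)
  have "continuous_on wedge (\<lambda>p. integral (cbox 0 1)
      (\<lambda>\<eta>. \<mu> (fst p * \<eta>, fst (snd p), snd (snd p)) * u (fst p * \<eta>, snd (snd p))))"
  proof (rule integral_continuous_on_param, unfold case_prod_unfold)
    show "continuous_on (wedge \<times> cbox 0 1) (\<lambda>q. \<mu> (fst (fst q) * snd q, fst (snd (fst q)), snd (snd (fst q))) *
      u (fst (fst q) * snd q, snd (snd (fst q))))"
    proof (intro continuous_on_mult continuous_on_wedge_compose[OF assms(1)]
         continuous_on_strip_compose[OF assms(2)])
      fix q assume "q \<in> wedge \<times> cbox 0 (1::real)"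
      hence "fst q \<in> wedge" "snd q \<in> {0..1}" by auto
      with m[of "fst q"] le[of "fst (fst q)" "snd q"]
      show "0 \<le> fst (fst q) * snd q \<and> fst (fst q) * snd q \<le> fst (snd (fst q)) \<and> fst (snd (fst q)) \<le> 1"
        and "fst (fst q) * snd q \<in> {0..1}" by auto
    qed (auto intro!: continuous_intros)
  qed
  hence "continuous_on wedge (\<lambda>p. fst p * integral {0..1}
      (\<lambda>\<eta>. \<mu> (fst p * \<eta>, fst (snd p), snd (snd p)) * u (fst p * \<eta>, snd (snd p))))"
    by (auto intro!: continuous_intros)
  also have "?this \<longleftrightarrow> ?thesis"
  proof (rule continuous_on_cong[OF refl])
    fix p assume p: "p \<in> wedge"
    have "continuous_on {0..fst p} (\<lambda>\<xi>. \<mu> (\<xi>, fst (snd p), snd (snd p)) * u (\<xi>, snd (snd p)))"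
      using m[OF p] by (intro vol_integrand_cont assms) auto
    from integral_0x_rescale[OF this] m[OF p]
    show "fst p * integral {0..1} (\<lambda>\<eta>. \<mu> (fst p * \<eta>, fst (snd p), snd (snd p)) * u (fst p * \<eta>, snd (snd p)))
      = vol3 \<mu> u p" by (simp add: vol3_def case_prod_unfold)
  qed
  finally show ?thesis .
qed

lemma cont_vol: "continuous_on wedge \<mu> \<Longrightarrow> continuous_on strip u \<Longrightarrow> continuous_on strip (vol \<mu> u)"
  unfolding vol_eq_diag by (intro cont_diag cont_vol3)

lemma has_partial_on_wedge_\<xi>I:
  assumes "\<And>\<xi> x t. 0 \<le> \<xi> \<Longrightarrow> \<xi> \<le> x \<Longrightarrow> x \<le> 1 \<Longrightarrow>
    ((\<lambda>\<xi>. f (\<xi>, x, t)) has_real_derivative g (\<xi>, x, t)) (at \<xi> within {0..x})"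
  shows "has_partial_on (1, 0, 0) wedge f g"
  unfolding has_partial_on_def
proof
  fix p assume "p \<in> wedge"
  then obtain \<xi> x t where p: "p = (\<xi>, x, t)" "0 \<le> \<xi>" "\<xi> \<le> x" "x \<le> 1" by (cases p) auto
  have *: "(+) \<xi> ` {s. p + s *\<^sub>R (1, 0, 0) \<in> wedge} = {0..x}"
  proof -
    have "{s. p + s *\<^sub>R (1, 0, 0) \<in> wedge} = {- \<xi>..x - \<xi>}" using p by auto
    thus ?thesis by simp
  qed
  show "((\<lambda>s. f (p + s *\<^sub>R (1, 0, 0))) has_real_derivative g p) (at 0 within {s. p + s *\<^sub>R (1, 0, 0) \<in> wedge})"
    using assms[OF p(2-), of t]
      DERIV_at_within_shift[of "\<lambda>\<xi>. f (\<xi>, x, t)" "g p" \<xi> 0 "{s. p + s *\<^sub>R (1, 0, 0) \<in> wedge}"]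
    unfolding * by (simp add: p(1))
qed

lemma has_partial_on_wedge_xI:
  assumes "\<And>\<xi> x t. 0 \<le> \<xi> \<Longrightarrow> \<xi> \<le> x \<Longrightarrow> x \<le> 1 \<Longrightarrow>
    ((\<lambda>x. f (\<xi>, x, t)) has_real_derivative g (\<xi>, x, t)) (at x within {\<xi>..1})"
  shows "has_partial_on (0, 1, 0) wedge f g"
  unfolding has_partial_on_def
proof
  fix p assume "p \<in> wedge"
  then obtain \<xi> x t where p: "p = (\<xi>, x, t)" "0 \<le> \<xi>" "\<xi> \<le> x" "x \<le> 1" by (cases p) auto
  have *: "(+) x ` {s. p + s *\<^sub>R (0, 1, 0) \<in> wedge} = {\<xi>..1}"
  proof -
    have "{s. p + s *\<^sub>R (0, 1, 0) \<in> wedge} = {\<xi> - x..1 - x}" using p by auto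
    thus ?thesis by simp
  qed
  show "((\<lambda>s. f (p + s *\<^sub>R (0, 1, 0))) has_real_derivative g p) (at 0 within {s. p + s *\<^sub>R (0, 1, 0) \<in> wedge})"
    using assms[OF p(2-), of t]
      DERIV_at_within_shift[of "\<lambda>x. f (\<xi>, x, t)" "g p" x 0 "{s. p + s *\<^sub>R (0, 1, 0) \<in> wedge}"]
    unfolding * by (simp add: p(1))
qed

text \<open>Total derivative of \<open>vol3\<close> along the diagonal: the upper limit contributes
  the boundary term, the kernel argument the integral of \<open>\<mu>x\<close>.\<close>

lemma vol_x:
  assumes \<mu>: "continuous_on wedge \<mu>" "has_partial_on (0, 1, 0) wedge \<mu> \<mu>x" "continuous_on wedge \<mu>x"
    and u: "continuous_on strip u"
  shows "x_partial (vol \<mu> u) (\<lambda>p. diag \<mu> p * u p + vol \<mu>x u p)"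
proof -
  have "x_partial (diag (vol3 \<mu> u))
     (\<lambda>p. diag (\<lambda>q. \<mu> q * u (fst q, snd (snd q))) p + diag (vol3 \<mu>x u) p)"
  proof (rule diag_x)
    show "has_partial_on (1, 0, 0) wedge (vol3 \<mu> u) (\<lambda>q. \<mu> q * u (fst q, snd (snd q)))"
    proof (rule has_partial_on_wedge_\<xi>I)
      fix \<xi> x t :: real assume *: "0 \<le> \<xi>" "\<xi> \<le> x" "x \<le> 1"
      have "continuous_on {0..x} (\<lambda>\<xi>. \<mu> (\<xi>, x, t) * u (\<xi>, t))"
        using * by (intro vol_integrand_cont \<mu> u) auto
      from integral_has_real_derivative[OF this, of \<xi>] *
      show "((\<lambda>\<xi>. vol3 \<mu> u (\<xi>, x, t)) has_real_derivative
          \<mu> (\<xi>, x, t) * u (fst (\<xi>, x, t), snd (snd (\<xi>, x, t)))) (at \<xi> within {0..x})"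
        by (simp add: vol3_def)
    qed
    show "has_partial_on (0, 1, 0) wedge (vol3 \<mu> u) (vol3 \<mu>x u)"
    proof (rule has_partial_on_wedge_xI)
      fix \<xi> x t :: real assume *: "0 \<le> \<xi>" "\<xi> \<le> x" "x \<le> 1"
      have "((\<lambda>x. integral (cbox 0 \<xi>) (\<lambda>\<zeta>. \<mu> (\<zeta>, x, t) * u (\<zeta>, t))) has_field_derivative
          integral (cbox 0 \<xi>) (\<lambda>\<zeta>. \<mu>x (\<zeta>, x, t) * u (\<zeta>, t))) (at x within {\<xi>..1})"
      proof (rule leibniz_rule_field_derivative)
        fix y \<zeta> assume y: "y \<in> {\<xi>..1}" "\<zeta> \<in> cbox 0 \<xi>"
        have "((\<lambda>y. \<mu> (\<zeta>, y, t)) has_real_derivative \<mu>x (\<zeta>, y, t)) (at y within {\<xi>..1})"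
          by (rule DERIV_subset[OF has_partial_on_wedge_x[OF \<mu>(2)]]) (use y in auto)
        from DERIV_cmult_right[OF this, of "u (\<zeta>, t)"]
        show "((\<lambda>y. \<mu> (\<zeta>, y, t) * u (\<zeta>, t)) has_real_derivative \<mu>x (\<zeta>, y, t) * u (\<zeta>, t)) (at y within {\<xi>..1})" .
      next
        fix y assume "y \<in> {\<xi>..1}"
        thus "(\<lambda>\<zeta>. \<mu> (\<zeta>, y, t) * u (\<zeta>, t)) integrable_on cbox 0 \<xi>"
          using * by (intro integrable_continuous) (auto intro!: vol_integrand_cont \<mu> u)
      next
        show "continuous_on ({\<xi>..1} \<times> cbox 0 \<xi>) (\<lambda>(x, \<zeta>). \<mu>x (\<zeta>, x, t) * u (\<zeta>, t))"
          unfolding case_prod_unfold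
          by (intro continuous_on_mult continuous_on_wedge_compose[OF \<mu>(3)]
              continuous_on_strip_compose[OF u] continuous_intros) (use * in auto)
      qed (use * in auto)
      thus "((\<lambda>x. vol3 \<mu> u (\<xi>, x, t)) has_real_derivative vol3 \<mu>x u (\<xi>, x, t)) (at x within {\<xi>..1})"
        by (simp add: vol3_def)
    qed
    show "continuous_on wedge (\<lambda>q. \<mu> q * u (fst q, snd (snd q)))"
      by (intro continuous_on_mult \<mu> continuous_on_strip_compose[OF u] continuous_intros) auto
    show "continuous_on wedge (vol3 \<mu>x u)" by (intro cont_vol3 \<mu> u)
  qed
  thus ?thesis by (simp add: vol_eq_diag diag_def)
qed

lemma vol_t:
  assumes \<mu>: "continuous_on wedge \<mu>" "has_partial_on (0, 0, 1) wedge \<mu> \<mu>t" "continuous_on wedge \<mu>t"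
    and u: "continuous_on strip u" "t_partial u ut" "continuous_on strip ut"
  shows "t_partial (vol \<mu> u) (\<lambda>p. vol \<mu>t u p + vol \<mu> ut p)"
  unfolding has_partial_on_strip_t
proof (intro ballI allI)
  fix x t :: real assume x: "x \<in> {0..1}"
  have "((\<lambda>t. integral (cbox 0 x) (\<lambda>\<xi>. \<mu> (\<xi>, x, t) * u (\<xi>, t))) has_field_derivative
      integral (cbox 0 x) (\<lambda>\<xi>. \<mu>t (\<xi>, x, t) * u (\<xi>, t) + \<mu> (\<xi>, x, t) * ut (\<xi>, t))) (at t within UNIV)"
  proof (rule leibniz_rule_field_derivative)
    fix r \<xi> assume \<xi>: "\<xi> \<in> cbox 0 x"
    have "((\<lambda>t. \<mu> (\<xi>, x, t)) has_real_derivative \<mu>t (\<xi>, x, r)) (at r)"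
      using \<xi> x by (intro has_partial_on_wedge_t[OF \<mu>(2)]) auto
    moreover have "((\<lambda>t. u (\<xi>, t)) has_real_derivative ut (\<xi>, r)) (at r)"
      using \<xi> x u(2) by (simp add: has_partial_on_strip_t)
    ultimately show "((\<lambda>t. \<mu> (\<xi>, x, t) * u (\<xi>, t)) has_real_derivative
      \<mu>t (\<xi>, x, r) * u (\<xi>, r) + \<mu> (\<xi>, x, r) * ut (\<xi>, r)) (at r)"
      by (auto intro!: derivative_eq_intros simp: mult.commute)
  next
    show "(\<lambda>\<xi>. \<mu> (\<xi>, x, r) * u (\<xi>, r)) integrable_on cbox 0 x" for r
      using x by (intro integrable_continuous) (auto intro!: vol_integrand_cont \<mu> u)
  next
    show "continuous_on (UNIV \<times> cbox 0 x) (\<lambda>(t, \<xi>). \<mu>t (\<xi>, x, t) * u (\<xi>, t) + \<mu> (\<xi>, x, t) * ut (\<xi>, t))"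
      unfolding case_prod_unfold
      by (intro continuous_on_add continuous_on_mult continuous_on_wedge_compose[OF \<mu>(3)]
          continuous_on_wedge_compose[OF \<mu>(1)] continuous_on_strip_compose[OF u(1)]
          continuous_on_strip_compose[OF u(3)] continuous_intros) (use x in auto)
  qed auto
  moreover have "integral {0..x} (\<lambda>\<xi>. \<mu>t (\<xi>, x, t) * u (\<xi>, t) + \<mu> (\<xi>, x, t) * ut (\<xi>, t)) =
      vol \<mu>t u (x, t) + vol \<mu> ut (x, t)"
    unfolding vol_def prod.case using x
    by (intro integral_add integrable_continuous_real vol_integrand_cont \<mu> u) auto
  ultimately show "((\<lambda>t. vol \<mu> u (x, t)) has_real_derivative vol \<mu>t u (x, t) + vol \<mu> ut (x, t)) (at t)"
    by (simp add: vol_def)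
qed

lemma Cxt_vol: "Ck_dirs Basis k wedge \<mu> \<Longrightarrow> Cxt k u \<Longrightarrow> Cxt k (vol \<mu> u)"
proof (induction k arbitrary: \<mu> u)
  case 0
  thus ?case by (simp add: cont_vol)
next
  case (Suc k)
  note c0 = Ck_dirs_imp_continuous_on
  from Suc.prems(1) obtain \<mu>\<xi> \<mu>x \<mu>t where \<mu>: "has_partial_on (1, 0, 0) wedge \<mu> \<mu>\<xi>" "Ck_dirs Basis k wedge \<mu>\<xi>"
    "has_partial_on (0, 1, 0) wedge \<mu> \<mu>x" "Ck_dirs Basis k wedge \<mu>x"
    "has_partial_on (0, 0, 1) wedge \<mu> \<mu>t" "Ck_dirs Basis k wedge \<mu>t" by (rule Cwedge_SucE)
  from Suc.prems(2) obtain ux ut where u: "x_partial u ux" "Cxt k ux"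
    "t_partial u ut" "Cxt k ut" by (rule Cxt_SucE)
  note c = c0[OF Suc.prems(1)] c0[OF Suc.prems(2)] and d = Suc.prems[THEN Ck_dirs_Suc_D]
  show ?case
  proof (rule Cxt_SucI[OF cont_vol[OF c] vol_x[OF c(1) \<mu>(3) c0[OF \<mu>(4)] c(2)] _
        vol_t[OF c(1) \<mu>(5) c0[OF \<mu>(6)] c(2) u(3) c0[OF u(4)]]])
    show "Cxt k (\<lambda>p. diag \<mu> p * u p + vol \<mu>x u p)"
      by (intro Ck_dirs_add Ck_dirs_mult Cxt_diag Suc.IH d \<mu>)
    show "Cxt k (\<lambda>p. vol \<mu>t u p + vol \<mu> ut p)"
      by (intro Ck_dirs_add Suc.IH d \<mu> u)
  qed
qed

text \<open>In \<open>x\<close> the operator gains one order, since its \<open>x\<close>-partial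
  involves \<open>u\<close> but no derivative of \<open>u\<close>.\<close>

lemma Cx_vol:
  "Ck_dirs Basis k wedge \<mu> \<Longrightarrow> Ck_dirs {(0, 1, 0)} (Suc k) wedge \<mu> \<Longrightarrow> Cxt k u \<Longrightarrow> Cx (Suc k) (vol \<mu> u)"
proof (induction k arbitrary: \<mu>)
  case 0
  then obtain \<mu>x where "has_partial_on (0, 1, 0) wedge \<mu> \<mu>x" "continuous_on wedge \<mu>x" by auto
  thus ?case using 0
    by (intro Cx_1I[OF cont_vol vol_x]) (auto intro!: continuous_intros cont_vol cont_diag)
next
  case (Suc k)
  note c0 = Ck_dirs_imp_continuous_on
  obtain \<mu>x where \<mu>x: "has_partial_on (0, 1, 0) wedge \<mu> \<mu>x" "Ck_dirs {(0, 1, 0)} (Suc k) wedge \<mu>x"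
    by (rule Ck_dirs_SucE[OF Suc.prems(2)]) simp
  have "Ck_dirs Basis k wedge \<mu>x"
    by (rule Ck_dirs_partial[OF Suc.prems(1) _ \<mu>x(1) c0[OF \<mu>x(2)] wedge_nondegenerate_x])
       (simp add: Basis_real_triple)
  hence "Cx (Suc k) (vol \<mu>x u)"
    using \<mu>x(2) Suc.prems(3)[THEN Ck_dirs_Suc_D] by (rule Suc.IH)
  moreover have "Cx (Suc k) (\<lambda>p. diag \<mu> p * u p)"
    using Suc.prems(1,3) by (intro Ck_dirs_mult Cxt_imp_Cx Cxt_diag)
  ultimately have "Cx (Suc k) (\<lambda>p. diag \<mu> p * u p + vol \<mu>x u p)" by (intro Ck_dirs_add)
  moreover have "x_partial (vol \<mu> u) (\<lambda>p. diag \<mu> p * u p + vol \<mu>x u p)"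
    by (rule vol_x[OF c0[OF Suc.prems(1)] \<mu>x(1) c0[OF \<mu>x(2)] c0[OF Suc.prems(3)]])
  moreover have "continuous_on strip (vol \<mu> u)"
    by (rule cont_vol[OF c0[OF Suc.prems(1)] c0[OF Suc.prems(3)]])
  ultimately show ?case unfolding Ck_dirs.simps(2)[of _ "Suc k"] by blast
qed

text \<open>The lines of constant time depart from the flow at rate \<open>- \<sigma>\<close>, so
  \<open>Q = - K / \<sigma>\<close>, and the derivative \<open>D\<close> involves \<open>g\<close>
  and \<open>g1\<close> but no time derivative of \<open>g\<close>: one order is gained in
  \<open>t\<close>. The integration by parts falls on the weight, which is why the weights of
  \<open>P\<close> are asked for an \<open>x\<close>-derivative.\<close>

lemma (in char_flow) C1_weighted_integral:
  assumes s: "Cxt (Suc k) \<sigma>" "\<And>p. p \<in> strip \<Longrightarrow> \<sigma> p \<noteq> 0"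
    and K: "Ct (Suc k) K" "x_partial K Kx" "Ct k Kx"
    and g: "Cxt k g" "along w g g1" "Ct k g1"
  shows "C1 (Suc k) (\<lambda>t. prim (\<lambda>p. K p * g p) (1, t))"
proof -
  note c0 = Ck_dirs_imp_continuous_on
  obtain Kt where Kt: "t_partial K Kt" "Ct k Kt" using K(1) by (rule Ct_SucE)
  define iv where "iv = (\<lambda>p. inverse (\<sigma> p))"
  have iv: "Cxt (Suc k) iv" unfolding iv_def using s by (rule Ck_dirs_inverse)
  then obtain ivx ivt where ivx: "x_partial iv ivx" "Cxt k ivx"
    "t_partial iv ivt" "Cxt k ivt"
    by (rule Cxt_SucE)
  define Q where "Q = (\<lambda>p. - (K p * iv p))"
  define Qx where "Qx = (\<lambda>p. - (Kx p * iv p + K p * ivx p))"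
  have Q: "Ct k Q" "Ct k Qx"
    unfolding Q_def Qx_def
    by (intro Ck_dirs_minus Ck_dirs_mult Ck_dirs_add K(3) Ck_dirs_Suc_D[OF K(1)]
        Cxt_imp_Ct[OF ivx(2)] Cxt_imp_Ct[OF Ck_dirs_Suc_D[OF iv]])+
  have Qx: "x_partial Q Qx"
    unfolding Q_def Qx_def by (intro has_partial_on_minus has_partial_on_mult K ivx)
  define D where "D = (\<lambda>p. prim (\<lambda>p. (Kt p - Qx p) * g p - Q p * g1 p) p + Q p * g p - Q (0, snd p) * g (0, snd p))"
  have comp_snd: "f \<odot> snd = f" for f by (auto simp: curve_comp_def)
  have "t_partial (prim (\<lambda>p. K p * (g \<odot> snd) p))
     (\<lambda>p. prim (\<lambda>p. (Kt p - Qx p) * (g \<odot> snd) p - Q p * (g1 \<odot> snd) p) p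
       + Q p * (g \<odot> snd) p - Q (0, snd p) * g (0, snd (0::real, snd p)))"
  proof (rule transversal_integral_flow[OF c0[OF g(1)] g(2) c0[OF g(3)]])
    show "x_partial snd (\<lambda>p. 0)" "t_partial snd (\<lambda>p. 1)"
      by (simp_all add: has_partial_on_strip_x has_partial_on_strip_t)
    show "Q p * (0 - (\<sigma> \<odot> snd) p) = K p * 1" if "p \<in> strip" for p
      using s(2)[OF that] by (simp add: Q_def iv_def comp_snd)
  qed (intro continuous_intros c0[OF K(1)] Kt(1) c0[OF Kt(2)] c0[OF Q(1)] Qx c0[OF Q(2)])+
  hence D: "t_partial (prim (\<lambda>p. K p * g p)) D"
    unfolding D_def comp_snd by simp
  have tr: "Ct k (\<lambda>p. f (0, snd p))" if "Ct k f" for f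
    using Ct_of_trace[OF Ck_dirs_trace[OF that]] by simp
  have g': "Ct k g" using g(1) by (rule Cxt_imp_Ct)
  have "Ct k D"
    unfolding D_def
    by (intro Ck_dirs_diff Ck_dirs_add Ck_dirs_mult Ct_prim tr Q g' g(3) Kt(2))
  hence "Ct (Suc k) (prim (\<lambda>p. K p * g p))"
    using D cont_prim[OF continuous_on_mult[OF c0[OF K(1)] c0[OF g(1)]]] by auto
  thus ?thesis by (rule Ck_dirs_trace) simp
qed

section \<open>Continuous solutions as weak solutions\<close>

text \<open>The interval integral is oriented. Both orders of the limits occur, because the inflow
  edge may lie on either side of \<open>x\<close>.\<close>

lemma (in char_flow) LBINT_along_flow:
  assumes g: "continuous_on strip g" and \<xi>: "\<xi> \<in> {0..1}" "\<eta> \<in> {0..1}"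
    and x: "x \<in> {0..1}"
  shows "(LBINT \<rho>=\<xi>..\<eta>. g (\<rho>, w \<rho> x (Psi w (x, y)))) = prim (g \<odot> Psi w) (\<eta>, y) - prim (g \<odot> Psi w) (\<xi>, y)"
proof (rule interval_integral_FTC_finite)
  have sub: "{min \<xi> \<eta>..max \<xi> \<eta>} \<subseteq> {0..1}" using \<xi> by auto
  have gP: "continuous_on strip (g \<odot> Psi w)" by (intro cont_curve_comp g cont_Psi)
  have eq: "g (\<rho>, w \<rho> x (Psi w (x, y))) = (g \<odot> Psi w) (\<rho>, y)" if "\<rho> \<in> {0..1}" for \<rho>
    using flow_Psi[OF that x] by simp
  have "continuous_on {0..1} (\<lambda>\<rho>. (g \<odot> Psi w) (\<rho>, y))" by (rule continuous_on_strip_x[OF gP])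
  hence "continuous_on {min \<xi> \<eta>..max \<xi> \<eta>} (\<lambda>\<rho>. (g \<odot> Psi w) (\<rho>, y))"
    using sub by (rule continuous_on_subset)
  also have "?this \<longleftrightarrow> continuous_on {min \<xi> \<eta>..max \<xi> \<eta>} (\<lambda>\<rho>. g (\<rho>, w \<rho> x (Psi w (x, y))))"
    by (rule continuous_on_cong[OF refl], rule eq[symmetric], rule subsetD[OF sub])
  finally show "continuous_on {min \<xi> \<eta>..max \<xi> \<eta>} (\<lambda>\<rho>. g (\<rho>, w \<rho> x (Psi w (x, y))))" .
  fix \<rho> assume "min \<xi> \<eta> \<le> \<rho>" "\<rho> \<le> max \<xi> \<eta>"
  hence \<rho>: "\<rho> \<in> {0..1}" using sub by auto
  have "((\<lambda>\<eta>. prim (g \<odot> Psi w) (\<eta>, y)) has_real_derivative (g \<odot> Psi w) (\<rho>, y)) (at \<rho> within {0..1})"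
    using prim_x[OF gP] \<rho> unfolding has_partial_on_strip_x by blast
  from DERIV_subset[OF this sub]
  show "((\<lambda>\<eta>. prim (g \<odot> Psi w) (\<eta>, y)) has_vector_derivative g (\<rho>, w \<rho> x (Psi w (x, y))))
      (at \<rho> within {min \<xi> \<eta>..max \<xi> \<eta>})"
    unfolding eq[OF \<rho>] has_real_derivative_iff_has_vector_derivative .
qed

text \<open>Variation of constants, read backwards.\<close>

lemma (in char_flow) along_from_integral_form:
  assumes \<beta>: "continuous_on strip \<beta>" and q: "continuous_on strip q" and x0: "x0 \<in> {0..1}"
    and rep: "\<And>x t. x \<in> {0..1} \<Longrightarrow> u (x, t) =
      exp (LBINT \<eta>=x..x0. \<beta> (\<eta>, w \<eta> x t)) * B (w x0 x t) +
      (LBINT \<xi>=x0..x. exp (LBINT \<eta>=x..\<xi>. \<beta> (\<eta>, w \<eta> x t)) * q (\<xi>, w \<xi> x t))"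
  shows "along w u (\<lambda>p. q p - \<beta> p * u p)" and "u (x0, t) = B t"
proof -
  define I where "I = prim (\<beta> \<odot> Psi w)"
  define K where "K = (\<lambda>p. exp (I p))"
  have \<beta>P: "continuous_on strip (\<beta> \<odot> Psi w)" by (intro cont_curve_comp \<beta> cont_Psi)
  have Kc: "continuous_on strip K" unfolding K_def I_def by (intro continuous_on_exp cont_prim \<beta>P)
  \<comment> \<open>\<open>K\<close> is a function of position and label; composing it with
    \<open>Foot w\<close> makes it a function on the strip, as an integrand along the flow has to
    be.\<close>
  define g where "g = (\<lambda>p. (K \<odot> Foot w) p * q p)"
  have gc: "continuous_on strip g" unfolding g_def by (intro continuous_on_mult cont_curve_comp Kc cont_Foot q)
  define H where "H = prim (g \<odot> Psi w)"
  \<comment> \<open>In label coordinates the exponential weight splits into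
    \<open>exp (I (\<xi>, y)) * exp (- I (x, y))\<close>. With the second factor pulled out,
    \<open>x\<close> remains only there and in the upper limit of \<open>H\<close>, so the product
    rule applies.\<close>
  have U: "u (x, Psi w (x, y)) = exp (- I (x, y)) * (K (x0, y) * B (Psi w (x0, y)) + H (x, y) - H (x0, y))"
    if x: "x \<in> {0..1}" for x y
  proof -
    have 1: "(LBINT \<eta>=x..\<xi>. \<beta> (\<eta>, w \<eta> x (Psi w (x, y)))) = I (\<xi>, y) - I (x, y)" if "\<xi> \<in> {0..1}" for \<xi>
      unfolding I_def by (rule LBINT_along_flow[OF \<beta> x that x])
    have "(LBINT \<xi>=x0..x. exp (LBINT \<eta>=x..\<xi>. \<beta> (\<eta>, w \<eta> x (Psi w (x, y)))) * q (\<xi>, w \<xi> x (Psi w (x, y)))) =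
      (LBINT \<xi>=x0..x. exp (- I (x, y)) * g (\<xi>, w \<xi> x (Psi w (x, y))))"
    proof (rule interval_integral_cong)
      fix \<xi> assume "\<xi> \<in> einterval (min (ereal x0) (ereal x)) (max (ereal x0) (ereal x))"
      hence \<xi>: "\<xi> \<in> {0..1}" using x x0 by (auto simp: einterval_def min_def max_def split: if_splits)
      show "exp (LBINT \<eta>=x..\<xi>. \<beta> (\<eta>, w \<eta> x (Psi w (x, y)))) * q (\<xi>, w \<xi> x (Psi w (x, y))) =
        exp (- I (x, y)) * g (\<xi>, w \<xi> x (Psi w (x, y)))"
        using \<xi> unfolding 1[OF \<xi>] flow_Psi[OF \<xi> x]
        by (simp add: g_def K_def exp_diff exp_minus divide_inverse)
    qed
    also have "\<dots> = exp (- I (x, y)) * (H (x, y) - H (x0, y))"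
      using LBINT_along_flow[OF gc x0 x x, of y] by (simp add: H_def interval_lebesgue_integral_mult_right)
    finally show ?thesis
      using rep[OF x, of "Psi w (x, y)"] 1[OF x0] flow_Psi[OF x0 x]
      by (simp add: K_def exp_diff exp_minus divide_inverse algebra_simps)
  qed
  show "along w u (\<lambda>p. q p - \<beta> p * u p)"
    unfolding along_iff_Psi has_partial_on_strip_x
  proof (intro ballI allI)
    fix x y :: real assume x: "x \<in> {0..1}"
    define C where "C = K (x0, y) * B (Psi w (x0, y)) - H (x0, y)"
    have U': "exp (- I (z, y)) * (C + H (z, y)) = u (z, Psi w (z, y))" if "z \<in> {0..1}" for z
      using U[OF that] by (simp add: C_def algebra_simps)
    have gP: "continuous_on strip (g \<odot> Psi w)" by (intro cont_curve_comp gc cont_Psi)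
    have dI: "((\<lambda>x. - I (x, y)) has_real_derivative - (\<beta> \<odot> Psi w) (x, y)) (at x within {0..1})"
      using prim_x[OF \<beta>P] x unfolding has_partial_on_strip_x I_def by (intro DERIV_minus) blast
    have dH: "((\<lambda>x. C + H (x, y)) has_real_derivative 0 + (g \<odot> Psi w) (x, y)) (at x within {0..1})"
      using prim_x[OF gP] x unfolding has_partial_on_strip_x H_def by (intro DERIV_add DERIV_const) blast
    have "((\<lambda>x. exp (- I (x, y)) * (C + H (x, y))) has_real_derivative
        exp (- I (x, y)) * - (\<beta> \<odot> Psi w) (x, y) * (C + H (x, y)) + (0 + (g \<odot> Psi w) (x, y)) * exp (- I (x, y)))
        (at x within {0..1})"
      by (rule DERIV_mult[OF DERIV_exp_within[OF dI] dH])
    moreover have "exp (- I (x, y)) * - (\<beta> \<odot> Psi w) (x, y) * (C + H (x, y)) + (0 + (g \<odot> Psi w) (x, y)) * exp (- I (x, y))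
      = q (x, Psi w (x, y)) - \<beta> (x, Psi w (x, y)) * u (x, Psi w (x, y))"
      using x U'[OF x, symmetric] by (simp add: g_def K_def exp_minus)
    ultimately have "((\<lambda>x. exp (- I (x, y)) * (C + H (x, y))) has_real_derivative
        q (x, Psi w (x, y)) - \<beta> (x, Psi w (x, y)) * u (x, Psi w (x, y))) (at x within {0..1})" by simp
    from DERIV_cong_on[OF this x U']
    show "((\<lambda>x. (u \<odot> Psi w) (x, y)) has_real_derivative ((\<lambda>p. q p - \<beta> p * u p) \<odot> Psi w) (x, y))
      (at x within {0..1})" by simp
  qed
  show "u (x0, t) = B t" using rep[OF x0, of t] init[OF x0] by simp
qed

section \<open>Flows of the given speeds and the integral operators in terms of \<open>prim\<close>
  and \<open>vol\<close>\<close>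

lemma strip_periodic_bounded:
  fixes f :: "real \<times> real \<Rightarrow> real"
  assumes "continuous_on strip f" "\<And>x t. x \<in> {0..1} \<Longrightarrow> f (x, t + 2 * pi) = f (x, t)"
  shows "\<exists>L. \<forall>p\<in>strip. \<bar>f p\<bar> \<le> L"
proof -
  have "compact ({0..1} \<times> {0..2 * pi} :: (real \<times> real) set)" by (intro compact_Times compact_Icc)
  hence "compact (f ` ({0..1} \<times> {0..2 * pi}))"
    by (intro compact_continuous_image continuous_on_subset[OF assms(1)]) (auto simp: strip_eq_Times)
  from compact_imp_bounded[OF this] obtain L where L: "\<forall>y\<in>f ` ({0..1} \<times> {0..2 * pi}). norm y \<le> L"
    unfolding bounded_iff by blast
  have "\<bar>f (x, t)\<bar> \<le> L" if x: "x \<in> {0..1}" for x t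
  proof -
    interpret periodic_fun_simple "\<lambda>t. f (x, t)" "2 * pi"
      by unfold_locales (rule assms(2)[OF x])
    define k where "k = \<lfloor>t / (2 * pi)\<rfloor>"
    have "of_int k \<le> t / (2 * pi)" "t / (2 * pi) < of_int k + 1" unfolding k_def by linarith+
    hence "t - of_int k * (2 * pi) \<in> {0..2 * pi}"
      by (auto simp: field_simps)
    hence "(x, t - of_int k * (2 * pi)) \<in> {0..1} \<times> {0..2 * pi}" using x by auto
    from bspec[OF L imageI[OF this]] show ?thesis using minus_of_int[of t k] by simp
  qed
  thus ?thesis by (intro exI[of _ L]) (auto simp: strip_eq_Times)
qed

lemma char_flow_reciprocal_speed:
  assumes a: "Ck_per (0, 1) (Suc d) strip a" "\<And>p. p \<in> strip \<Longrightarrow> a p \<noteq> 0"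
    and w: "\<And>x t. x \<in> {0..1} \<Longrightarrow> w x x t = t"
      "\<And>x t \<xi>. x \<in> {0..1} \<Longrightarrow> \<xi> \<in> {0..1} \<Longrightarrow>
        ((\<lambda>\<eta>. w \<eta> x t) has_real_derivative 1 / a (\<xi>, w \<xi> x t)) (at \<xi> within {0..1})"
  shows "\<exists>st L. char_flow (\<lambda>p. inverse (a p)) st w L"
proof -
  have aC: "Cxt (Suc d) a" using a(1) by (simp add: Ck_per_def Ck_on_eq_Ck_dirs del: Ck_dirs.simps)
  then obtain ax a_t where at: "x_partial a ax" "Cxt d ax" "t_partial a a_t" "Cxt d a_t"
    by (rule Cxt_SucE)
  note c = Ck_dirs_imp_continuous_on[OF aC] Ck_dirs_imp_continuous_on[OF at(4)]
  define st where "st = (\<lambda>p. - (inverse (a p) * a_t p * inverse (a p)))"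
  have per: "a (x, t + 2 * pi) = a (x, t)" if "x \<in> {0..1}" for x t
    using conjunct2[OF a(1)[unfolded Ck_per_def], rule_format, of "(x, t)"] that by simp
  \<comment> \<open>Nothing known about the chosen partial \<open>a_t\<close> mentions periodicity;
    it is inherited from \<open>a\<close> because derivatives are unique.\<close>
  have "a_t (x, t + 2 * pi) = a_t (x, t)" if x: "x \<in> {0..1}" for x t
  proof (rule DERIV_unique)
    have "((\<lambda>t. a (x, t)) has_real_derivative a_t (x, t + 2 * pi)) (at (t + 2 * pi))"
      using at(3) x by (simp add: has_partial_on_strip_t)
    thus "((\<lambda>t. a (x, t)) has_real_derivative a_t (x, t + 2 * pi)) (at t)"
      using per[OF x] by (simp add: DERIV_shift)
    show "((\<lambda>t. a (x, t)) has_real_derivative a_t (x, t)) (at t)"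
      using at(3) x by (simp add: has_partial_on_strip_t)
  qed
  hence per': "st (x, t + 2 * pi) = st (x, t)" if "x \<in> {0..1}" for x t
    using per that by (simp add: st_def)
  have stc: "continuous_on strip st"
    unfolding st_def by (intro continuous_on_minus continuous_on_mult continuous_on_inverse c) (use a(2) in auto)
  obtain L where "\<forall>p\<in>strip. \<bar>st p\<bar> \<le> L" using strip_periodic_bounded[OF stc per'] by blast
  moreover have "t_partial (\<lambda>p. inverse (a p)) st"
    unfolding st_def by (rule has_partial_on_inverse[OF at(3) a(2)])
  moreover have "continuous_on strip (\<lambda>p. inverse (a p))"
    by (intro continuous_on_inverse c) (use a(2) in auto)
  ultimately have "char_flow (\<lambda>p. inverse (a p)) st w L"
    using stc w by unfold_locales (auto simp: inverse_eq_divide)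
  thus ?thesis by blast
qed

lemma LBINT_0_eq_integral:
  fixes g :: "real \<Rightarrow> real"
  assumes "continuous_on {0..x} g" "0 \<le> x"
  shows "(LBINT \<xi>=0..ereal x. g \<xi>) = integral {0..x} g"
  unfolding zero_ereal_def
  by (rule interval_integral_eq_integral[OF assms(2) borel_integrable_atLeastAtMost'[OF assms(1)]])

lemma M_op_eq_vol:
  assumes "\<And>k. k < n \<Longrightarrow> continuous_on wedge (\<mu> j k)" "\<And>k. k < n \<Longrightarrow> continuous_on strip (u k)" "p \<in> strip"
  shows "M_op n \<mu> u j p = (\<Sum>k<n. vol (\<mu> j k) (u k) p)"
proof -
  obtain x t where p: "p = (x, t)" "0 \<le> x" "x \<le> 1" using assms(3) by (cases p) auto
  show ?thesis
    unfolding M_op_def vol_def p(1) prod.case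
    using p by (intro sum.cong refl LBINT_0_eq_integral vol_integrand_cont assms) auto
qed

lemma P_op_eq_prim:
  assumes "\<And>k. k < n \<Longrightarrow> continuous_on strip (p j k)" "\<And>k. k < n \<Longrightarrow> continuous_on strip (u k)"
  shows "P_op n p u j t = (\<Sum>k<n. prim (\<lambda>q. p j k q * u k q) (1, t))"
  unfolding P_op_def prim_def fst_conv snd_conv one_ereal_def
proof (intro sum.cong refl LBINT_0_eq_integral)
  fix k assume "k \<in> {..<n}"
  thus "continuous_on {0..1} (\<lambda>x. p j k (x, t) * u k (x, t))"
    by (intro continuous_on_mult continuous_on_strip_x assms) auto
qed simp

lemma continuous_solution_regular:
  fixes n m l :: nat
  assumes m: "m \<le> n" and l: "1 \<le> l"
    and a_nonzero: "\<And>j q. j < n \<Longrightarrow> q \<in> strip \<Longrightarrow> a j q \<noteq> 0"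
    and a_distinct: "\<And>j k q. j < n \<Longrightarrow> k < n \<Longrightarrow> j \<noteq> k \<Longrightarrow> q \<in> strip \<Longrightarrow> a j q \<noteq> a k q"
    and a_reg: "\<And>j. j < n \<Longrightarrow> Ck_per (0, 1) l strip (a j)"
    and b_reg: "\<And>j k. j < n \<Longrightarrow> k < n \<Longrightarrow> Ck_per (0, 1) l strip (b j k)"
    and r_reg: "\<And>j k. j < n \<Longrightarrow> k < n \<Longrightarrow> Ck_per 1 l UNIV (r j k)"
    and h_reg: "\<And>j. j < n \<Longrightarrow> Ck_per 1 l UNIV (h j)"
    and f_reg: "\<And>j. j < n \<Longrightarrow> Ck_per (0, 1) (l - 1) strip (f j) \<and> Ck_dir_on (0, 1) l strip (f j)"
    and \<mu>_reg: "\<And>j k. j < n \<Longrightarrow> k < n \<Longrightarrow>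
          Ck_per (0, 0, 1) (l - 1) wedge (\<mu> j k) \<and> Ck_dir_on (0, 1, 0) l wedge (\<mu> j k)"
    and p_reg: "\<And>j k. j < n \<Longrightarrow> k < n \<Longrightarrow>
          Ck_per (0, 1) 0 strip (p j k) \<and> Ck_dir_on (0, 1) l strip (p j k) \<and>
          (\<exists>q. x_partial (p j k) q \<and> Ck_dir_on (0, 1) (l - 1) strip q)"
    and \<omega>: "characteristics n a \<omega>"
    and E: "E \<subseteq> {..<n} \<times> {..<n}" "acyclic E"
    and r_zero: "\<And>j k t. j < n \<Longrightarrow> k < n \<Longrightarrow> (j, k) \<notin> E \<Longrightarrow> r j k t = 0"
    and sol: "continuous_solution n m a b \<mu> p r f h \<omega> u"
    and "i < n"
  shows "Ck_per (0, 1) l strip (u i)"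
proof -
  note [simp del] = Ck_dirs.simps and c0 = Ck_dirs_imp_continuous_on
  obtain d where d: "l = Suc d" using l by (cases l) auto
  have aC: "Cxt l (a j)" if "j < n" for j
    using a_reg[OF that] by (simp add: Ck_per_def Ck_on_eq_Ck_dirs)
  have bC: "Cxt l (b j k)" if "j < n" "k < n" for j k
    using b_reg[OF that] by (simp add: Ck_per_def Ck_on_eq_Ck_dirs)
  have rC: "C1 l (r j k)" if "j < n" "k < n" for j k
    using r_reg[OF that] by (simp add: Ck_per_def Ck_on_eq_Ck_dirs)
  have hC: "C1 l (h j)" if "j < n" for j
    using h_reg[OF that] by (simp add: Ck_per_def Ck_on_eq_Ck_dirs)
  have fC: "Cxt d (f j)" "Ct l (f j)" if "j < n" for j
    using f_reg[OF that] by (simp_all add: Ck_per_def Ck_on_eq_Ck_dirs Ck_dir_on_eq_Ck_dirs d)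
  have \<mu>C: "Ck_dirs Basis d wedge (\<mu> j k)" "Ck_dirs {(0, 1, 0)} l wedge (\<mu> j k)" if "j < n" "k < n" for j k
    using \<mu>_reg[OF that] by (simp_all add: Ck_per_def Ck_on_eq_Ck_dirs Ck_dir_on_eq_Ck_dirs d)
  have pC: "Ct l (p j k)" "\<exists>q. x_partial (p j k) q \<and> Ct d q" if "j < n" "k < n" for j k
    using p_reg[OF that] by (simp_all add: Ck_per_def Ck_on_eq_Ck_dirs Ck_dir_on_eq_Ck_dirs d)
  have uc: "continuous_on strip (u j)" if "j < n" for j
    using sol that by (simp add: continuous_solution_def Ck_per_def)
  define s where "s j = (\<lambda>q. inverse (a j q))" for j
  have sC: "Cxt l (s j)" if "j < n" for j
    unfolding s_def using aC a_nonzero that by (intro Ck_dirs_inverse)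
  have "\<exists>st L. char_flow (s j) st (\<omega> j) L" if "j < n" for j
    unfolding s_def
  proof (rule char_flow_reciprocal_speed[OF a_reg[OF that, unfolded d] a_nonzero[OF that]])
    fix x t \<xi> :: real assume x: "x \<in> {0..1}"
    have "\<omega> j x x t = t \<and> (\<forall>\<xi>\<in>{0..1}. ((\<lambda>\<eta>. \<omega> j \<eta> x t) has_real_derivative 1 / a j (\<xi>, \<omega> j \<xi> x t)) (at \<xi> within {0..1}))"
      using \<omega>[unfolded characteristics_def, rule_format, OF that, of "(x, t)"] x by simp
    thus "\<omega> j x x t = t"
      "\<xi> \<in> {0..1} \<Longrightarrow> ((\<lambda>\<eta>. \<omega> j \<eta> x t) has_real_derivative 1 / a j (\<xi>, \<omega> j \<xi> x t)) (at \<xi> within {0..1})"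
      by blast+
  qed
  then obtain st L where flow: "\<And>j. j < n \<Longrightarrow> char_flow (s j) (st j) (\<omega> j) (L j)" by metis
  \<comment> \<open>Components with positive speed (\<open>k < m\<close>) leave at
    \<open>x = 1\<close>, the others at \<open>x = 0\<close>; these are the traces that
    \<open>R_op\<close> reflects.\<close>
  define x_out where "x_out k = (if k < m then 1 else 0 :: real)" for k
  interpret hyp_system n s st \<omega> L E "x_in a" x_out
  proof (rule hyp_system.intro)
    show "s j q \<noteq> s k q" if "j < n" "k < n" "j \<noteq> k" "q \<in> strip" for j k q
      using a_distinct[OF that] by (simp add: s_def)
  qed (use flow a_nonzero E in \<open>auto simp: s_def x_in_def x_out_def\<close>)
  \<comment> \<open>Division by the speed gives a system with slope \<open>s j\<close>;
    \<open>f2\<close> and \<open>H\<close> freeze \<open>Mu\<close> and \<open>Pu\<close> of the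
    given solution as source and boundary data.\<close>
  define \<beta> where "\<beta> j k = (\<lambda>q. s j q * b j k q)" for j k
  define f1 where "f1 j = (\<lambda>q. s j q * f j q)" for j
  define f2 where "f2 j = (\<lambda>q. - (\<Sum>k<n. vol (\<mu> j k) (u k) q))" for j
  define H where "H j = (\<lambda>t. (\<Sum>k<n. prim (\<lambda>q. p j k q * u k q) (1, t)) + h j t)" for j
  have \<beta>C: "Cxt l (\<beta> j k)" if "j < n" "k < n" for j k
    unfolding \<beta>_def by (intro Ck_dirs_mult sC bC that)
  have f1C: "Cxt d (f1 j)" "Ct l (f1 j)" if "j < n" for j
    unfolding f1_def
    using sC[OF that, unfolded d, THEN Ck_dirs_Suc_D] sC[OF that, THEN Cxt_imp_Ct] fC[OF that]
    by (auto intro!: Ck_dirs_mult)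
  have M: "M_op n \<mu> u j q = - f2 j q" if "j < n" "q \<in> strip" for j q
    unfolding f2_def using M_op_eq_vol[of n \<mu> j u q] c0[OF \<mu>C(1)] uc that by simp
  have P: "P_op n p u j t = (\<Sum>k<n. prim (\<lambda>q. p j k q * u k q) (1, t))" if "j < n" for j t
    by (rule P_op_eq_prim) (use c0[OF pC(1)] uc that in auto)
  have R: "R_op n m r u j t = (\<Sum>k\<in>E `` {j}. r j k t * u k (x_out k, t))" if "j < n" for j t
  proof -
    have "R_op n m r u j t = (\<Sum>k\<in>{m..<n} \<union> {..<m}. r j k t * u k (x_out k, t))"
      unfolding R_op_def by (subst sum.union_disjoint) (auto simp: x_out_def)
    also have "\<dots> = (\<Sum>k\<in>E `` {j}. r j k t * u k (x_out k, t))"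
      by (rule sum.mono_neutral_right) (use m E r_zero that in auto)
    finally show ?thesis .
  qed
  have f2c: "continuous_on strip (f2 j)" if "j < n" for j
    unfolding f2_def using that
    by (intro continuous_on_minus continuous_on_sum cont_vol c0[OF \<mu>C(1)] uc) auto
  have weak: "weak_solution \<beta> f1 f2 r H u"
    unfolding weak_solution_def
  proof (intro allI impI conjI)
    fix j assume j: "j < n"
    interpret char_flow "s j" "st j" "\<omega> j" "L j" using j by (rule flow)
    define F where "F = (\<lambda>q. f j q - M_op n \<mu> u j q - (\<Sum>k\<in>{..<n} - {j}. b j k q * u k q))"
    have Fc: "continuous_on strip (\<lambda>q. s j q * F q)"
    proof -
      have "continuous_on strip (\<lambda>q. s j q * (f j q + f2 j q - (\<Sum>k\<in>{..<n} - {j}. b j k q * u k q)))"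
        by (intro continuous_on_mult continuous_on_diff continuous_on_add continuous_on_sum
            c0[OF sC] c0[OF fC(1)] f2c c0[OF bC] uc j) auto
      also have "?this \<longleftrightarrow> ?thesis"
        by (rule continuous_on_cong) (auto simp: F_def M[OF j])
      finally show ?thesis .
    qed
    have x0: "x_in a j \<in> {0..1}" by (simp add: x_in_def)
    have rep: "u j (x, t) = exp (LBINT \<eta>=x..x_in a j. \<beta> j j (\<eta>, \<omega> j \<eta> x t)) *
        (R_op n m r u j (\<omega> j (x_in a j) x t) + P_op n p u j (\<omega> j (x_in a j) x t) + h j (\<omega> j (x_in a j) x t)) +
      (LBINT \<xi>=x_in a j..x. exp (LBINT \<eta>=x..\<xi>. \<beta> j j (\<eta>, \<omega> j \<eta> x t)) * (s j (\<xi>, \<omega> j \<xi> x t) * F (\<xi>, \<omega> j \<xi> x t)))"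
      if "x \<in> {0..1}" for x t
    proof -
      have "(x, t) \<in> strip" using that by simp
      with sol j have "u j (x, t) = c_fun a b \<omega> j (x_in a j) x t *
            (let s = \<omega> j (x_in a j) x t in R_op n m r u j s + P_op n p u j s + h j s) +
          (LBINT \<xi>=x_in a j..x. d_fun a b \<omega> j \<xi> x t *
            (let q = (\<xi>, \<omega> j \<xi> x t)
             in f j q - M_op n \<mu> u j q - (\<Sum>k\<in>{..<n} - {j}. b j k q * u k q)))"
        unfolding continuous_solution_def by blast
      thus ?thesis
        by (simp add: c_fun_def d_fun_def Let_def \<beta>_def s_def F_def field_simps)
    qed
    note int = along_from_integral_form[where u = "u j" and \<beta> = "\<beta> j j" and q = "\<lambda>q. s j q * F q" and
        B = "\<lambda>t. R_op n m r u j t + P_op n p u j t + h j t", OF c0[OF \<beta>C[OF j j]] Fc x0 rep]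
    have "s j q * F q - \<beta> j j q * u j q = along_rhs \<beta> f1 f2 u j q" if "q \<in> strip" for q
    proof -
      have "(\<Sum>k<n. \<beta> j k q * u k q) = \<beta> j j q * u j q + (\<Sum>k\<in>{..<n} - {j}. \<beta> j k q * u k q)"
        using j by (subst sum.remove[of _ j]) auto
      thus ?thesis
        by (simp add: along_rhs_def F_def M[OF j that] f1_def \<beta>_def algebra_simps sum_distrib_left)
    qed
    from iffD1[OF along_cong[OF this] int(1)]
    show "along (\<omega> j) (u j) (along_rhs \<beta> f1 f2 u j)" .
    show "u j (x_in a j, t) = (\<Sum>k\<in>E `` {j}. r j k t * u k (x_out k, t)) + H j t" for t
      using int(2)[of t] by (simp add: R[OF j] P[OF j] H_def)
  qed (rule uc)
  \<comment> \<open>\<open>weak\<close> holds once and for all, but \<open>f2\<close> and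
    \<open>H\<close> contain \<open>u\<close>, so their smoothness has to be reassessed at every
    order \<open>e\<close> before the system is used again.\<close>
  have "j < n \<longrightarrow> Cxt e (u j)" if "e \<le> l" for e j
    using that
  proof (induction e arbitrary: j)
    case 0
    thus ?case using uc by (simp add: Ck_dirs.simps)
  next
    case (Suc e)
    have le: "Suc e \<le> l" "e \<le> d" "e \<le> l" using Suc.prems d by auto
    have u: "Cxt e (u j)" if "j < n" for j using Suc.IH le that by auto
    have f1e: "Cxt e (f1 j)" "Ct (Suc e) (f1 j)" if "j < n" for j
      using f1C[OF that] Ck_dirs_le le by blast+
    have f2e: "Cxt e (f2 j)" "Cx (Suc e) (f2 j)" if "j < n" for j
    proof -
      have "Ck_dirs Basis e wedge (\<mu> j k)" "Ck_dirs {(0, 1, 0)} (Suc e) wedge (\<mu> j k)" if "k < n" for k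
        using \<mu>C[OF \<open>j < n\<close> that] Ck_dirs_le le by blast+
      thus "Cxt e (f2 j)" "Cx (Suc e) (f2 j)"
        unfolding f2_def by (auto intro!: Ck_dirs_minus Ck_dirs_sum Cxt_vol Cx_vol u)
    qed
    have \<beta>e: "Cxt (Suc e) (\<beta> j k)" if "j < n" "k < n" for j k
      using \<beta>C[OF that] le(1) by (rule Ck_dirs_le)
    have se: "Cxt (Suc e) (s j)" if "j < n" for j
      using sC[OF that] le(1) by (rule Ck_dirs_le)
    have rhs: "Ct e (along_rhs \<beta> f1 f2 u j)" if "j < n" for j
      unfolding along_rhs_def
      by (intro Ck_dirs_diff Ck_dirs_add Ck_dirs_mult Ck_dirs_sum Cxt_imp_Ct f1e f2e u that
          Ck_dirs_Suc_D[OF se] Ck_dirs_Suc_D[OF \<beta>e]) auto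
    have He: "C1 (Suc e) (H j)" if j: "j < n" for j
      unfolding H_def
    proof (intro Ck_dirs_add Ck_dirs_sum)
      fix k assume "k \<in> {..<n}"
      hence k: "k < n" by simp
      interpret char_flow "s k" "st k" "\<omega> k" "L k" using k by (rule flow)
      obtain q where q: "x_partial (p j k) q" "Ct d q" using pC(2)[OF j k] by blast
      show "C1 (Suc e) (\<lambda>t. prim (\<lambda>q. p j k q * u k q) (1, t))"
      proof (rule C1_weighted_integral[OF se[OF k] s_nonzero[OF k] Ck_dirs_le[OF pC(1)[OF j k] le(1)] q(1)
            Ck_dirs_le[OF q(2) le(2)] u[OF k] _ rhs[OF k]])
        show "along (\<omega> k) (u k) (along_rhs \<beta> f1 f2 u k)" using weak k by (simp add: weak_solution_def)
      qed
    next
      show "C1 (Suc e) (h j)" using hC[OF j] le(1) by (rule Ck_dirs_le)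
    qed
    have re: "C1 (Suc e) (r j k)" if "(j, k) \<in> E" for j k
      using rC[OF E_less[OF that]] le(1) by (rule Ck_dirs_le)
    show ?case
      using weak_solution_regular[OF se \<beta>e re He conjI[OF f1e] conjI[OF f2e] weak] by blast
  qed
  hence "Cxt l (u i)" using \<open>i < n\<close> by blast
  moreover have "\<forall>q\<in>strip. u i (q + (2 * pi) *\<^sub>R (0, 1)) = u i q"
    using sol \<open>i < n\<close> unfolding continuous_solution_def Ck_per_def by blast
  ultimately show ?thesis by (simp add: Ck_per_def Ck_on_eq_Ck_dirs)
qed

section \<open>The conditions on the zero-one matrix\<close>

definition edges :: "nat \<Rightarrow> real mat \<Rightarrow> (nat \<times> nat) set" where
  "edges n W = {(j, k). j < n \<and> k < n \<and> W $$ (j, k) \<noteq> 0}"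

lemma edges_subset: "edges n W \<subseteq> {..<n} \<times> {..<n}"
  by (auto simp: edges_def)

lemma finite_edges: "finite (edges n W)"
  by (rule finite_subset[OF edges_subset]) simp

lemma dag_adjacency_iff_acyclic:
  assumes "zero_one_mat n W"
  shows "dag_adjacency n W \<longleftrightarrow> acyclic (edges n W)"
proof
  assume "dag_adjacency n W"
  then obtain E where E: "E \<subseteq> {..<n} \<times> {..<n}" "acyclic E"
    "W = Matrix.mat n n (\<lambda>(j, k). if (j, k) \<in> E then 1 else 0)"
    by (auto simp: dag_adjacency_def)
  have "edges n W = E" using E(1) by (auto simp: edges_def E(3) split: if_splits)
  thus "acyclic (edges n W)" using E(2) by simp
next
  assume "acyclic (edges n W)"
  moreover have "W = Matrix.mat n n (\<lambda>(j, k). if (j, k) \<in> edges n W then 1 else 0)"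
    using assms by (intro eq_matI) (auto simp: zero_one_mat_def edges_def)
  ultimately show "dag_adjacency n W" using edges_subset unfolding dag_adjacency_def by blast
qed

lemma path_in_trancl:
  assumes "s < s'" "\<And>q. s \<le> q \<Longrightarrow> q < s' \<Longrightarrow> (i q, i (Suc q)) \<in> E"
  shows "(i s, i s') \<in> E\<^sup>+"
proof -
  have "(i s, i (s + Suc d)) \<in> E\<^sup>+" if "s + d < s'" for d
    using that
  proof (induction d)
    case 0
    thus ?case using assms(2)[of s] by auto
  next
    case (Suc d)
    hence "(i s, i (s + Suc d)) \<in> E\<^sup>+" by simp
    moreover have "(i (s + Suc d), i (s + Suc (Suc d))) \<in> E" using assms(2)[of "s + Suc d"] Suc.prems by simp
    ultimately show ?case by (rule trancl_into_trancl)
  qed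
  from this[of "s' - s - 1"] show ?thesis using assms(1) by simp
qed

text \<open>Pigeonhole: among \<open>n + 1\<close> indices below \<open>n\<close> two coincide, and
  the stretch between them would close a cycle unless one of its steps is not an edge.\<close>

lemma acyclic_imp_path_products_zero:
  assumes "acyclic (edges n W)"
  shows "path_products_zero n W"
  unfolding path_products_zero_def
proof (intro allI impI)
  fix i :: "nat \<Rightarrow> nat" assume i: "\<forall>s\<in>{1..n + 1}. i s < n"
  have "\<not> inj_on i {1..n + 1}"
  proof
    assume "inj_on i {1..n + 1}"
    hence "card {1..n + 1} \<le> card {..<n}" using i by (intro card_inj_on_le[of i]) auto
    thus False by simp
  qed
  then obtain s s' where s: "s \<in> {1..n + 1}" "s' \<in> {1..n + 1}" "i s = i s'" "s < s'"
    unfolding inj_on_def by (metis linorder_neqE_nat)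
  have "(i s, i s) \<notin> (edges n W)\<^sup>+" using assms by (simp add: acyclic_def)
  with path_in_trancl[OF s(4), of i "edges n W"] s(3)
  obtain q where q: "s \<le> q" "q < s'" "(i q, i (Suc q)) \<notin> edges n W" by auto
  hence "W $$ (i q, i (q + 1)) = 0" using i s by (auto simp: edges_def)
  moreover have "q \<in> {1..n}" using q s by auto
  ultimately show "(\<Prod>s=1..n. W $$ (i s, i (s + 1))) = 0" by (intro prod_zero) auto
qed

lemma index_mult_square:
  assumes "A \<in> carrier_mat n n" "B \<in> carrier_mat n n" "i < n" "j < n"
  shows "(A * B) $$ (i, j) = (\<Sum>q<n. A $$ (i, q) * B $$ (q, j))"
  using assms by (simp add: scalar_prod_def atLeast0LessThan)

lemma pow_mat_entry_path:
  fixes W :: "real mat"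
  assumes W: "W \<in> carrier_mat n n" and "(W ^\<^sub>m k) $$ (i, j) \<noteq> 0" "i < n" "j < n"
  shows "\<exists>\<pi>. \<pi> 0 = i \<and> \<pi> k = j \<and> (\<forall>s\<le>k. \<pi> s < n) \<and> (\<forall>s<k. W $$ (\<pi> s, \<pi> (Suc s)) \<noteq> 0)"
  using assms(2-)
proof (induction k arbitrary: j)
  case 0
  thus ?case using W by (intro exI[of _ "\<lambda>_. i"]) (auto split: if_splits)
next
  case (Suc k)
  have "(\<Sum>q<n. (W ^\<^sub>m k) $$ (i, q) * W $$ (q, j)) \<noteq> 0"
    using Suc.prems W by (simp add: index_mult_square[of _ n] del: index_mult_mat)
  then obtain q where q: "q < n" "(W ^\<^sub>m k) $$ (i, q) \<noteq> 0" "W $$ (q, j) \<noteq> 0"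
    by (metis (no_types, lifting) lessThan_iff mult_eq_0_iff sum.neutral)
  from Suc.IH[OF q(2) Suc.prems(2) q(1)] obtain \<pi> where
    \<pi>: "\<pi> 0 = i" "\<pi> k = q" "\<forall>s\<le>k. \<pi> s < n" "\<forall>s<k. W $$ (\<pi> s, \<pi> (Suc s)) \<noteq> 0" by blast
  show ?case
    using \<pi> q Suc.prems by (intro exI[of _ "\<pi>(Suc k := j)"]) (auto simp: less_Suc_eq le_Suc_eq)
qed

lemma path_products_zero_imp_nth_power_zero:
  assumes "zero_one_mat n W" "path_products_zero n W"
  shows "nth_power_zero n W"
  unfolding nth_power_zero_def
proof (rule eq_matI)
  have W: "W \<in> carrier_mat n n" using assms(1) by (simp add: zero_one_mat_def)
  show "dim_row (W ^\<^sub>m n) = dim_row (0\<^sub>m n n :: real mat)" "dim_col (W ^\<^sub>m n) = dim_col (0\<^sub>m n n :: real mat)"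
    using W by auto
  fix i j assume ij: "i < dim_row (0\<^sub>m n n :: real mat)" "j < dim_col (0\<^sub>m n n :: real mat)"
  show "(W ^\<^sub>m n) $$ (i, j) = 0\<^sub>m n n $$ (i, j)"
  proof (rule ccontr)
    assume "(W ^\<^sub>m n) $$ (i, j) \<noteq> 0\<^sub>m n n $$ (i, j)"
    then obtain \<pi> where \<pi>: "\<forall>s\<le>n. \<pi> s < n" "\<forall>s<n. W $$ (\<pi> s, \<pi> (Suc s)) \<noteq> 0"
      using pow_mat_entry_path[OF W, of n i j] ij by auto
    \<comment> \<open>Paths from \<open>pow_mat_entry_path\<close> are numbered from 0, the tuples
      from 1.\<close>
    define i' where "i' s = \<pi> (s - 1)" for s
    have "\<forall>s\<in>{1..n + 1}. i' s < n" using \<pi>(1) by (auto simp: i'_def)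
    hence "(\<Prod>s=1..n. W $$ (i' s, i' (s + 1))) = 0"
      using assms(2) unfolding path_products_zero_def by blast
    then obtain s where s: "s \<in> {1..n}" "W $$ (i' s, i' (s + 1)) = 0" by auto
    hence "W $$ (\<pi> (s - 1), \<pi> (Suc (s - 1))) = 0" by (simp add: i'_def)
    moreover have "s - 1 < n" using s(1) by auto
    ultimately show False using \<pi>(2) by blast
  qed
qed

text \<open>Nonnegative entries rule out cancellation, so a walk of length \<open>k\<close> makes
  the corresponding entry of the \<open>k\<close>-th power positive, and a cycle supplies
  arbitrarily long walks.\<close>

lemma nth_power_zero_imp_acyclic:
  assumes "zero_one_mat n W" "nth_power_zero n W"
  shows "acyclic (edges n W)"
  unfolding acyclic_def
proof (intro allI notI)
  have W: "W \<in> carrier_mat n n" and W01: "\<And>j k. j < n \<Longrightarrow> k < n \<Longrightarrow> W $$ (j, k) \<in> {0, 1}"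
    using assms(1) by (auto simp: zero_one_mat_def)
  have nonneg: "(W ^\<^sub>m k) $$ (i, j) \<ge> 0" if "i < n" "j < n" for k i j
    using that
  proof (induction k arbitrary: j)
    case 0
    thus ?case using W by simp
  next
    case (Suc k)
    have "W $$ (q, j) \<ge> 0" if "q < n" for q using W01[OF that Suc.prems(2)] by auto
    hence "(\<Sum>q<n. (W ^\<^sub>m k) $$ (i, q) * W $$ (q, j)) \<ge> 0"
      using Suc by (intro sum_nonneg mult_nonneg_nonneg) auto
    thus ?case using Suc.prems W by (simp add: index_mult_square[of _ n] del: index_mult_mat)
  qed
  have pos: "(W ^\<^sub>m k) $$ (i, j) > 0" if "(i, j) \<in> edges n W ^^ k" "i < n" "j < n" for k i j
    using that
  proof (induction k arbitrary: j)
    case 0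
    thus ?case using W by simp
  next
    case (Suc k)
    then obtain q where q: "(i, q) \<in> edges n W ^^ k" "(q, j) \<in> edges n W" by auto
    hence qn: "q < n" and "W $$ (q, j) = 1" using W01[of q j] by (auto simp: edges_def)
    with Suc.IH[OF q(1) Suc.prems(2) qn] have "(W ^\<^sub>m k) $$ (i, q) * W $$ (q, j) > 0" by simp
    moreover have "(W ^\<^sub>m k) $$ (i, r) * W $$ (r, j) \<ge> 0" if "r < n" for r
      using nonneg[OF Suc.prems(2) that] W01[OF that Suc.prems(3)] by auto
    ultimately have "(\<Sum>r<n. (W ^\<^sub>m k) $$ (i, r) * W $$ (r, j)) > 0"
      using qn by (intro sum_pos2[of _ q]) auto
    thus ?case using Suc.prems W by (simp add: index_mult_square[of _ n] del: index_mult_mat)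
  qed
  fix x assume "(x, x) \<in> (edges n W)\<^sup>+"
  then obtain k where k: "k > 0" "(x, x) \<in> edges n W ^^ k" by (auto simp: trancl_power)
  have kc: "(x, x) \<in> edges n W ^^ (k * c)" for c
    by (induction c) (use k(2) in \<open>auto simp: relpow_add\<close>)
  \<comment> \<open>\<open>n\<close> rounds of the cycle form a walk of length \<open>k * n\<close>,
    which is at least \<open>n\<close>; its first \<open>n\<close> steps make an entry of the
    \<open>n\<close>-th power positive.\<close>
  have "k * n = n + (k * n - n)" using k(1) by simp
  hence "(x, x) \<in> edges n W ^^ (n + (k * n - n))" using kc[of n] by simp
  hence "(x, x) \<in> edges n W ^^ n O edges n W ^^ (k * n - n)" by (simp only: relpow_add)
  then obtain y where y: "(x, y) \<in> edges n W ^^ n" "(y, x) \<in> edges n W ^^ (k * n - n)" by blast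
  have xn: "x < n" using k edges_subset[of n W] by (cases k) auto
  have yn: "y < n"
  proof (cases n)
    case 0
    thus ?thesis using xn by simp
  next
    case (Suc n')
    then obtain z where "(z, y) \<in> edges n W" using y(1) by auto
    thus ?thesis by (simp add: edges_def)
  qed
  from pos[OF y(1) xn yn] show False
    using assms(2) xn yn by (simp add: nth_power_zero_def)
qed

section \<open>Principal minors and cycles\<close>

lemma submatrix_carrier:
  assumes "W \<in> carrier_mat n n" "I \<subseteq> {..<n}"
  shows "submatrix W I I \<in> carrier_mat (card I) (card I)"
    and "i < card I \<Longrightarrow> j < card I \<Longrightarrow> submatrix W I I $$ (i, j) = W $$ (pick I i, pick I j)"
proof -
  have "{i. i < n \<and> i \<in> I} = I" using assms(2) by auto
  hence "submatrix W I I = Matrix.mat (card I) (card I) (\<lambda>(i, j). W $$ (pick I i, pick I j))"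
    using assms(1) unfolding submatrix_def by simp
  thus "submatrix W I I \<in> carrier_mat (card I) (card I)"
    "i < card I \<Longrightarrow> j < card I \<Longrightarrow> submatrix W I I $$ (i, j) = W $$ (pick I i, pick I j)"
    by simp_all
qed

lemma card_below_less:
  assumes "finite I" "(v :: nat) \<in> I"
  shows "card {a \<in> I. a < v} < card I"
  by (rule psubset_card_mono) (use assms in auto)

text \<open>In an acyclic graph every nonempty vertex set contains a sink, i.e. a zero row of the minor.\<close>

lemma acyclic_imp_principal_minors_zero:
  assumes "zero_one_mat n W" "acyclic (edges n W)"
  shows "principal_minors_zero n W"
  unfolding principal_minors_zero_def
proof (intro allI impI)
  fix I assume I: "I \<subseteq> {..<n} \<and> I \<noteq> {}"
  have W: "W \<in> carrier_mat n n" using assms(1) by (simp add: zero_one_mat_def)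
  have fin: "finite I" using I finite_subset by blast
  have "wf ((edges n W)\<inverse>)" by (rule finite_acyclic_wf_converse[OF finite_edges assms(2)])
  then obtain v where v: "v \<in> I" "\<And>y. (v, y) \<in> edges n W \<Longrightarrow> y \<notin> I"
    unfolding wf_eq_minimal using I by (metis converse_iff ex_in_conv)
  \<comment> \<open>The position of the sink \<open>v\<close> in the increasing enumeration of
    \<open>I\<close>, that is, the index of the zero row.\<close>
  define i where "i = card {a \<in> I. a < v}"
  have i: "i < card I" "pick I i = v"
    using card_below_less[OF fin v(1)] pick_card_in_set[OF v(1)] by (simp_all add: i_def)
  note A = submatrix_carrier[OF W conjunct1[OF I]]
  have zero: "submatrix W I I $$ (i, j) = 0" if "j < card I" for j
  proof -
    have "pick I j \<in> I" using that by (rule pick_in_set_le)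
    thus ?thesis using A(2)[OF i(1) that] i(2) v I by (auto simp: edges_def)
  qed
  have "signof p * (\<Prod>j = 0..<card I. submatrix W I I $$ (j, p j)) = 0" if "p permutes {0..<card I}" for p
  proof -
    have "p i < card I" using permutes_in_image[OF that, of i] i(1) by simp
    hence "(\<Prod>j = 0..<card I. submatrix W I I $$ (j, p j)) = 0"
      using i(1) zero by (intro prod_zero bexI[of _ i]) auto
    thus ?thesis by simp
  qed
  thus "Determinant.det (submatrix W I I) = 0"
    unfolding det_def'[OF A(1)] by (intro sum.neutral) auto
qed

text \<open>A minimal nonempty vertex set without sinks carries a single chordless cycle; its principal
  submatrix is a permutation matrix.\<close>

lemma principal_minors_zero_imp_acyclic:
  assumes "zero_one_mat n W" "principal_minors_zero n W"
  shows "acyclic (edges n W)"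
proof (rule ccontr)
  have W: "W \<in> carrier_mat n n" and W01: "\<And>j k. j < n \<Longrightarrow> k < n \<Longrightarrow> W $$ (j, k) \<in> {0, 1}"
    using assms(1) by (auto simp: zero_one_mat_def)
  define F where "F = {I. I \<subseteq> {..<n} \<and> I \<noteq> {} \<and> (\<forall>v\<in>I. \<exists>z\<in>I. (v, z) \<in> edges n W)}"
  assume "\<not> acyclic (edges n W)"
  then obtain x where x: "(x, x) \<in> (edges n W)\<^sup>+" by (auto simp: acyclic_def)
  have "{v. (v, v) \<in> (edges n W)\<^sup>+} \<in> F"
    unfolding F_def
  proof (intro CollectI conjI ballI)
    show "{v. (v, v) \<in> (edges n W)\<^sup>+} \<subseteq> {..<n}"
      using trancl_subset_Sigma[OF edges_subset[of n W]] by auto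
    show "{v. (v, v) \<in> (edges n W)\<^sup>+} \<noteq> {}" using x by auto
    fix v assume "v \<in> {v. (v, v) \<in> (edges n W)\<^sup>+}"
    then obtain z where z: "(v, z) \<in> edges n W" "(z, v) \<in> (edges n W)\<^sup>*"
      by (auto dest: tranclD)
    thus "\<exists>z\<in>{v. (v, v) \<in> (edges n W)\<^sup>+}. (v, z) \<in> edges n W"
      by (auto intro: rtrancl_into_trancl1)
  qed
  then obtain I where IF: "I \<in> F" and I_min: "\<And>J. J \<in> F \<Longrightarrow> card I \<le> card J"
    using ex_has_least_nat[of "\<lambda>I. I \<in> F" _ card] by blast
  have I: "I \<subseteq> {..<n}" "I \<noteq> {}" "\<And>v. v \<in> I \<Longrightarrow> \<exists>z\<in>I. (v, z) \<in> edges n W"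
    using IF by (auto simp: F_def)
  have fin: "finite I" using I(1) finite_subset by blast
  \<comment> \<open>The image of \<open>I\<close> under a choice of successors is again without
    sinks, so minimality makes the choice onto and, \<open>I\<close> being finite,
    injective.\<close>
  have surj: "g ` I = I" if g: "\<And>v. v \<in> I \<Longrightarrow> g v \<in> I \<and> (v, g v) \<in> edges n W" for g
  proof (rule card_seteq[OF fin])
    show "g ` I \<subseteq> I" using g by auto
    have "\<exists>z\<in>g ` I. (g v, z) \<in> edges n W" if "v \<in> I" for v
      using g[OF that] g[of "g v"] by (intro bexI[of _ "g (g v)"]) auto
    hence "g ` I \<in> F" using g I(1,2) by (auto simp: F_def)
    thus "card I \<le> card (g ` I)" by (rule I_min)
  qed
  obtain \<sigma> where \<sigma>: "\<And>v. v \<in> I \<Longrightarrow> \<sigma> v \<in> I \<and> (v, \<sigma> v) \<in> edges n W" using I(3) by metis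
  have \<sigma>I: "\<sigma> ` I = I" by (rule surj) (rule \<sigma>)
  have inj: "inj_on \<sigma> I" by (rule eq_card_imp_inj_on[OF fin]) (simp only: \<sigma>I)
  have chordless: "z = \<sigma> v" if v: "v \<in> I" "z \<in> I" "(v, z) \<in> edges n W" for v z
  proof (rule ccontr)
    assume neq: "z \<noteq> \<sigma> v"
    have "z \<in> \<sigma> ` I" using v(2) by (simp only: \<sigma>I)
    then obtain v' where v': "v' \<in> I" "\<sigma> v' = z" by auto
    \<comment> \<open>Redirecting \<open>v\<close> to \<open>z\<close> is again a choice of
      successors and hence injective on \<open>I\<close>, yet the \<open>\<sigma>\<close>-preimage
      \<open>v'\<close> of \<open>z\<close> is sent to \<open>z\<close> as well.\<close>
    define g where "g = \<sigma>(v := z)"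
    have "g ` I = I" by (rule surj) (use \<sigma> v in \<open>auto simp: g_def\<close>)
    hence "inj_on g I" by (intro eq_card_imp_inj_on[OF fin]) (simp only:)
    moreover have "v' \<noteq> v" "g v' = g v" using v' neq by (auto simp: g_def)
    ultimately show False using v'(1) v(1) by (auto dest: inj_onD)
  qed
  define c where "c = card I"
  define A where "A = submatrix W I I"
  note sub = submatrix_carrier[OF W I(1), folded A_def c_def]
  have pickI: "pick I i \<in> I" if "i < c" for i using that unfolding c_def by (rule pick_in_set_le)
  have pick_inj: "i = j" if "i < c" "j < c" "pick I i = pick I j" for i j
  proof -
    have "card {a \<in> I. a < pick I i} = i" "card {a \<in> I. a < pick I j} = j"
      by (rule card_pick_le[OF that(1)[unfolded c_def]], rule card_pick_le[OF that(2)[unfolded c_def]])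
    thus ?thesis unfolding that(3) by (rule trans[OF sym])
  qed
  \<comment> \<open>\<open>\<sigma>\<close> transported to row indices: counting the smaller
    elements of \<open>I\<close> inverts \<open>pick\<close>.\<close>
  define nxt where "nxt i = card {a \<in> I. a < \<sigma> (pick I i)}" for i
  have nxt: "nxt i < c" "pick I (nxt i) = \<sigma> (pick I i)" if "i < c" for i
    using card_below_less[OF fin] pick_card_in_set \<sigma>[OF pickI[OF that]] by (auto simp: nxt_def c_def)
  have Aij: "A $$ (i, j) = (if j = nxt i then 1 else 0)" if ij: "i < c" "j < c" for i j
  proof -
    have bounds: "pick I i < n" "pick I j < n" using pickI ij I(1) by auto
    show ?thesis
    proof (cases "j = nxt i")
      case True
      hence "(pick I i, pick I j) \<in> edges n W" using \<sigma>[OF pickI[OF ij(1)]] nxt(2)[OF ij(1)] by simp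
      thus ?thesis using True sub(2)[OF ij] W01[OF bounds] by (auto simp: edges_def)
    next
      case False
      have "(pick I i, pick I j) \<notin> edges n W"
      proof
        assume "(pick I i, pick I j) \<in> edges n W"
        hence "pick I j = pick I (nxt i)"
          using chordless[OF pickI[OF ij(1)] pickI[OF ij(2)]] nxt(2)[OF ij(1)] by simp
        thus False using pick_inj[OF ij(2) nxt(1)[OF ij(1)]] False by simp
      qed
      thus ?thesis using False sub(2)[OF ij] bounds by (auto simp: edges_def)
    qed
  qed
  \<comment> \<open>The rows of \<open>A\<close> are distinct unit vectors. The product with the
    transpose gives a squared determinant of 1 without computing the sign of the
    permutation.\<close>
  have "A * transpose_mat A = 1\<^sub>m c"
  proof (rule eq_matI)
    fix i j assume "i < dim_row (1\<^sub>m c :: real mat)" "j < dim_col (1\<^sub>m c :: real mat)"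
    hence ij: "i < c" "j < c" by auto
    have "(A * transpose_mat A) $$ (i, j) = (\<Sum>q<c. A $$ (i, q) * transpose_mat A $$ (q, j))"
      using sub(1) ij by (intro index_mult_square) auto
    also have "\<dots> = (\<Sum>q<c. if q = nxt i then (if nxt i = nxt j then 1 else 0) else 0)"
      using sub(1) ij by (intro sum.cong refl) (auto simp: Aij)
    also have "\<dots> = (if nxt i = nxt j then 1 else 0)"
      using nxt(1)[OF ij(1)] by simp
    also have "nxt i = nxt j \<longleftrightarrow> i = j"
      using nxt(2) ij pickI inj pick_inj by (metis inj_onD)
    finally show "(A * transpose_mat A) $$ (i, j) = 1\<^sub>m c $$ (i, j)" using ij by simp
  qed (use sub(1) in auto)
  hence "Determinant.det A * Determinant.det (transpose_mat A) = 1"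
    using det_mult[OF sub(1), of "transpose_mat A"] sub(1) by simp
  moreover have "Determinant.det A = 0"
    using assms(2) I(1,2) unfolding principal_minors_zero_def A_def by blast
  ultimately show False by simp
qed

theorem theorem4p1:
  fixes n m l :: nat
    and a f :: "nat \<Rightarrow> real \<times> real \<Rightarrow> real"
    and b p :: "nat \<Rightarrow> nat \<Rightarrow> real \<times> real \<Rightarrow> real"
    and \<mu> :: "nat \<Rightarrow> nat \<Rightarrow> real \<times> real \<times> real \<Rightarrow> real"
    and r rt :: "nat \<Rightarrow> nat \<Rightarrow> real \<Rightarrow> real"
    and h :: "nat \<Rightarrow> real \<Rightarrow> real"
    and \<omega> :: "nat \<Rightarrow> real \<Rightarrow> real \<Rightarrow> real \<Rightarrow> real"
    and W :: "real mat"
  assumes n: "2 \<le> n" and m: "m \<le> n" and l: "1 \<le> l"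
    and a_pos: "\<And>j q. j < m \<Longrightarrow> q \<in> strip \<Longrightarrow> a j q > 0"
    and a_neg: "\<And>j q. m \<le> j \<Longrightarrow> j < n \<Longrightarrow> q \<in> strip \<Longrightarrow> a j q < 0"
    and a_nonzero: "\<And>j q. j < n \<Longrightarrow> q \<in> strip \<Longrightarrow> a j q \<noteq> 0"
    and a_distinct: "\<And>j k q. j < n \<Longrightarrow> k < n \<Longrightarrow> j \<noteq> k \<Longrightarrow> q \<in> strip \<Longrightarrow> a j q \<noteq> a k q"
    and a_reg: "\<And>j. j < n \<Longrightarrow> Ck_per (0, 1) l strip (a j)"
    and b_reg: "\<And>j k. j < n \<Longrightarrow> k < n \<Longrightarrow> Ck_per (0, 1) l strip (b j k)"
    and r_reg: "\<And>j k. j < n \<Longrightarrow> k < n \<Longrightarrow> Ck_per 1 l UNIV (r j k)"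
    and h_reg: "\<And>j. j < n \<Longrightarrow> Ck_per 1 l UNIV (h j)"
    and f_reg: "\<And>j. j < n \<Longrightarrow> Ck_per (0, 1) (l - 1) strip (f j) \<and> Ck_dir_on (0, 1) l strip (f j)"
    and \<mu>_reg: "\<And>j k. j < n \<Longrightarrow> k < n \<Longrightarrow>
          Ck_per (0, 0, 1) (l - 1) wedge (\<mu> j k) \<and> Ck_dir_on (0, 1, 0) l wedge (\<mu> j k)"
    and p_reg: "\<And>j k. j < n \<Longrightarrow> k < n \<Longrightarrow>
          Ck_per (0, 1) 0 strip (p j k) \<and> Ck_dir_on (0, 1) l strip (p j k) \<and>
          (\<exists>q. has_partial_on (1, 0) strip (p j k) q \<and> Ck_dir_on (0, 1) (l - 1) strip q)"
    and \<omega>: "characteristics n a \<omega>"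
    and W: "zero_one_mat n W"
    and rt_reg: "\<And>j k. j < n \<Longrightarrow> k < n \<Longrightarrow> Ck_per 1 l UNIV (rt j k)"
    and r_eq: "\<And>j k t. j < n \<Longrightarrow> k < n \<Longrightarrow> r j k t = rt j k t * W $$ (j, k)"
  shows "(path_products_zero n W \<longleftrightarrow> principal_minors_zero n W) \<and>
         (principal_minors_zero n W \<longleftrightarrow> nth_power_zero n W) \<and>
         (nth_power_zero n W \<longleftrightarrow> dag_adjacency n W) \<and>
         (path_products_zero n W \<or> principal_minors_zero n W \<or> nth_power_zero n W \<or> dag_adjacency n W
           \<longrightarrow> (\<forall>u. continuous_solution n m a b \<mu> p r f h \<omega> u \<longrightarrow>
                    (\<forall>j<n. Ck_per (0, 1) l strip (u j))))"
proof -
  have acyclic: "dag_adjacency n W \<longleftrightarrow> acyclic (edges n W)" by (rule dag_adjacency_iff_acyclic[OF W])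
  \<comment> \<open>All conditions are compared with acyclicity of \<open>edges n W\<close>: path
    products and powers lie on one circle of implications, the minors are tied to it by one
    implication each way.\<close>
  have equiv: "path_products_zero n W \<longleftrightarrow> principal_minors_zero n W"
    "principal_minors_zero n W \<longleftrightarrow> nth_power_zero n W" "nth_power_zero n W \<longleftrightarrow> dag_adjacency n W"
    using acyclic acyclic_imp_path_products_zero path_products_zero_imp_nth_power_zero[OF W]
      nth_power_zero_imp_acyclic[OF W] acyclic_imp_principal_minors_zero[OF W]
      principal_minors_zero_imp_acyclic[OF W] by blast+
  have "Ck_per (0, 1) l strip (u j)"
    if "dag_adjacency n W" "continuous_solution n m a b \<mu> p r f h \<omega> u" "j < n" for u j
  proof (rule continuous_solution_regular[OF m l a_nonzero a_distinct a_reg b_reg r_reg h_reg f_reg \<mu>_reg p_reg \<omega>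
        edges_subset _ _ that(2,3)])
    show "acyclic (edges n W)" using that(1) acyclic by blast
    show "r j k t = 0" if "j < n" "k < n" "(j, k) \<notin> edges n W" for j k t
      using that r_eq[OF that(1,2)] by (simp add: edges_def)
  qed
  with equiv show ?thesis by blast
qed

end
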